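(* Let $\alpha>0$ and assume the following. (i) $h$ and $h^n$ ($n\ge1$) are continuously differentiable; $\langle\theta-\theta^*,h(\theta)\rangle>0$ for $\theta\ne\theta^*$ and $\langle\theta-\theta^{*,n},h^n(\theta)\rangle>0$ for $\theta\neq\theta^{*,n}$; $h^n\to h$ and $Dh^n\to Dh$ locally uniformly on $\mathbb{R}^d$; $Dh(\theta^* )$ is non-singular; and for all $\theta\in\mathbb{R}^d$ the limit $\mathcal{E}(h,\alpha,\theta):=\lim_{n}n^{\alpha}(h^n(\theta)-h(\theta))$ exists. (ii) $h$ is twice continuously differentiable in a neighborhood of $\theta^*$; all eigenvalues of $Dh(\theta^* )$ have strictly positive real parts; $\theta\mapsto\mathbb{E}[H(\theta,U)H(\theta,U)^T]$ is continuous on $\mathbb{R}^d$; there is $\varepsilon>0$ such that $\theta\mapsto\mathbb{E}[|H(\theta,U)|^{2+\varepsilon}]$ is locally bounded on $\mathbb{R}^d$; and $\mathbb{E}[H(\theta^*,U)H(\theta^*,U)^T]$ is positive definite. (iii) There exists $b\in(0,1]$ such that $\sup_{n\ge1,\ \theta\ne\theta'}\mathbb{E}[|H(\theta,U^n)-H(\theta',U^n)|^2]/|\theta-\theta'|^{2b}<+\infty$. (iv) There exists $\eta>0$ such that for all $R>0$, $\sup_{|\theta|\le R,\,n\ge1}\mathbb{E}[|H(\theta,U^n)|^{2+\eta}]<+\infty$; and $\theta\mapsto\mathbb{E}[H(\theta,U^n)H(\theta,U^n)^T]$ converges locally uniformly, as $n\to\infty$, to $\theta\mapsto\mathbb{E}[H(\theta,U)H(\theta,U)^T]$.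 (v) There exists $\underline{\lambda}>0$ such that for all $n\ge1$ and $\theta\in\mathbb{R}^d$, $\langle\theta-\theta^{*,n},h^n(\theta)\rangle\ge\underline{\lambda}|\theta-\theta^{*,n}|^2$. (vi) Each $h^n$ is twice continuously differentiable and $Dh^n$ is Lipschitz continuous uniformly in $n$. (vii) $\gamma_p=\gamma(p)$, $p\ge1$, where $\gamma$ is a positive function on $[0,+\infty)$ decreasing to zero which satisfies one of: (HS1) $\gamma$ varies regularly with exponent $(-a)$, $a\in[0,1)$; or (HS2) $\gamma(t)=\gamma_0/t$ for $t\ge1$ with $2\underline{\lambda}\gamma_0>1$. Then, as $n\to+\infty$, $$n^{\alpha}\big(\theta^n_{\gamma^{-1}(1/n^{2\alpha})}-\theta^*\big)\Longrightarrow-\big(Dh(\theta^* )\big)^{-1}\mathcal{E}(h,\alpha,\theta^* )+\mathcal{N}(0,\Sigma^* ),$$ where $$\Sigma^*:=\int_0^{\infty}e^{-s(Dh(\theta^* )-\zeta I_d)}\,\mathbb{E}[H(\theta^*,U)H(\theta^*,U)^T]\,\big(e^{-s(Dh(\theta^* )-\zeta I_d)}\big)^T\,ds,$$ with $\zeta=0$ if (HS1) holds and $\zeta=1/(2\gamma_0)$ if (HS2) holds.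
   Context: Let $H:\mathbb{R}^d\times\mathbb{R}^q\to\mathbb{R}^d$ be Borel, $U$ and $U^n$ ($n\ge1$) be $\mathbb{R}^q$-valued random vectors, $h(\theta)=\mathbb{E}[H(\theta,U)]$, $h^n(\theta)=\mathbb{E}[H(\theta,U^n)]$; $\theta^*$ is the unique zero of $h$ and $\theta^{*,n}$ the unique zero of $h^n$. For each $n\ge1$ the scheme is $$\theta^n_{p+1}=\theta^n_p-\gamma_{p+1}H(\theta^n_p,(U^n)^{p+1}),\quad p\ge0,$$ where $((U^n)^p)_{p\ge1}$ is i.i.d. with the law of $U^n$ and $\theta^n_0$ is independent of $((U^n)^p)_{p\ge1}$ with $\sup_{n\ge1}\mathbb{E}[|\theta^n_0|^2]<+\infty$. $\gamma$ varies regularly with exponent $(-a)$ means $\lim_{t\to+\infty}\gamma(tx)/\gamma(t)=x^{-a}$ for every $x>0$. $\gamma^{-1}$ denotes the inverse function of $\gamma$; a non-integer number of steps is understood as its integer part. $\Longrightarrow$ is convergence in law; $c+\mathcal{N}(0,\Sigma)$ is the Gaussian law with mean $c$ and covariance $\Sigma$. *)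

theory Defs
  imports "HOL-Probability.Probability"
begin

section \<open>Analysis in \<open>\<real>\<^sup>d\<close>\<close>

text \<open>On an open set, of class \<open>C\<^sup>1\<close> resp. \<open>C\<^sup>2\<close>.\<close>

definition C1_on :: "'a::real_normed_vector set \<Rightarrow> ('a \<Rightarrow> 'b::real_normed_vector) \<Rightarrow> bool" where
  "C1_on S f \<longleftrightarrow> (\<exists>f' :: 'a \<Rightarrow> 'a \<Rightarrow>\<^sub>L 'b.
     (\<forall>x\<in>S. (f has_derivative blinfun_apply (f' x)) (at x)) \<and> continuous_on S f')"

definition C2_on :: "'a::real_normed_vector set \<Rightarrow> ('a \<Rightarrow> 'b::real_normed_vector) \<Rightarrow> bool" where
  "C2_on S f \<longleftrightarrow> (\<exists>f' :: 'a \<Rightarrow> 'a \<Rightarrow>\<^sub>L 'b.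
     (\<forall>x\<in>S. (f has_derivative blinfun_apply (f' x)) (at x)) \<and> C1_on S f')"

definition locally_uniform_limit ::
  "('i \<Rightarrow> 'a::metric_space \<Rightarrow> 'b::metric_space) \<Rightarrow> ('a \<Rightarrow> 'b) \<Rightarrow> 'i filter \<Rightarrow> bool" where
  "locally_uniform_limit f l F \<longleftrightarrow> (\<forall>x. \<exists>r>0. uniform_limit (ball x r) f l F)"

definition locally_bounded :: "('a::metric_space \<Rightarrow> ennreal) \<Rightarrow> bool" where
  "locally_bounded f \<longleftrightarrow> (\<forall>x. \<exists>r>0. (SUP y\<in>ball x r. f y) < \<infinity>)"

definition regularly_varying :: "(real \<Rightarrow> real) \<Rightarrow> real \<Rightarrow> bool" where
  "regularly_varying g \<rho> \<longleftrightarrow> (\<forall>x>0. ((\<lambda>t. g (t * x) / g t) \<longlongrightarrow> x powr \<rho>) at_top)"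

text \<open>
  The inverse of a decreasing function on \<open>[0, \<infinity>)\<close>. On the range of a strictly decreasing
  function this is the inverse function (lemma \<open>decreasing_inverse_eq\<close>); the infimum extends it
  to levels that are skipped by a jump or attained on a whole interval.
\<close>

definition decreasing_inverse :: "(real \<Rightarrow> real) \<Rightarrow> real \<Rightarrow> real" where
  "decreasing_inverse g y = Inf {t. 0 \<le> t \<and> g t \<le> y}"

lemma decreasing_inverse_eq:
  assumes dec: "\<And>s t. 0 \<le> s \<Longrightarrow> s < t \<Longrightarrow> g t < g s" and y: "y \<in> g ` {0..}"
  shows "decreasing_inverse g y = the_inv_into {0..} g y"
proof -
  from y obtain t where t: "0 \<le> t" "y = g t" by auto
  have inj: "inj_on g {0..}"
    by (rule inj_onI) (metis atLeast_iff dec less_irrefl linorder_neqE)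
  have "{s. 0 \<le> s \<and> g s \<le> y} = {t..}"
    using t dec by (auto simp: not_less) (metis dec linorder_not_le, metis dec le_less order.refl)
  then show ?thesis
    using t inj by (simp add: decreasing_inverse_def the_inv_into_f_f)
qed

section \<open>Matrices\<close>

definition outer :: "real ^ 'd \<Rightarrow> real ^ 'd ^ 'd" where
  "outer v = (\<chi> i j. v $ i * v $ j)"

definition positive_definite :: "real ^ 'd ^ 'd \<Rightarrow> bool" where
  "positive_definite A \<longleftrightarrow> transpose A = A \<and> (\<forall>v. v \<noteq> 0 \<longrightarrow> v \<bullet> (A *v v) > 0)"

definition complex_eigenvalue :: "real ^ 'd ^ 'd \<Rightarrow> complex \<Rightarrow> bool" where
  "complex_eigenvalue A z \<longleftrightarrow>
     (\<exists>v :: complex ^ 'd. v \<noteq> 0 \<and> map_matrix complex_of_real A *v v = z *s v)"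

text \<open>
  The product and powers of the algebra structure on \<open>real ^ 'd ^ 'd\<close> are componentwise, so
  powers and the exponential series are written with the matrix product.
\<close>

primrec matrix_power :: "real ^ 'd ^ 'd \<Rightarrow> nat \<Rightarrow> real ^ 'd ^ 'd" where
  "matrix_power A 0 = mat 1"
| "matrix_power A (Suc k) = A ** matrix_power A k"

definition matrix_exp :: "real ^ 'd ^ 'd \<Rightarrow> real ^ 'd ^ 'd" where
  "matrix_exp A = (\<Sum>k. (1 / fact k) *\<^sub>R matrix_power A k)"

section \<open>Laws on \<open>\<real>\<^sup>d\<close>\<close>

definition conv_in_law ::
  "(nat \<Rightarrow> 'a::topological_space measure) \<Rightarrow> 'a measure \<Rightarrow> bool" where
  "conv_in_law \<mu> \<nu> \<longleftrightarrow> (\<forall>f :: 'a \<Rightarrow> real. continuous_on UNIV f \<longrightarrow> bounded (range f) \<longrightarrow>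
     (\<lambda>n. \<integral>x. f x \<partial>\<mu> n) \<longlonglongrightarrow> (\<integral>x. f x \<partial>\<nu>))"

text \<open>
  The Gaussian law with mean \<open>c\<close> and (positive semidefinite, possibly singular) covariance
  \<open>\<Sigma>\<close>: the law of \<open>c + S Z\<close> where \<open>S S\<^sup>T = \<Sigma>\<close> and \<open>Z\<close> has independent standard normal
  components. By lemma \<open>gaussian_char\<close> its characteristic function, hence the law itself, does
  not depend on the choice of \<open>S\<close>.
\<close>

definition gaussian_image :: "real ^ 'd \<Rightarrow> real ^ 'd ^ 'd \<Rightarrow> (real ^ 'd) measure" where
  "gaussian_image c S =
     distr (\<Pi>\<^sub>M i\<in>UNIV. std_normal_distribution) borel (\<lambda>z. c + S *v (\<chi> i. z i))"

definition gaussian :: "real ^ 'd \<Rightarrow> real ^ 'd ^ 'd \<Rightarrow> (real ^ 'd) measure" where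
  "gaussian c \<Sigma> = gaussian_image c (SOME S. S ** transpose S = \<Sigma>)"

lemma measurable_gaussian_image:
  "(\<lambda>z. c + S *v (\<chi> i. z i)) \<in> (\<Pi>\<^sub>M i\<in>UNIV. std_normal_distribution) \<rightarrow>\<^sub>M borel"
  for S :: "real ^ 'd ^ 'd"
proof -
  have "(\<lambda>z. \<chi> i. z i) \<in> (\<Pi>\<^sub>M i\<in>UNIV. std_normal_distribution) \<rightarrow>\<^sub>M (borel :: (real ^ 'd) measure)"
    by (subst borel_measurable_euclidean_space)
       (auto simp: Basis_vec_def inner_axis axis_eq_axis intro!: measurable_component_singleton
         borel_measurable_const)
  moreover have "(\<lambda>x. c + S *v x) \<in> borel \<rightarrow>\<^sub>M borel"
    by (intro borel_measurable_continuous_onI continuous_intros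
          linear_continuous_on matrix_vector_mul_bounded_linear)
  ultimately show ?thesis
    using measurable_compose by fastforce
qed

lemma gaussian_char:
  fixes c :: "real ^ 'd"
  assumes "\<exists>S :: real ^ 'd ^ 'd. S ** transpose S = \<Sigma>"
  shows "(CLINT x|gaussian c \<Sigma>. iexp (v \<bullet> x)) =
    iexp (v \<bullet> c) * complex_of_real (exp (- (v \<bullet> (\<Sigma> *v v)) / 2))"
proof -
  define S :: "real ^ 'd ^ 'd" where "S = (SOME S. S ** transpose S = \<Sigma>)"
  have S: "S ** transpose S = \<Sigma>"
    unfolding S_def using assms by (rule someI_ex)
  define w where "w = transpose S *v v"
  interpret N: prob_space std_normal_distribution
    by (rule prob_space_normal_density) simp
  interpret product_sigma_finite "\<lambda>_::'d. std_normal_distribution" ..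
  have inner_S: "v \<bullet> (S *v x) = w \<bullet> x" for x
    unfolding w_def by (simp add: dot_lmul_matrix)
  have "(CLINT x|gaussian c \<Sigma>. iexp (v \<bullet> x)) =
      (CLINT z|(\<Pi>\<^sub>M i\<in>(UNIV::'d set). std_normal_distribution). iexp (v \<bullet> (c + S *v (\<chi> i. z i))))"
    unfolding gaussian_def gaussian_image_def S_def[symmetric]
    by (rule integral_distr[OF measurable_gaussian_image]) simp
  also have "\<dots> = (CLINT z|(\<Pi>\<^sub>M i\<in>(UNIV::'d set). std_normal_distribution).
      iexp (v \<bullet> c) * (\<Prod>i\<in>UNIV. iexp (w $ i * z i)))"
    by (intro Bochner_Integration.integral_cong refl)
       (simp add: inner_add_right inner_S inner_vec_def[of w] exp_add[symmetric] exp_sum[symmetric]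
          distrib_left sum_distrib_left)
  also have "\<dots> = iexp (v \<bullet> c) * (\<Prod>i\<in>UNIV. CLINT x|std_normal_distribution. iexp (w $ i * x))"
    by (subst integral_mult_right_zero, subst product_integral_prod)
       (auto intro!: N.integrable_const_bound[where B=1])
  also have "(\<Prod>i\<in>UNIV. CLINT x|std_normal_distribution. iexp (w $ i * x)) =
      (\<Prod>i\<in>UNIV. complex_of_real (exp (- ((w $ i)\<^sup>2) / 2)))"
    using char_std_normal_distribution by (simp add: char_def fun_eq_iff)
  also have "\<dots> = complex_of_real (exp (- (w \<bullet> w) / 2))"
    by (simp add: exp_sum[symmetric] of_real_prod[symmetric] inner_vec_def power2_eq_square
          sum_negf sum_divide_distrib del: of_real_prod)
  also have "w \<bullet> w = v \<bullet> (\<Sigma> *v v)"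
    by (metis S inner_S w_def matrix_vector_mul_assoc)
  finally show ?thesis .
qed

text \<open>
  Independence of two random variables; unlike \<open>prob_space.indep_var\<close> they may take values in
  different types.
\<close>

definition indep_rvs ::
  "'w measure \<Rightarrow> 'a measure \<Rightarrow> ('w \<Rightarrow> 'a) \<Rightarrow> 'b measure \<Rightarrow> ('w \<Rightarrow> 'b) \<Rightarrow> bool" where
  "indep_rvs M MX X MY Y \<longleftrightarrow> X \<in> M \<rightarrow>\<^sub>M MX \<and> Y \<in> M \<rightarrow>\<^sub>M MY \<and>
     prob_space.indep_set M {X -` A \<inter> space M | A. A \<in> sets MX} {Y -` B \<inter> space M | B. B \<in> sets MY}"

section \<open>Stochastic approximation\<close>

text \<open>The mean field \<open>\<theta> \<mapsto> E[H(\<theta>,X)]\<close> and \<open>\<theta> \<mapsto> E[H(\<theta>,X) H(\<theta>,X)\<^sup>T]\<close>.\<close>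

definition mean_field ::
  "'w measure \<Rightarrow> (real ^ 'd \<Rightarrow> real ^ 'q \<Rightarrow> real ^ 'd) \<Rightarrow> ('w \<Rightarrow> real ^ 'q) \<Rightarrow> real ^ 'd \<Rightarrow> real ^ 'd" where
  "mean_field M H X \<theta> = (\<integral>\<omega>. H \<theta> (X \<omega>) \<partial>M)"

definition second_moment ::
  "'w measure \<Rightarrow> (real ^ 'd \<Rightarrow> real ^ 'q \<Rightarrow> real ^ 'd) \<Rightarrow> ('w \<Rightarrow> real ^ 'q) \<Rightarrow> real ^ 'd \<Rightarrow> real ^ 'd ^ 'd" where
  "second_moment M H X \<theta> = (\<integral>\<omega>. outer (H \<theta> (X \<omega>)) \<partial>M)"

primrec sa_scheme ::
  "(real \<Rightarrow> real) \<Rightarrow> (real ^ 'd \<Rightarrow> real ^ 'q \<Rightarrow> real ^ 'd) \<Rightarrow> ('w \<Rightarrow> real ^ 'd) \<Rightarrow>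
   (nat \<Rightarrow> 'w \<Rightarrow> real ^ 'q) \<Rightarrow> nat \<Rightarrow> 'w \<Rightarrow> real ^ 'd" where
  "sa_scheme \<gamma> H \<theta>0 V 0 \<omega> = \<theta>0 \<omega>"
| "sa_scheme \<gamma> H \<theta>0 V (Suc p) \<omega> = sa_scheme \<gamma> H \<theta>0 V p \<omega> -
     \<gamma> (real (Suc p)) *\<^sub>R H (sa_scheme \<gamma> H \<theta>0 V p \<omega>) (V (Suc p) \<omega>)"

definition discretization_error ::
  "(nat \<Rightarrow> 'a \<Rightarrow> 'b::real_normed_vector) \<Rightarrow> ('a \<Rightarrow> 'b) \<Rightarrow> real \<Rightarrow> 'a \<Rightarrow> 'b" where
  "discretization_error hn h \<alpha> \<theta> = lim (\<lambda>n. (real n powr \<alpha>) *\<^sub>R (hn n \<theta> - h \<theta>))"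

definition asymptotic_covariance :: "real ^ 'd ^ 'd \<Rightarrow> real ^ 'd ^ 'd \<Rightarrow> real \<Rightarrow> real ^ 'd ^ 'd" where
  "asymptotic_covariance A \<Gamma> \<zeta> =
     (LBINT s:{0..}. matrix_exp ((- s) *\<^sub>R (A - \<zeta> *\<^sub>R mat 1)) ** \<Gamma> **
        transpose (matrix_exp ((- s) *\<^sub>R (A - \<zeta> *\<^sub>R mat 1))))"

end

theory Submission
  imports Defs
begin

text \<open>
  The error \<open>\<delta>\<^sub>p = \<theta>\<^sub>p - \<theta>\<^sup>*\<^sup>n\<close> has second moments of order \<open>\<gamma>\<^sub>p\<close>, uniformly in \<open>n\<close>. Variation of
  constants, with the exact flow \<open>e\<^sup>-\<^sup>s\<^sup>A\<close> of the linearised equation run in the time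
  \<open>s\<^sub>p = \<gamma>\<^sub>1 + \<dots> + \<gamma>\<^sub>p\<close>, expresses \<open>\<delta>\<^sub>N / \<surd>\<gamma>\<^sub>N\<close> as a weighted sum of the innovations up to
  terms that vanish in \<open>L\<^sup>1\<close>. By assumption (iii) the innovation \<open>H(\<theta>\<^sub>p\<^sub>-\<^sub>1, V\<^sub>p)\<close> may be replaced by
  \<open>H(\<theta>\<^sup>*\<^sup>n, V\<^sub>p)\<close> plus its mean, so no martingale limit theorem is needed: the weighted sum of the
  independent vectors \<open>H(\<theta>\<^sup>*\<^sup>n, V\<^sub>p)\<close> is handled by a second-order expansion of characteristic
  functions, and its variance is a Riemann sum for \<open>\<Sigma>\<^sup>*\<close>. Letting \<open>n \<rightarrow> \<infinity>\<close> in (v) shows that the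
  symmetric part of \<open>A = Dh(\<theta>\<^sup>*)\<close> is at least \<open>\<lambda>\<close>, which gives the exponential decay of the flow
  directly. The bias comes from \<open>n\<^sup>\<alpha> (\<theta>\<^sup>*\<^sup>n - \<theta>\<^sup>*) \<rightarrow> - A\<^sup>-\<^sup>1 \<E>\<close>.
\<close>

section \<open>Quadratic forms and Cholesky factorisation\<close>

text \<open>The obstacle is that the chain and the number of steps change together: \<open>N\<close>
  grows with \<open>n\<close> along a sequence tied to \<gamma>. Hence no limit is taken for a fixed
  chain. Every estimate is explicit, with constants fixed before the chain is chosen, and
  \<open>char_bound\<close> separates errors that vanish with \<open>N\<close> from errors that
  vanish with \<open>n\<close>, so that any \<open>N n\<close> tending to infinity is admissible.
  Only the normalisation uses the special choice of \<open>N\<close>. Both step regimes enter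
  through \<kappa> and \<zeta> alone. At age x the flow has decayed like e^(-\<lambda>x), while the
  ratio of the standard deviations sqrt(g k / g N) may have grown like e^(\<kappa>x/2), so \<kappa>
  < 2\<lambda> is the decisive inequality. Under (HS1) \<kappa> can be any positive number; under
  (HS2) it is 1/\<gamma>0, and the inequality is the condition 2\<lambda>\<gamma>0 > 1 of the
  theorem. The Cholesky factorisation is there because \<open>gaussian\<close> picks a square root
  by \<open>SOME\<close>: its characteristic function is known once the covariance is shown to be of
  the form \<open>S ** transpose S\<close>.\<close>

lemma norm_matrix_vector_mult_le:
  fixes M :: "real ^ 'n ^ 'm"
  shows "norm (M *v x) \<le> norm M * norm x"
proof -
  have "(norm (M *v x))\<^sup>2 = (\<Sum>i\<in>UNIV. ((M *v x) $ i)\<^sup>2)"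
    by (simp add: norm_vec_def L2_set_def sum_nonneg)
  also have "\<dots> \<le> (\<Sum>i\<in>UNIV. (norm (M $ i))\<^sup>2 * (norm x)\<^sup>2)"
  proof (rule sum_mono)
    fix i
    have "\<bar>M $ i \<bullet> x\<bar> \<le> norm (M $ i) * norm x"
      by (rule Cauchy_Schwarz_ineq2)
    then show "((M *v x) $ i)\<^sup>2 \<le> (norm (M $ i))\<^sup>2 * (norm x)\<^sup>2"
      by (metis abs_le_square_iff abs_mult abs_norm_cancel matrix_vector_mul_component power_mult_distrib)
  qed
  also have "\<dots> = (norm M * norm x)\<^sup>2"
    by (simp add: norm_vec_def[of M] L2_set_def sum_nonneg power_mult_distrib sum_distrib_right)
  finally show ?thesis
    by (rule power2_le_imp_le) simp
qed

text \<open>Carries quadratic forms through limits and Bochner integrals, so that matrix-valued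
  limits and integrals are studied through scalar ones.\<close>

lemma bounded_linear_bilinear_form: "bounded_linear (\<lambda>M. x \<bullet> (M *v y))"
  for x :: "real ^ 'm" and y :: "real ^ 'n"
  by (subst linear_conv_bounded_linear[symmetric], rule linearI)
     (simp_all add: matrix_vector_mult_add_rdistrib inner_add_right scaleR_matrix_vector_assoc[symmetric])

lemma norm_matrix_le_sum: "norm M \<le> (\<Sum>i\<in>UNIV. \<Sum>j\<in>UNIV. \<bar>M $ i $ j\<bar>)"
  for M :: "real ^ 'n ^ 'm"
proof -
  have "norm M \<le> (\<Sum>i\<in>UNIV. norm (M $ i))"
    unfolding norm_vec_def[of M] by (rule L2_set_le_sum) simp
  also have "\<dots> \<le> (\<Sum>i\<in>UNIV. \<Sum>j\<in>UNIV. \<bar>M $ i $ j\<bar>)"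
    by (intro sum_mono norm_le_l1_cart)
  finally show ?thesis .
qed

definition psd :: "real ^ 'n ^ 'n \<Rightarrow> bool" where
  "psd A \<longleftrightarrow> transpose A = A \<and> (\<forall>v. v \<bullet> (A *v v) \<ge> 0)"

lemma psd_inner_sym:
  assumes "psd A"
  shows "x \<bullet> (A *v y) = y \<bullet> (A *v x)"
  using assms by (metis dot_lmul_matrix inner_commute psd_def transpose_matrix_vector)

lemma outer_mult_vec: "outer c *v v = (c \<bullet> v) *\<^sub>R c"
  by (simp add: vec_eq_iff outer_def matrix_vector_mult_def inner_vec_def sum_distrib_left sum_distrib_right mult_ac)

text \<open>The form along the line \<open>x + t *\<^sub>R y\<close> is a polynomial in
  \<open>t\<close> of degree at most 2 that stays nonnegative, so its discriminant is at most 0. The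
  leading coefficient may vanish, since the form may be degenerate; that case is separate.\<close>

lemma psd_Cauchy_Schwarz:
  assumes "psd A"
  shows "(x \<bullet> (A *v y))\<^sup>2 \<le> (x \<bullet> (A *v x)) * (y \<bullet> (A *v y))"
proof -
  define a b c where "a = y \<bullet> (A *v y)" and "b = x \<bullet> (A *v y)" and "c = x \<bullet> (A *v x)"
  have q: "t\<^sup>2 * a + 2 * t * b + c \<ge> 0" for t
  proof -
    have "0 \<le> (x + t *\<^sub>R y) \<bullet> (A *v (x + t *\<^sub>R y))"
      using assms psd_def by blast
    also have "\<dots> = t\<^sup>2 * a + 2 * t * b + c"
      using psd_inner_sym[OF assms, of y x]
      unfolding a_def b_def c_def
      by (simp add: matrix_vector_right_distrib inner_add_left inner_add_right
        matrix_vector_mult_scaleR power2_eq_square distrib_left)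
    finally show ?thesis .
  qed
  have a0: "a \<ge> 0" using assms by (simp add: a_def psd_def)
  show ?thesis
  proof (cases "a = 0")
    case True
    have "b = 0"
    proof (rule ccontr)
      assume "b \<noteq> 0"
      \<comment> \<open>At this \<open>t\<close> the affine function \<open>2 * t * b + c\<close>
        equals -1.\<close>
      then show False using q[of "- (c + 1) / (2 * b)"] True by (simp add: field_simps)
    qed
    then show ?thesis using True by (simp add: a_def b_def)
  next
    case False
    with a0 have "a > 0" by simp
    have "0 \<le> a * ((- b / a)\<^sup>2 * a + 2 * (- b / a) * b + c)"
      using q[of "- b / a"] \<open>a > 0\<close> by simp
    also have "\<dots> = a * c - b\<^sup>2"
      using \<open>a > 0\<close> by (simp add: field_simps power2_eq_square)
    finally show ?thesis by (simp add: a_def b_def c_def mult.commute)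
  qed
qed

lemma inner_axis_matrix: "axis i 1 \<bullet> (A *v axis j 1) = (A :: real ^ 'n ^ 'n) $ i $ j"
  by (simp add: inner_axis' matrix_vector_mult_basis column_def)

text \<open>Cholesky elimination: subtracting \<open>c c\<^sup>T\<close> with \<open>c = \<Sigma> e\<^sub>a / \<surd>\<Sigma>\<^sub>a\<^sub>a\<close> kills row \<open>a\<close> and, by
  Cauchy--Schwarz, preserves positive semidefiniteness.\<close>

lemma psd_eliminate:
  fixes A :: "real ^ 'n ^ 'n"
  assumes "psd A"
  shows "\<exists>c. psd (A - outer c) \<and> (A - outer c) $ a $ a = 0 \<and>
    (\<forall>i. A $ i $ i = 0 \<longrightarrow> (A - outer c) $ i $ i = 0)"
proof (cases "A $ a $ a = 0")
  case True
  have "outer 0 = (0 :: real ^ 'n ^ 'n)" by (simp add: outer_def vec_eq_iff)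
  with True assms show ?thesis by (intro exI[of _ 0]) simp
next
  case False
  have "A $ a $ a \<ge> 0"
    using assms inner_axis_matrix[of a A a] by (metis psd_def)
  with False have pos: "A $ a $ a > 0" by simp
  define c where "c = (1 / sqrt (A $ a $ a)) *\<^sub>R (A *v axis a 1)"
  have sym: "A $ i $ j = A $ j $ i" for i j
    using arg_cong[of _ _ "\<lambda>B. B $ i $ j", OF psd_def[THEN iffD1, OF assms, THEN conjunct1]]
    by (simp add: transpose_def)
  have c: "c $ i = A $ i $ a / sqrt (A $ a $ a)" for i
    by (simp add: c_def matrix_vector_mult_basis column_def)
  have cc: "c $ i * c $ j = A $ i $ a * A $ j $ a / A $ a $ a" for i j
    using pos by (simp add: c)
  have entry: "(A - outer c) $ i $ j = A $ i $ j - A $ i $ a * A $ j $ a / A $ a $ a" for i j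
    by (simp add: outer_def cc)
  have "psd (A - outer c)"
    unfolding psd_def
  proof safe
    show "transpose (A - outer c) = A - outer c"
    proof -
      have "(A - outer c) $ j $ i = (A - outer c) $ i $ j" for i j
        unfolding entry using sym[of i j] by (simp add: mult.commute)
      then show ?thesis
        by (simp add: vec_eq_iff transpose_def del: vector_minus_component)
    qed
    fix v
    have "(c \<bullet> v)\<^sup>2 = (v \<bullet> (A *v axis a 1))\<^sup>2 / A $ a $ a"
      using pos by (simp add: c_def power_mult_distrib inner_commute power_divide)
    also have "\<dots> \<le> v \<bullet> (A *v v)"
      using psd_Cauchy_Schwarz[OF assms, of v "axis a 1"] pos
      by (simp add: inner_axis_matrix field_simps)
    finally show "0 \<le> v \<bullet> ((A - outer c) *v v)"
      by (simp add: matrix_vector_mult_diff_rdistrib outer_mult_vec inner_diff_right power2_eq_square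
        inner_commute)
  qed
  moreover have "(A - outer c) $ i $ i = 0" if "A $ i $ i = 0" for i
  proof -
    have "(A $ i $ a)\<^sup>2 \<le> 0"
      using psd_Cauchy_Schwarz[OF assms, of "axis i 1" "axis a 1"] that by (simp add: inner_axis_matrix)
    then show ?thesis using that by (simp add: entry del: vector_minus_component)
  qed
  ultimately show ?thesis
    using pos by (intro exI[of _ c]) (simp add: entry del: vector_minus_component)
qed

text \<open>Eliminating one index after another keeps the diagonal entries already killed at 0. Once
  the whole diagonal is 0, Cauchy--Schwarz kills the other entries too, so \<open>A\<close> is the
  sum of the \<open>outer (c a)\<close>, and the vectors \<open>c a\<close> are the columns of
  \<open>S\<close>.\<close>

lemma psd_factorization:
  fixes A :: "real ^ 'n ^ 'n"
  assumes "psd A"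
  shows "\<exists>S :: real ^ 'n ^ 'n. S ** transpose S = A"
proof -
  have "\<exists>c :: 'n \<Rightarrow> real ^ 'n. psd (A - (\<Sum>a\<in>I. outer (c a))) \<and> (\<forall>i\<in>I. (A - (\<Sum>a\<in>I. outer (c a))) $ i $ i = 0)"
    if "finite I" for I
    using that
  proof (induction I rule: finite_induct)
    case empty
    then show ?case using assms by simp
  next
    case (insert a I)
    then obtain c where c: "psd (A - (\<Sum>a\<in>I. outer (c a)))"
        "\<And>i. i \<in> I \<Longrightarrow> (A - (\<Sum>a\<in>I. outer (c a))) $ i $ i = 0"
      by blast
    obtain ca where ca: "psd (A - (\<Sum>a\<in>I. outer (c a)) - outer ca)"
       "(A - (\<Sum>a\<in>I. outer (c a)) - outer ca) $ a $ a = 0"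
       "\<And>i. i \<in> I \<Longrightarrow> (A - (\<Sum>a\<in>I. outer (c a)) - outer ca) $ i $ i = 0"
      using psd_eliminate[OF c(1), of a] c(2) by blast
    have "(\<Sum>x\<in>insert a I. outer ((c(a := ca)) x)) = (\<Sum>a\<in>I. outer (c a)) + outer ca"
      using insert by (simp add: add.commute cong: sum.cong_simp) (intro sum.cong, auto)
    with ca show ?case
      by (intro exI[of _ "c(a := ca)"]) (auto simp: diff_diff_eq simp del: vector_minus_component vector_add_component)
  qed
  from this[OF finite_class.finite_UNIV] obtain c :: "'n \<Rightarrow> real ^ 'n" where
    c: "psd (A - (\<Sum>a\<in>UNIV. outer (c a)))" "\<And>i. (A - (\<Sum>a\<in>UNIV. outer (c a))) $ i $ i = 0"
    by blast
  have "(A - (\<Sum>a\<in>UNIV. outer (c a))) $ i $ j = 0" for i j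
    using psd_Cauchy_Schwarz[OF c(1), of "axis i 1" "axis j 1"] c(2)
    by (simp add: inner_axis_matrix)
  then have "A = (\<Sum>a\<in>UNIV. outer (c a))"
    by (simp add: vec_eq_iff)
  also have "\<dots> = (\<chi> i a. c a $ i) ** transpose (\<chi> i a. c a $ i)"
    by (simp add: vec_eq_iff matrix_matrix_mult_def transpose_def outer_def)
  finally show ?thesis by metis
qed

text \<open>Each entry is split as \<open>(x - y) $ i * x $ j + y $ i * (x - y) $ j\<close>; the
  factor counts the entries. With \<open>y = 0\<close> this also bounds \<open>outer\<close>
  itself.\<close>

lemma norm_outer_diff_le:
  fixes x y :: "real ^ 'd"
  shows "norm (outer x - outer y) \<le> (real CARD('d))\<^sup>2 * (norm (x - y) * (norm x + norm y))"
proof -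
  have "\<bar>(outer x - outer y) $ i $ j\<bar> \<le> norm (x - y) * (norm x + norm y)" for i j
  proof -
    have "(outer x - outer y) $ i $ j = (x - y) $ i * x $ j + y $ i * (x - y) $ j"
      by (simp add: outer_def algebra_simps)
    also have "\<bar>\<dots>\<bar> \<le> norm (x - y) * norm x + norm y * norm (x - y)"
      by (rule order_trans[OF abs_triangle_ineq])
         (unfold abs_mult, intro add_mono mult_mono component_le_norm_cart norm_ge_zero abs_ge_zero)
    finally show ?thesis by (simp only: distrib_left mult.commute)
  qed
  then have "norm (outer x - outer y) \<le> (\<Sum>i\<in>(UNIV::'d set). \<Sum>j\<in>(UNIV::'d set). norm (x - y) * (norm x + norm y))"
    by (intro order_trans[OF norm_matrix_le_sum] sum_mono)
  then show ?thesis by (simp add: power2_eq_square mult.assoc)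
qed

lemma borel_measurable_outer: "outer \<in> borel_measurable (borel :: (real ^ 'd) measure)"
proof (rule borel_measurable_continuous_onI)
  show "continuous_on UNIV (outer :: real ^ 'd \<Rightarrow> _)"
    unfolding outer_def by (intro continuous_on_vec_lambda continuous_intros)
qed

lemma integrable_outer:
  fixes Y :: "'a \<Rightarrow> real ^ 'd"
  assumes [measurable]: "Y \<in> borel_measurable M" and "integrable M (\<lambda>\<omega>. (norm (Y \<omega>))\<^sup>2)"
  shows "integrable M (\<lambda>\<omega>. outer (Y \<omega>))"
proof (rule Bochner_Integration.integrable_bound)
  show "integrable M (\<lambda>\<omega>. (real CARD('d))\<^sup>2 * (norm (Y \<omega>))\<^sup>2)" using assms by simp
  show "(\<lambda>\<omega>. outer (Y \<omega>)) \<in> borel_measurable M"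
    using measurable_compose[OF assms(1) borel_measurable_outer] .
  have "outer (0 :: real ^ 'd) = 0" by (simp add: outer_def vec_eq_iff)
  then show "AE \<omega> in M. norm (outer (Y \<omega>)) \<le> norm ((real CARD('d))\<^sup>2 * (norm (Y \<omega>))\<^sup>2)"
    using norm_outer_diff_le[of "Y _" 0] by (intro AE_I2) (simp add: power2_eq_square)
qed

section \<open>The linear flow\<close>

lemma matrix_power_scaleR: "matrix_power (s *\<^sub>R A) k = s ^ k *\<^sub>R matrix_power A k"
  by (induction k) (simp_all add: vec_eq_iff matrix_matrix_mult_def sum_distrib_left mult_ac)

lemma norm_matrix_power_vec_le: "norm (matrix_power A k *v x) \<le> norm A ^ k * norm x"
proof (induction k)
  case (Suc k)
  have "norm (matrix_power A (Suc k) *v x) = norm (A *v (matrix_power A k *v x))"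
    by (simp add: matrix_vector_mul_assoc)
  also have "\<dots> \<le> norm A * (norm A ^ k * norm x)"
    by (rule order_trans[OF norm_matrix_vector_mult_le]) (intro mult_left_mono Suc norm_ge_zero)
  finally show ?case by (simp add: mult_ac)
qed simp

lemma abs_matrix_power_entry_le: "\<bar>matrix_power A k $ i $ j\<bar> \<le> norm A ^ k"
proof -
  have "\<bar>matrix_power A k $ i $ j\<bar> = \<bar>(matrix_power A k *v axis j 1) $ i\<bar>"
    by (simp add: matrix_vector_mult_basis column_def)
  also have "\<dots> \<le> norm (matrix_power A k *v axis j 1)"
    by (rule component_le_norm_cart)
  also have "\<dots> \<le> norm A ^ k"
    using norm_matrix_power_vec_le[of A k "axis j 1"] by simp
  finally show ?thesis .
qed

lemma summable_matrix_exp_entry: "summable (\<lambda>k. matrix_power A k $ i $ j / fact k * s ^ k)"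
proof (rule summable_comparison_test)
  have "norm (matrix_power A k $ i $ j / fact k * s ^ k) \<le> inverse (fact k) * (norm A * \<bar>s\<bar>) ^ k" for k
    using abs_matrix_power_entry_le[of A k i j]
    by (simp add: abs_mult power_mult_distrib power_abs divide_simps mult_right_mono)
  then show "\<exists>N. \<forall>k\<ge>N. norm (matrix_power A k $ i $ j / fact k * s ^ k)
      \<le> inverse (fact k) * (norm A * \<bar>s\<bar>) ^ k"
    by blast
  show "summable (\<lambda>k. inverse (fact k) * (norm A * \<bar>s\<bar>) ^ k)"
    by (rule summable_exp)
qed

text \<open>Reading each entry as a scalar power series in \<open>s\<close> makes termwise
  differentiation available.\<close>

lemma matrix_exp_entry:
  "matrix_exp (s *\<^sub>R A) $ i $ j = (\<Sum>k. matrix_power A k $ i $ j / fact k * s ^ k)"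
proof -
  have "(\<lambda>k. (1 / fact k) *\<^sub>R matrix_power (s *\<^sub>R A) k) sums
      (\<chi> i j. \<Sum>k. matrix_power A k $ i $ j / fact k * s ^ k)"
    unfolding sums_def
  proof (intro vec_tendstoI)
    fix i j
    show "(\<lambda>n. (\<Sum>k<n. (1 / fact k) *\<^sub>R matrix_power (s *\<^sub>R A) k) $ i $ j) \<longlonglongrightarrow>
      (\<chi> i j. \<Sum>k. matrix_power A k $ i $ j / fact k * s ^ k) $ i $ j"
      using summable_LIMSEQ[OF summable_matrix_exp_entry[of A i j s]]
      by (simp add: matrix_power_scaleR sum_component mult_ac)
  qed
  from sums_unique[OF this, symmetric] show ?thesis
    unfolding matrix_exp_def by simp
qed

lemma matrix_exp_0: "matrix_exp 0 = mat 1"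
proof -
  have "matrix_exp (0 *\<^sub>R 0) $ i $ j = (mat 1 :: real ^ 'n ^ 'n) $ i $ j" for i j
    unfolding matrix_exp_entry by (subst suminf_finite[of "{0}"]) auto
  then show ?thesis by (auto simp: vec_eq_iff)
qed

lemma matrix_exp_entry_deriv:
  "((\<lambda>s. matrix_exp (s *\<^sub>R A) $ i $ j) has_real_derivative
     (A ** matrix_exp (s *\<^sub>R A)) $ i $ j) (at s)"
proof -
  define c where "c i k = matrix_power A k $ i $ j / fact k" for i k
  have sm: "summable (\<lambda>k. c i k * t ^ k)" for i t
    unfolding c_def by (rule summable_matrix_exp_entry)
  \<comment> \<open>The factor \<open>k + 1\<close> from differentiation cancels in
    \<open>fact (Suc k)\<close>, and \<open>matrix_power A (Suc k)\<close> releases one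
    \<open>A\<close> on the left.\<close>
  have diffs: "diffs (c i) k = (\<Sum>l\<in>UNIV. A $ i $ l * c l k)" for k
    by (simp add: diffs_def c_def matrix_matrix_mult_def sum_divide_distrib[symmetric]
      del: of_nat_Suc)
  have "((\<lambda>s. \<Sum>k. c i k * s ^ k) has_real_derivative (\<Sum>k. diffs (c i) k * s ^ k)) (at s)"
    by (rule termdiffs_strong_converges_everywhere) (rule sm)
  also have "(\<Sum>k. diffs (c i) k * s ^ k) = (\<Sum>k. \<Sum>l\<in>UNIV. A $ i $ l * (c l k * s ^ k))"
    by (simp add: diffs sum_distrib_right mult.assoc)
  also have "\<dots> = (\<Sum>l\<in>UNIV. A $ i $ l * (\<Sum>k. c l k * s ^ k))"
    by (subst suminf_sum) (auto intro!: summable_mult sm simp: suminf_mult[OF sm])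
  finally show ?thesis
    by (simp add: matrix_exp_entry c_def matrix_matrix_mult_def)
qed

lemma has_vector_derivative_vecI:
  fixes f :: "real \<Rightarrow> real ^ 'n"
  assumes "\<And>i. ((\<lambda>s. f s $ i) has_real_derivative f' $ i) (at s)"
  shows "(f has_vector_derivative f') (at s)"
  unfolding has_vector_derivative_def has_derivative_componentwise_within[of f]
proof
  fix b :: "real ^ 'n" assume "b \<in> Basis"
  then obtain i where b: "b = axis i 1" by (auto simp: Basis_vec_def)
  show "((\<lambda>x. f x \<bullet> b) has_derivative (\<lambda>x. (x *\<^sub>R f') \<bullet> b)) (at s)"
    using assms[of i] by (simp add: b inner_axis has_field_derivative_def mult_commute_abs)
qed

text \<open>The flow of \<open>y' = - A y\<close>; the shift by \<open>\<zeta>\<close> is split off so that it can be matched with the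
  exponentials in \<^const>\<open>asymptotic_covariance\<close>.\<close>

definition mflow :: "real ^ 'n ^ 'n \<Rightarrow> real \<Rightarrow> real \<Rightarrow> real ^ 'n ^ 'n" where
  "mflow A \<zeta> s = exp (- \<zeta> * s) *\<^sub>R matrix_exp ((- s) *\<^sub>R (A - \<zeta> *\<^sub>R mat 1))"

lemma mflow_0: "mflow A \<zeta> 0 = mat 1"
  by (simp add: mflow_def matrix_exp_0)

text \<open>The derivative of the scalar factor cancels the shift in the exponent, so for every
  \<zeta> this is the flow of the same equation.\<close>

lemma mflow_deriv:
  "((\<lambda>s. mflow A \<zeta> s *v x) has_vector_derivative - (A *v (mflow A \<zeta> s *v x))) (at s)"
proof (rule has_vector_derivative_vecI)
  fix i
  define B where "B = - (A - \<zeta> *\<^sub>R mat 1)"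
  define E where "E s = matrix_exp (s *\<^sub>R B)" for s
  have f: "mflow A \<zeta> s = exp (- \<zeta> * s) *\<^sub>R E s" for s
    by (simp add: mflow_def B_def E_def scaleR_right_diff_distrib)
  have d: "((\<lambda>s. \<Sum>j\<in>UNIV. exp (- \<zeta> * s) * E s $ i $ j * x $ j) has_real_derivative
      (\<Sum>j\<in>UNIV. (exp (- \<zeta> * s) * (- \<zeta>) * E s $ i $ j + exp (- \<zeta> * s) * (B ** E s) $ i $ j) * x $ j)) (at s)"
    unfolding E_def
    by (auto intro!: derivative_eq_intros matrix_exp_entry_deriv simp: algebra_simps)
  have "(\<Sum>j\<in>UNIV. (exp (- \<zeta> * s) * (- \<zeta>) * E s $ i $ j + exp (- \<zeta> * s) * (B ** E s) $ i $ j) * x $ j)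
      = exp (- \<zeta> * s) * (((- \<zeta>) *\<^sub>R (E s *v x) + (B ** E s) *v x) $ i)"
    by (simp add: matrix_vector_mult_def sum_distrib_left algebra_simps sum.distrib sum_subtractf)
  also have "(- \<zeta>) *\<^sub>R (E s *v x) + (B ** E s) *v x = - (A *v (E s *v x))"
    by (simp add: B_def matrix_vector_mul_assoc[symmetric] matrix_vector_mult_diff_rdistrib
      scaleR_matrix_vector_assoc[symmetric])
  also have "exp (- \<zeta> * s) * ((- (A *v (E s *v x))) $ i) = (- (A *v (mflow A \<zeta> s *v x))) $ i"
    by (simp add: f scaleR_matrix_vector_assoc[symmetric] matrix_vector_mult_scaleR)
  finally show "((\<lambda>s. (mflow A \<zeta> s *v x) $ i) has_real_derivative (- (A *v (mflow A \<zeta> s *v x))) $ i) (at s)"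
    using d by (simp add: f matrix_vector_mult_def mult_ac)
qed

lemma continuous_on_mflow: "continuous_on S (mflow A \<zeta>)"
proof -
  have "continuous_on S (\<lambda>s. matrix_exp (s *\<^sub>R B) $ i $ j)" for S :: "real set" and B :: "real ^ 'n ^ 'n" and i j
    by (rule DERIV_continuous_on) (rule has_field_derivative_at_within, rule matrix_exp_entry_deriv)
  then have "continuous_on UNIV (\<lambda>s. matrix_exp (s *\<^sub>R B))" for B :: "real ^ 'n ^ 'n"
  proof -
    have "continuous_on UNIV (\<lambda>s. \<chi> i j. matrix_exp (s *\<^sub>R B) $ i $ j)"
      by (intro continuous_on_vec_lambda \<open>\<And>S B i j. continuous_on S (\<lambda>s. matrix_exp (s *\<^sub>R B) $ i $ j)\<close>)
    then show ?thesis by simp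
  qed
  then have "continuous_on S (\<lambda>s. matrix_exp ((- s) *\<^sub>R B))" for B :: "real ^ 'n ^ 'n"
    by (rule continuous_on_compose2) (auto intro!: continuous_intros)
  then show ?thesis
    unfolding mflow_def by (intro continuous_intros)
qed

text \<open>Gronwall's argument: \<open>e\<^sup>2\<^sup>\<lambda>\<^sup>s |y(s)|\<^sup>2\<close> is nonincreasing.\<close>

lemma linear_ode_decay:
  fixes y :: "real \<Rightarrow> real ^ 'n"
  assumes y: "\<And>s. (y has_vector_derivative - (A *v y s)) (at s)"
    and A: "\<And>v. v \<bullet> (A *v v) \<ge> lam * (norm v)\<^sup>2" and "s \<ge> 0"
  shows "norm (y s) \<le> exp (- lam * s) * norm (y 0)"
proof -
  define N where "N s = exp (2 * lam * s) * (y s \<bullet> y s)" for s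
  have "(N has_real_derivative exp (2 * lam * t) * (2 * lam) * (y t \<bullet> y t)
      + exp (2 * lam * t) * (2 * (y t \<bullet> - (A *v y t)))) (at t)" for t
  proof -
    have "((\<lambda>t. y t \<bullet> y t) has_real_derivative 2 * (y t \<bullet> - (A *v y t))) (at t)"
      unfolding has_field_derivative_def
      by (rule has_derivative_eq_rhs[OF has_derivative_inner[OF y[unfolded has_vector_derivative_def]
          y[unfolded has_vector_derivative_def]]]) (auto simp: inner_commute)
    then show ?thesis
      unfolding N_def by (auto intro!: derivative_eq_intros)
  qed
  moreover have "exp (2 * lam * t) * (2 * lam) * (y t \<bullet> y t) + exp (2 * lam * t) * (2 * (y t \<bullet> - (A *v y t))) \<le> 0" for t
    using A[of "y t"] by (simp add: power2_norm_eq_inner algebra_simps mult_left_mono)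
  ultimately have "N s \<le> N 0"
    using DERIV_nonpos_imp_nonincreasing[OF \<open>s \<ge> 0\<close>, of N] by blast
  then have "(norm (y s))\<^sup>2 \<le> (exp (- lam * s) * norm (y 0))\<^sup>2"
    by (simp add: N_def power2_norm_eq_inner[symmetric] power_mult_distrib exp_double[symmetric]
      exp_minus field_simps)
  then show ?thesis
    by (rule power2_le_imp_le) simp
qed

context
  fixes A :: "real ^ 'n ^ 'n" and lam :: real
  assumes A: "\<And>v. v \<bullet> (A *v v) \<ge> lam * (norm v)\<^sup>2"
begin

lemma norm_mflow_le:
  assumes "s \<ge> 0"
  shows "norm (mflow A \<zeta> s *v x) \<le> exp (- lam * s) * norm x"
  using linear_ode_decay[OF mflow_deriv A assms, of \<zeta> x] by (simp add: mflow_0)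

text \<open>The bound for the flow passes to its adjoint by duality: with \<open>w\<close> the
  vector on the left, \<open>w \<bullet> w = v \<bullet> (mflow A \<zeta> s *v w)\<close>.\<close>

lemma norm_transpose_mflow_le:
  assumes "s \<ge> 0"
  shows "norm (transpose (mflow A \<zeta> s) *v v) \<le> exp (- lam * s) * norm v"
proof -
  define w where "w = transpose (mflow A \<zeta> s) *v v"
  have "norm w * norm w = v \<bullet> (mflow A \<zeta> s *v w)"
    by (metis dot_lmul_matrix power2_eq_square power2_norm_eq_inner transpose_matrix_vector w_def)
  also have "\<dots> \<le> norm v * norm (mflow A \<zeta> s *v w)"
    by (rule norm_cauchy_schwarz)
  also have "\<dots> \<le> norm v * (exp (- lam * s) * norm w)"
    by (intro mult_left_mono norm_mflow_le assms) simp
  finally have "norm w * norm w \<le> (exp (- lam * s) * norm v) * norm w" by (simp add: mult_ac)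
  then show ?thesis
    unfolding w_def[symmetric] by (metis mult_right_le_imp_le norm_ge_zero exp_ge_zero mult_nonneg_nonneg linorder_not_le order.trans less_le)
qed

text \<open>The semigroup law follows from uniqueness for the linear equation: the difference of the
  two sides solves it in \<open>s\<close> and vanishes at \<open>s = 0\<close>, so
  \<open>linear_ode_decay\<close> keeps it at 0.\<close>

lemma mflow_add:
  assumes "s \<ge> 0"
  shows "mflow A \<zeta> (s + t) *v x = mflow A \<zeta> s *v (mflow A \<zeta> t *v x)"
proof -
  define y where "y s = mflow A \<zeta> (s + t) *v x - mflow A \<zeta> s *v (mflow A \<zeta> t *v x)" for s
  have "((\<lambda>s. mflow A \<zeta> (s + t) *v x) has_vector_derivative - (A *v (mflow A \<zeta> (s + t) *v x))) (at s)" for s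
    using vector_diff_chain_at[of "\<lambda>s. s + t" 1 s, OF _ mflow_deriv[of A \<zeta> x "s + t"]]
    by (auto simp: o_def has_vector_derivative_add_const has_vector_derivative_id)
  then have "(y has_vector_derivative - (A *v y s)) (at s)" for s
    unfolding y_def
    by (rule has_vector_derivative_eq_rhs[OF has_vector_derivative_diff[OF _ mflow_deriv]])
       (simp add: matrix_vector_mult_diff_distrib)
  from linear_ode_decay[OF this A assms] show ?thesis
    by (simp add: y_def mflow_0)
qed

text \<open>Two applications of the mean value inequality: the first bounds
  \<open>mflow A \<zeta> s *v x - x\<close> by a multiple of \<open>s\<close>, and this in turn
  bounds the derivative of the second-order remainder.\<close>

lemma mflow_Taylor:
  assumes "t \<ge> 0" "lam \<ge> 0"
  shows "norm (mflow A \<zeta> t *v x - x + t *\<^sub>R (A *v x)) \<le> t\<^sup>2 * (norm A)\<^sup>2 * norm x"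
proof -
  have bd: "norm (mflow A \<zeta> s *v x) \<le> norm x" if "s \<ge> 0" for s
  proof -
    have "exp (- lam * s) * norm x \<le> 1 * norm x"
      using that assms by (intro mult_right_mono) auto
    with norm_mflow_le[OF that, of \<zeta> x] show ?thesis by simp
  qed
  have onorm_le: "onorm (\<lambda>h. h *\<^sub>R a) \<le> B" if "norm a \<le> B" for a :: "real ^ 'n" and B
    using that by (intro onorm_le) (simp add: mult.commute[of B] mult_left_mono)
  have 1: "norm (mflow A \<zeta> s *v x - x) \<le> norm A * norm x * s" if "s \<ge> 0" for s
  proof -
    have "norm (mflow A \<zeta> s *v x - mflow A \<zeta> 0 *v x) \<le> norm A * norm x * norm (s - 0)"
    proof (rule differentiable_bound[where S="{0..s}"])
      fix r assume r: "r \<in> {0..s}"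
      show "((\<lambda>s. mflow A \<zeta> s *v x) has_derivative (\<lambda>h. h *\<^sub>R (- (A *v (mflow A \<zeta> r *v x))))) (at r within {0..s})"
        using mflow_deriv unfolding has_vector_derivative_def by (rule has_derivative_at_withinI)
      have "norm (A *v (mflow A \<zeta> r *v x)) \<le> norm A * norm x"
        using r by (intro order_trans[OF norm_matrix_vector_mult_le] mult_left_mono bd) auto
      then show "onorm (\<lambda>h. h *\<^sub>R (- (A *v (mflow A \<zeta> r *v x)))) \<le> norm A * norm x"
        by (intro onorm_le) simp
    qed (use that in auto)
    then show ?thesis using that by (simp add: mflow_0)
  qed
  define f where "f s = mflow A \<zeta> s *v x - x + s *\<^sub>R (A *v x)" for s
  have "norm (f t - f 0) \<le> (norm A * (norm A * norm x * t)) * norm (t - 0)"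
  proof (rule differentiable_bound[where S="{0..t}"])
    fix r assume r: "r \<in> {0..t}"
    have "(f has_vector_derivative - (A *v (mflow A \<zeta> r *v x - x))) (at r)"
      unfolding f_def
      by (rule has_vector_derivative_eq_rhs, (rule derivative_intros mflow_deriv)+)
         (simp add: matrix_vector_mult_diff_distrib)
    then show "(f has_derivative (\<lambda>h. h *\<^sub>R (- (A *v (mflow A \<zeta> r *v x - x))))) (at r within {0..t})"
      unfolding has_vector_derivative_def by (rule has_derivative_at_withinI)
    have "norm (A *v (mflow A \<zeta> r *v x - x)) \<le> norm A * (norm A * norm x * r)"
      using r by (intro order_trans[OF norm_matrix_vector_mult_le] mult_left_mono 1) auto
    also have "\<dots> \<le> norm A * (norm A * norm x * t)"
      using r by (intro mult_left_mono) auto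
    finally show "onorm (\<lambda>h. h *\<^sub>R (- (A *v (mflow A \<zeta> r *v x - x)))) \<le> norm A * (norm A * norm x * t)"
      by (intro onorm_le) simp
  qed (use assms in auto)
  then show ?thesis
    using assms by (simp add: f_def mflow_0 power2_eq_square mult_ac)
qed

end

section \<open>Step sequences\<close>

text \<open>The elapsed time of the algorithm. Step \<open>g k\<close> leads from index
  \<open>k - 1\<close> to \<open>k\<close>, so the sum starts at 1 and
  \<open>clock g 0 = 0\<close>.\<close>

definition clock :: "(nat \<Rightarrow> real) \<Rightarrow> nat \<Rightarrow> real" where
  "clock g N = (\<Sum>k=1..N. g k)"

lemma clock_Suc: "clock g (Suc N) = clock g N + g (Suc N)"
  by (simp add: clock_def)

text \<open>The two regimes of step sizes are unified by measuring the index \<open>k\<close> by the elapsed time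
  \<open>clock g k\<close>: up to constants \<open>g k / g N\<close> grows at most like \<open>e\<^sup>\<kappa>\<^sup>x\<close> in the time \<open>x\<close> separating
  \<open>k\<close> from \<open>N\<close>, and it is asymptotic to \<open>e\<^sup>2\<^sup>\<zeta>\<^sup>x\<close> on bounded time windows.\<close>

locale step_sequence =
  fixes g :: "nat \<Rightarrow> real" and \<kappa> \<zeta> :: real
  assumes g_pos: "g k > 0"
    and g_antimono: "k \<le> l \<Longrightarrow> g l \<le> g k"
    and g_tendsto: "g \<longlonglongrightarrow> 0"
    and clock_at_top: "filterlim (clock g) at_top sequentially"
    and g_growth: "\<exists>C. \<forall>N. \<forall>k\<in>{1..N}. g k \<le> C * g N * exp (\<kappa> * (clock g N - clock g k))"
    and g_ratio: "\<And>T \<epsilon>. \<epsilon> > 0 \<Longrightarrow> \<forall>\<^sub>F N in sequentially. \<forall>k\<in>{1..N}. clock g N - clock g k \<le> T \<longrightarrow>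
      \<bar>g k / g N * exp (- 2 * \<zeta> * (clock g N - clock g k)) - 1\<bar> \<le> \<epsilon>"
begin

abbreviation age :: "nat \<Rightarrow> nat \<Rightarrow> real" where "age N k \<equiv> clock g N - clock g k"

lemma clock_mono: "k \<le> l \<Longrightarrow> clock g k \<le> clock g l"
  unfolding clock_def using g_pos by (intro sum_mono2) (auto intro: less_imp_le)

lemma age_nonneg: "k \<le> N \<Longrightarrow> age N k \<ge> 0"
  using clock_mono by simp

text \<open>Step \<open>k\<close> covers the ages from \<open>age N k\<close> to
  \<open>age N k + g k\<close>. The sum in \<open>weights_le\<close> evaluates
  \<open>exp (- c * x)\<close> at the left ends, which costs at most the factor
  \<open>exp (c * g 0)\<close> over the integral \<open>1 / c\<close>.\<close>

definition weight_bound :: "real \<Rightarrow> real" where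
  "weight_bound c = exp (c * g 0) / c"

lemma weight_bound_pos: "c > 0 \<Longrightarrow> weight_bound c > 0"
  by (simp add: weight_bound_def)

text \<open>A further step \<open>x\<close> multiplies the sum by \<open>exp (- c * x)\<close> and
  adds \<open>x\<close>. The bound is stable under this map because
  \<open>x \<le> weight_bound c * (1 - exp (- c * x))\<close>.\<close>

lemma weights_le:
  assumes "c > 0"
  shows "(\<Sum>k=1..N. g k * exp (- c * age N k)) \<le> weight_bound c"
proof (induction N)
  case 0
  then show ?case using weight_bound_pos[OF assms] by (simp add: less_imp_le)
next
  case (Suc N)
  define x where "x = g (Suc N)"
  have x: "x > 0" "x \<le> g 0" using g_pos g_antimono by (auto simp: x_def)
  have "(\<Sum>k=1..Suc N. g k * exp (- c * age (Suc N) k)) =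
      exp (- c * x) * (\<Sum>k=1..N. g k * exp (- c * age N k)) + x"
    by (simp add: clock_Suc x_def sum_distrib_left exp_add[symmetric] mult.left_commute algebra_simps)
  also have "\<dots> \<le> exp (- c * x) * weight_bound c + x"
    by (intro add_right_mono mult_left_mono Suc) simp
  also have "exp (- c * x) * weight_bound c + x \<le> weight_bound c"
  proof -
  have "x \<le> weight_bound c * (1 - exp (- c * x))"
  proof -
    have "x * exp (c * x) \<le> x * exp (c * g 0)"
      using x assms by (intro mult_left_mono) auto
    then have "x \<le> weight_bound c * (c * x * exp (- c * x))"
      using assms by (simp add: weight_bound_def exp_minus field_simps)
    also have "c * x * exp (- c * x) \<le> 1 - exp (- c * x)"
      using exp_ge_add_one_self[of "c * x"] by (simp add: exp_minus field_simps)
    finally show ?thesis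
      using weight_bound_pos[OF assms] by (simp add: mult_left_mono)
  qed
  then show ?thesis by (simp add: algebra_simps)
  qed
  finally show ?case .
qed

text \<open>A Toeplitz argument, split at age \<open>T\<close>. Ages up to \<open>T\<close> are
  handled by the window hypothesis; beyond \<open>T\<close> half of the exponential rate is given up
  for the small factor \<open>exp (- (c / 2) * T)\<close>, and the other half still sums.\<close>

lemma weighted_sum_tendsto_0:
  assumes c: "c > 0"
    and bounded: "\<And>N k. 1 \<le> k \<Longrightarrow> k \<le> N \<Longrightarrow> \<bar>a N k\<bar> \<le> B"
    and window: "\<And>T \<epsilon>. \<epsilon> > 0 \<Longrightarrow> \<forall>\<^sub>F N in sequentially. \<forall>k\<in>{1..N}. age N k \<le> T \<longrightarrow> \<bar>a N k\<bar> \<le> \<epsilon>"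
  shows "(\<lambda>N. \<Sum>k=1..N. g k * exp (- c * age N k) * a N k) \<longlonglongrightarrow> 0"
proof (rule LIMSEQ_I)
  fix r :: real assume "r > 0"
  define \<epsilon> where "\<epsilon> = r / (3 * weight_bound c)"
  have \<epsilon>: "\<epsilon> > 0" using \<open>r > 0\<close> weight_bound_pos[OF c] by (simp add: \<epsilon>_def)
  have B: "B \<ge> 0" using bounded[of 1 1] by simp
  have "((\<lambda>T. B * exp (- (c / 2) * T) * weight_bound (c / 2)) \<longlongrightarrow> B * 0 * weight_bound (c / 2)) at_top"
    using c by (intro tendsto_intros filterlim_compose[OF exp_at_bot]
      filterlim_tendsto_neg_mult_at_bot[OF tendsto_const _ filterlim_ident]) auto
  then have "\<forall>\<^sub>F T in at_top. B * exp (- (c / 2) * T) * weight_bound (c / 2) < r / 3"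
    using \<open>r > 0\<close> by (intro order_tendstoD) auto
  then obtain T where T: "B * exp (- (c / 2) * T) * weight_bound (c / 2) < r / 3"
    by (auto simp: eventually_at_top_linorder)
  have bound: "\<bar>\<Sum>k=1..N. g k * exp (- c * age N k) * a N k\<bar> < r"
    if N: "\<forall>k\<in>{1..N}. age N k \<le> T \<longrightarrow> \<bar>a N k\<bar> \<le> \<epsilon>" for N
  proof -
    have "\<bar>\<Sum>k=1..N. g k * exp (- c * age N k) * a N k\<bar> \<le>
        (\<Sum>k=1..N. \<epsilon> * (g k * exp (- c * age N k)) + B * exp (- (c / 2) * T) * (g k * exp (- (c / 2) * age N k)))"
    proof (rule sum_abs[THEN order_trans], rule sum_mono)
      fix k assume k: "k \<in> {1..N}"
      have gk: "g k > 0" by (rule g_pos)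
      show "\<bar>g k * exp (- c * age N k) * a N k\<bar> \<le>
        \<epsilon> * (g k * exp (- c * age N k)) + B * exp (- (c / 2) * T) * (g k * exp (- (c / 2) * age N k))"
      proof (cases "age N k \<le> T")
        case True
        then have "\<bar>a N k\<bar> \<le> \<epsilon>" using N k by blast
        then have "\<bar>g k * exp (- c * age N k) * a N k\<bar> \<le> \<epsilon> * (g k * exp (- c * age N k))"
          using gk by (simp add: abs_mult mult.commute)
        moreover have "0 \<le> B * exp (- (c / 2) * T) * (g k * exp (- (c / 2) * age N k))"
          using B gk by simp
        ultimately show ?thesis by linarith
      next
        case False
        have "\<bar>g k * exp (- c * age N k) * a N k\<bar> \<le> g k * (exp (- c * age N k) * B)"
          using bounded[of k N] k gk by (simp add: abs_mult mult.assoc mult_left_mono)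
        also have "exp (- c * age N k) \<le> exp (- (c / 2) * T) * exp (- (c / 2) * age N k)"
        proof -
          have "- c * age N k \<le> - (c / 2) * T + - (c / 2) * age N k"
            using mult_left_mono[of T "age N k" "c / 2"] False c by (simp add: field_simps)
          then show ?thesis by (simp only: exp_add[symmetric] exp_le_cancel_iff)
        qed
        finally have "\<bar>g k * exp (- c * age N k) * a N k\<bar> \<le>
            B * exp (- (c / 2) * T) * (g k * exp (- (c / 2) * age N k))"
          using gk B by (simp add: mult_left_mono mult_right_mono mult_ac)
        moreover have "0 \<le> \<epsilon> * (g k * exp (- c * age N k))" using \<epsilon> gk by simp
        ultimately show ?thesis by linarith
      qed
    qed
    also have "\<dots> = \<epsilon> * (\<Sum>k=1..N. g k * exp (- c * age N k)) +
        B * exp (- (c / 2) * T) * (\<Sum>k=1..N. g k * exp (- (c / 2) * age N k))"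
      by (simp add: sum.distrib sum_distrib_left)
    also have "\<dots> \<le> \<epsilon> * weight_bound c + B * exp (- (c / 2) * T) * weight_bound (c / 2)"
      using \<epsilon> B c by (intro add_mono mult_left_mono weights_le) auto
    also have "\<dots> < r"
      using T weight_bound_pos[OF c] \<open>r > 0\<close> by (simp add: \<epsilon>_def)
    finally show ?thesis .
  qed
  show "\<exists>no. \<forall>n\<ge>no. norm ((\<Sum>k=1..n. g k * exp (- c * age n k) * a n k) - 0) < r"
    using window[OF \<epsilon>, of T] bound unfolding eventually_sequentially by (metis diff_zero real_norm_def)
qed

text \<open>Because \<open>clock g\<close> diverges, an index within bounded age of \<open>N\<close>
  eventually lies beyond any fixed index.\<close>

lemma eventually_window:
  assumes "\<forall>\<^sub>F k in sequentially. P k"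
  shows "\<forall>\<^sub>F N in sequentially. \<forall>k\<in>{1..N}. age N k \<le> T \<longrightarrow> P k"
proof -
  obtain m where m: "\<And>k. k \<ge> m \<Longrightarrow> P k"
    using assms by (auto simp: eventually_sequentially)
  have "\<forall>\<^sub>F N in sequentially. clock g N > clock g m + T"
    using clock_at_top by (simp add: filterlim_at_top_dense)
  then show ?thesis
  proof (rule eventually_mono, safe)
    fix N k assume "clock g m + T < clock g N" "age N k \<le> T"
    then have "\<not> k \<le> m" using clock_mono[of k m] by linarith
    then show "P k" using m by simp
  qed
qed

lemma weighted_null_sequence:
  assumes c: "c > 0" and b: "b \<longlonglongrightarrow> 0"
  shows "(\<lambda>N. \<Sum>k=1..N. g k * exp (- c * age N k) * b k) \<longlonglongrightarrow> 0"
proof -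
  obtain B where B: "\<And>k. \<bar>b k\<bar> \<le> B"
    using convergent_imp_Bseq[OF convergentI[OF b]] by (auto simp: Bseq_def)
  show ?thesis
  proof (rule weighted_sum_tendsto_0[OF c, where B=B])
    fix T \<epsilon> :: real assume "\<epsilon> > 0"
    then have "\<forall>\<^sub>F k in sequentially. \<bar>b k\<bar> \<le> \<epsilon>"
      using b[THEN tendstoD, of \<epsilon>] by (auto elim: eventually_mono)
    then show "\<forall>\<^sub>F N in sequentially. \<forall>k\<in>{1..N}. age N k \<le> T \<longrightarrow> \<bar>b k\<bar> \<le> \<epsilon>"
      by (rule eventually_window)
  qed (use B in auto)
qed

lemma g_powr_tendsto: "b > 0 \<Longrightarrow> (\<lambda>k. g k powr b) \<longlonglongrightarrow> 0"
  using tendsto_powr'[OF g_tendsto tendsto_const, of b] by (simp add: g_pos less_imp_le)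

lemma g_growth_obtain:
  obtains C where "C > 0" "\<And>N k. 1 \<le> k \<Longrightarrow> k \<le> N \<Longrightarrow> g k \<le> C * g N * exp (\<kappa> * age N k)"
proof -
  obtain C where C: "\<And>N k. k \<in> {1..N} \<Longrightarrow> g k \<le> C * g N * exp (\<kappa> * age N k)"
    using g_growth by blast
  have "C * g 1 \<ge> g 1" using C[of 1 1] by simp
  then have "C > 0" using g_pos[of 1] by (smt (verit) mult_le_0_iff)
  with C that show thesis by auto
qed

lemma g_pred_le:
  obtains C where "C > 0" "\<And>k. g k \<le> C * g (Suc k)"
proof -
  obtain C where C: "C > 0" "\<And>N k. 1 \<le> k \<Longrightarrow> k \<le> N \<Longrightarrow> g k \<le> C * g N * exp (\<kappa> * age N k)"
    by (erule g_growth_obtain)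
  \<comment> \<open>The summand \<open>g 0 / g 1\<close> covers \<open>k = 0\<close>, about which
    \<open>g_growth\<close> says nothing; the exponential covers the elapsed time
    \<open>g (Suc k)\<close>.\<close>
  define D where "D = C * exp (\<bar>\<kappa>\<bar> * g 0) + g 0 / g 1"
  have D: "D > 0" using C(1) g_pos by (simp add: D_def add_pos_pos)
  moreover have "g k \<le> D * g (Suc k)" for k
  proof (cases "k = 0")
    case True
    have "g 0 = g 0 / g 1 * g 1" using g_pos[of 1] by simp
    also have "\<dots> \<le> D * g 1" using C g_pos[of 1] by (simp add: D_def distrib_right)
    finally show ?thesis using True by simp
  next
    case False
    then have "g k \<le> C * g (Suc k) * exp (\<kappa> * g (Suc k))"
      using C(2)[of k "Suc k"] by (simp add: clock_Suc)
    also have "\<dots> \<le> C * g (Suc k) * exp (\<bar>\<kappa>\<bar> * g 0)"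
    proof -
      have "\<kappa> * g (Suc k) \<le> \<bar>\<kappa>\<bar> * g 0"
        using g_antimono[of 0 "Suc k"] g_pos[of "Suc k"] by (intro mult_mono) auto
      then show ?thesis using C g_pos[of "Suc k"] by (intro mult_left_mono) auto
    qed
    also have "\<dots> \<le> D * g (Suc k)"
      using g_pos[of 0] g_pos[of 1] g_pos[of "Suc k"] by (simp add: D_def distrib_right mult_ac)
    finally show ?thesis .
  qed
  ultimately show thesis by (rule that)
qed

text \<open>Once \<open>g j \<le> \<epsilon>\<close>, the squares are at most
  \<open>\<epsilon> * g j\<close>; the finitely many earlier ones go into \<open>D\<close>. The
  quadratic term of the moment recursion thus costs an arbitrarily small part of the contraction
  rate.\<close>

lemma sum_squares_le:
  assumes "\<epsilon> > 0"
  obtains D where "D \<ge> 0" "\<And>N k. k \<le> N \<Longrightarrow> (\<Sum>j\<in>{k<..N}. (g j)\<^sup>2) \<le> \<epsilon> * age N k + D"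
proof -
  obtain m where m: "\<And>j. j \<ge> m \<Longrightarrow> g j \<le> \<epsilon>"
    using g_tendsto[THEN order_tendstoD(2), OF assms] by (auto simp: eventually_sequentially intro: less_imp_le)
  define D where "D = (\<Sum>j<m. (g j)\<^sup>2)"
  have "(\<Sum>j\<in>{k<..N}. (g j)\<^sup>2) \<le> \<epsilon> * age N k + D" if "k \<le> N" for k N
  proof -
    have "(\<Sum>j\<in>{k<..N}. (g j)\<^sup>2) \<le> (\<Sum>j\<in>{k<..N}. \<epsilon> * g j + (if j < m then (g j)\<^sup>2 else 0))"
      using m g_pos assms by (intro sum_mono) (auto simp: power2_eq_square not_less less_imp_le mult_right_mono)
    also have "\<dots> = \<epsilon> * (\<Sum>j\<in>{k<..N}. g j) + (\<Sum>j\<in>{k<..N} \<inter> {..<m}. (g j)\<^sup>2)"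
      by (simp add: sum.distrib sum_distrib_left sum.inter_restrict[of _ _ "{..<m}"])
    also have "(\<Sum>j\<in>{k<..N}. g j) = age N k"
    proof -
      have "{1..N} = {1..k} \<union> {k<..N}" using that by auto
      then have "clock g N = clock g k + (\<Sum>j\<in>{k<..N}. g j)"
        unfolding clock_def by (simp only:) (subst sum.union_disjoint, auto)
      then show ?thesis by simp
    qed
    also have "(\<Sum>j\<in>{k<..N} \<inter> {..<m}. (g j)\<^sup>2) \<le> D"
      unfolding D_def by (intro sum_mono2) auto
    finally show ?thesis by simp
  qed
  moreover have "D \<ge> 0" by (simp add: D_def sum_nonneg)
  ultimately show thesis using that by blast
qed

end

lemma abs_integral_diff_le:
  fixes p :: "real \<Rightarrow> real"
  assumes "continuous_on {a..b} p" "a \<le> b" "\<And>u. u \<in> {a..b} \<Longrightarrow> \<bar>p u - y\<bar> \<le> \<epsilon>"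
  shows "\<bar>integral {a..b} p - (b - a) * y\<bar> \<le> \<epsilon> * (b - a)"
proof -
  have "integral {a..b} p - (b - a) * y = integral {a..b} (\<lambda>u. p u - y)"
    using assms by (subst integral_diff) (auto intro: integrable_continuous_interval)
  also have "norm \<dots> \<le> \<epsilon> * (b - a)"
    using assms by (intro integral_bound) (auto intro!: continuous_intros)
  finally show ?thesis by simp
qed

lemma set_integrable_exp_minus:
  fixes c :: real
  assumes "c > 0"
  shows "set_integrable lborel {0..} (\<lambda>x. exp (- c * x))"
proof -
  have "(\<lambda>x. exp (- c * x)) absolutely_integrable_on {0..}"
    using assms by (intro nonnegative_absolutely_integrable_1 integrable_on_exp_minus_to_infinity) auto
  then show ?thesis
    unfolding set_integrable_def by (subst (asm) integrable_completion) auto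
qed

context step_sequence
begin

text \<open>The sum is a Riemann sum for the integral over \<open>[0, clock g N]\<close> run backwards in time.\<close>

lemma Riemann_sum_tendsto:
  fixes q :: "real \<Rightarrow> real"
  defines "p \<equiv> \<lambda>x. exp (2 * \<zeta> * x) * q x"
  assumes q_cont: "continuous_on {0..} q"
    and q_le: "\<And>x. x \<ge> 0 \<Longrightarrow> \<bar>q x\<bar> \<le> K * exp (- 2 * lam * x)"
    and rates: "\<kappa> < 2 * lam" "\<zeta> < lam"
  shows "(\<lambda>N. \<Sum>k=1..N. (g k)\<^sup>2 / g N * q (age N k)) \<longlonglongrightarrow> (LBINT x:{0..}. p x)"
proof -
  \<comment> \<open>A decay rate common to the terms of the sum, where \<open>g k / g N\<close> may
    grow at rate \<kappa>, and to the integrand \<open>p\<close>.\<close>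
  define c where "c = min (2 * lam - \<kappa>) (2 * lam - 2 * \<zeta>)"
  have c: "c > 0" "c \<le> 2 * lam - \<kappa>" "c \<le> 2 * lam - 2 * \<zeta>"
    using rates by (auto simp: c_def)
  have K: "K \<ge> 0" using q_le[of 0] by simp
  have p_cont: "continuous_on S p" if "S \<subseteq> {0..}" for S
    unfolding p_def by (intro continuous_intros continuous_on_subset[OF q_cont that])
  have p_le: "\<bar>p x\<bar> \<le> K * exp (- c * x)" if "x \<ge> 0" for x
  proof -
    have "\<bar>p x\<bar> \<le> exp (2 * \<zeta> * x) * (K * exp (- 2 * lam * x))"
      unfolding p_def using q_le[OF that] by (simp add: abs_mult)
    also have "\<dots> = K * exp (- (2 * lam - 2 * \<zeta>) * x)"
      by (simp add: exp_add[symmetric] algebra_simps)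
    also have "\<dots> \<le> K * exp (- c * x)"
    proof -
      have "- (2 * lam - 2 * \<zeta>) * x \<le> - c * x" using c(3) that by (intro mult_right_mono) auto
      then show ?thesis using K by (intro mult_left_mono) (simp_all only: exp_le_cancel_iff)
    qed
    finally show ?thesis .
  qed
  obtain C where C: "C > 0" "\<And>N k. 1 \<le> k \<Longrightarrow> k \<le> N \<Longrightarrow> g k \<le> C * g N * exp (\<kappa> * age N k)"
    by (erule g_growth_obtain)
  define I where "I N k = integral {age N k..age N k + g k} p" for N k
  \<comment> \<open>\<open>a\<close> compares term and integral per unit of time. Half of the rate
    \<open>c\<close> is split off as summation weight; the other half keeps \<open>a\<close>
    bounded.\<close>
  define a where "a N k = exp (c / 2 * age N k) * (g k / g N * q (age N k) - I N k / g k)" for N k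
  have gq: "\<bar>g k / g N * q (age N k)\<bar> \<le> C * K * exp (- c * age N k)" if k: "1 \<le> k" "k \<le> N" for N k
  proof -
    have "\<bar>g k / g N * q (age N k)\<bar> \<le> (C * exp (\<kappa> * age N k)) * (K * exp (- 2 * lam * age N k))"
      unfolding abs_mult using C(1) C(2)[OF k] g_pos[of N] g_pos[of k] age_nonneg[OF k(2)]
      by (intro mult_mono q_le) (auto simp: field_simps)
    also have "\<dots> = C * K * exp (- (2 * lam - \<kappa>) * age N k)"
      by (simp add: exp_add[symmetric] algebra_simps)
    also have "\<dots> \<le> C * K * exp (- c * age N k)"
      using mult_right_mono[OF c(2) age_nonneg[OF k(2)]] C(1) K
      by (intro mult_left_mono) (simp_all only: exp_le_cancel_iff mult_minus_left neg_le_iff_le, simp)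
    finally show ?thesis .
  qed
  have I_le: "\<bar>I N k / g k\<bar> \<le> K * exp (- c * age N k)" if k: "1 \<le> k" "k \<le> N" for N k
  proof -
    have "norm (I N k) \<le> K * exp (- c * age N k) * (age N k + g k - age N k)"
      unfolding I_def
    proof (rule integral_bound)
      show "continuous_on {age N k..age N k + g k} p"
        using age_nonneg[OF k(2)] by (intro p_cont) auto
      fix t assume t: "t \<in> {age N k..age N k + g k}"
      have "\<bar>p t\<bar> \<le> K * exp (- c * t)"
        using t age_nonneg[OF k(2)] by (intro p_le) simp
      also have "\<dots> \<le> K * exp (- c * age N k)"
        using t c K by (intro mult_left_mono) auto
      finally show "norm (p t) \<le> K * exp (- c * age N k)" by simp
    qed (use g_pos[of k] in simp)
    then show ?thesis using g_pos[of k] by (simp add: field_simps)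
  qed
  have lim0: "(\<lambda>N. \<Sum>k=1..N. g k * exp (- (c / 2) * age N k) * a N k) \<longlonglongrightarrow> 0"
  proof (rule weighted_sum_tendsto_0)
    show "c / 2 > 0" using c by simp
    fix N k :: nat assume k: "1 \<le> k" "k \<le> N"
    have "\<bar>a N k\<bar> = exp (c / 2 * age N k) * \<bar>g k / g N * q (age N k) - I N k / g k\<bar>"
      by (simp add: a_def abs_mult)
    also have "\<dots> \<le> exp (c / 2 * age N k) * ((C * K + K) * exp (- c * age N k))"
      unfolding distrib_right
      by (intro mult_left_mono order_trans[OF abs_triangle_ineq4] add_mono gq[OF k] I_le[OF k]) simp
    also have "\<dots> = (C * K + K) * exp (- (c / 2) * age N k)"
      by (simp add: exp_add[symmetric] algebra_simps)
    also have "\<dots> \<le> (C * K + K) * 1"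
      using C(1) K c age_nonneg[OF k(2)] by (intro mult_left_mono) auto
    finally show "\<bar>a N k\<bar> \<le> C * K + K" by simp
  next
    fix T \<epsilon> :: real assume "\<epsilon> > 0"
    define T' where "T' = max T 0"
    \<comment> \<open>Two errors \<delta>, enlarged by \<open>exp (c / 2 * T')\<close>, add up to
      \<epsilon>.\<close>
    define \<delta> where "\<delta> = \<epsilon> / (2 * exp (c / 2 * T'))"
    have \<delta>: "\<delta> > 0" using \<open>\<epsilon> > 0\<close> by (simp add: \<delta>_def)
    have "uniformly_continuous_on {0..T' + g 0} p"
      by (intro compact_uniformly_continuous p_cont) auto
    then obtain d where d: "d > 0" "\<And>x u. x \<in> {0..T' + g 0} \<Longrightarrow> u \<in> {0..T' + g 0} \<Longrightarrow> \<bar>u - x\<bar> < d \<Longrightarrow> \<bar>p u - p x\<bar> < \<delta>"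
      using \<delta> unfolding uniformly_continuous_on_def dist_real_def by metis
    have "\<forall>\<^sub>F k in sequentially. g k < d"
      using g_tendsto d(1) by (rule order_tendstoD(2))
    then have small: "\<forall>\<^sub>F N in sequentially. \<forall>k\<in>{1..N}. age N k \<le> T \<longrightarrow> g k < d"
      by (rule eventually_window)
    have ratio: "\<forall>\<^sub>F N in sequentially. \<forall>k\<in>{1..N}. age N k \<le> T \<longrightarrow>
      \<bar>g k / g N * exp (- 2 * \<zeta> * age N k) - 1\<bar> \<le> \<delta> / (K + 1)"
      using \<delta> K by (intro g_ratio) simp
    show "\<forall>\<^sub>F N in sequentially. \<forall>k\<in>{1..N}. age N k \<le> T \<longrightarrow> \<bar>a N k\<bar> \<le> \<epsilon>"
      using small ratio
    proof eventually_elim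
      case (elim N)
      show ?case
      proof safe
        fix k assume k: "k \<in> {1..N}" "age N k \<le> T"
        define x where "x = age N k"
        have x: "x \<ge> 0" "x \<le> T'" using k age_nonneg[of k N] by (auto simp: x_def T'_def)
        have gk: "g k > 0" "g k < d" "g k \<le> g 0" using elim(1) k g_pos g_antimono by auto
        have "\<bar>I N k - (x + g k - x) * p x\<bar> \<le> \<delta> * (x + g k - x)"
          unfolding I_def x_def[symmetric]
        proof (rule abs_integral_diff_le)
          fix u assume u: "u \<in> {x..x + g k}"
          then have "\<bar>p u - p x\<bar> < \<delta>"
            using x gk by (intro d) auto
          then show "\<bar>p u - p x\<bar> \<le> \<delta>" by simp
        qed (use gk x in \<open>auto intro: p_cont\<close>)
        then have 1: "\<bar>I N k / g k - p x\<bar> \<le> \<delta>"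
          using gk by (simp add: abs_le_iff field_simps)
        \<comment> \<open>The first factor on the right is the quantity controlled by
          \<open>g_ratio\<close>; this is how the shift \<zeta> enters the limit integrand.\<close>
        have "g k / g N * q x - p x = (g k / g N * exp (- 2 * \<zeta> * x) - 1) * p x"
          by (simp add: p_def algebra_simps exp_minus)
        also have "\<bar>\<dots>\<bar> \<le> (\<delta> / (K + 1)) * K"
          unfolding abs_mult
        proof (rule mult_mono)
          show "\<bar>g k / g N * exp (- 2 * \<zeta> * x) - 1\<bar> \<le> \<delta> / (K + 1)"
            using elim(2) k by (simp add: x_def)
          have "\<bar>p x\<bar> \<le> K * exp (- c * x)" by (rule p_le) fact
          also have "\<dots> \<le> K * 1" using c x K by (intro mult_left_mono) auto
          finally show "\<bar>p x\<bar> \<le> K" by simp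
        qed (use \<delta> K in auto)
        also have "\<dots> \<le> \<delta>" using \<delta> K by (simp add: field_simps)
        finally have 2: "\<bar>g k / g N * q x - p x\<bar> \<le> \<delta>" .
        have "\<bar>a N k\<bar> = exp (c / 2 * x) * \<bar>g k / g N * q x - I N k / g k\<bar>"
          by (simp add: a_def abs_mult x_def)
        also have "\<dots> \<le> exp (c / 2 * T') * (2 * \<delta>)"
          using 1 2 x c by (intro mult_mono) auto
        also have "\<dots> = \<epsilon>" by (simp add: \<delta>_def)
        finally show "\<bar>a N k\<bar> \<le> \<epsilon>" .
      qed
    qed
  qed
  \<comment> \<open>The intervals of the \<open>I N k\<close> abut, since
    \<open>age N k + g k = age N (k - 1)\<close>, and tile the time from 0 to
    \<open>clock g N\<close>.\<close>
  have telescope: "(\<Sum>k=1..N. I N k) = integral {0..clock g N} p" for N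
  proof -
    have "(\<Sum>k=1..N. I M k) = integral {age M N..age M 0} p" if "N \<le> M" for M
      using that
    proof (induction N)
      case (Suc N)
      have "age M (Suc N) + g (Suc N) = age M N" by (simp add: clock_Suc)
      then have "I M (Suc N) = integral {age M (Suc N)..age M N} p" by (simp only: I_def)
      then have "(\<Sum>k=1..Suc N. I M k) = integral {age M N..age M 0} p + integral {age M (Suc N)..age M N} p"
        using Suc by simp
      also have "\<dots> = integral {age M (Suc N)..age M 0} p"
        using clock_mono[of N "Suc N"] clock_mono[of 0 N] clock_mono[of "Suc N" M] Suc
        by (subst add.commute, intro Henstock_Kurzweil_Integration.integral_combine integrable_continuous_interval p_cont) auto
      finally show ?case .
    qed simp
    from this[of N] show ?thesis by (simp add: clock_def)
  qed
  have eq: "(\<Sum>k=1..N. (g k)\<^sup>2 / g N * q (age N k)) =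
      (\<Sum>k=1..N. g k * exp (- (c / 2) * age N k) * a N k) + integral {0..clock g N} p" for N
  proof -
    have "g k * exp (- (c / 2) * age N k) * a N k = (g k)\<^sup>2 / g N * q (age N k) - I N k" for k
      using g_pos[of k] by (simp add: a_def power2_eq_square right_diff_distrib exp_add[symmetric] mult.assoc[symmetric])
    then show ?thesis by (simp add: sum_subtractf telescope[symmetric])
  qed
  have p_int: "set_integrable lborel {0..} p"
  proof (rule set_integrable_bound)
    show "set_integrable lborel {0..} (\<lambda>x. K * exp (- c * x))"
      using set_integrable_exp_minus[OF c(1)] by simp
    show "set_borel_measurable lborel {0..} p"
      unfolding set_borel_measurable_def
      using borel_measurable_continuous_on_indicator[OF _ p_cont[of "{0..}"]] by simp
    show "AE x in lborel. x \<in> {0..} \<longrightarrow> norm (p x) \<le> norm (K * exp (- c * x))"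
      using p_le K by (auto intro!: AE_I2)
  qed
  have "((\<lambda>b. LBINT x:{0..b}. p x) \<longlongrightarrow> (LBINT x:{0..}. p x)) at_top"
    by (rule tendsto_set_lebesgue_integral_at_top) (use p_int in auto)
  then have "(\<lambda>N. LBINT x:{0..clock g N}. p x) \<longlonglongrightarrow> (LBINT x:{0..}. p x)"
    by (rule filterlim_compose) (rule clock_at_top)
  moreover have "(LBINT x:{0..b}. p x) = integral {0..b} p" for b
    by (intro set_borel_integral_eq_integral(2) set_integrable_subset[OF p_int]) auto
  ultimately have "(\<lambda>N. integral {0..clock g N} p) \<longlonglongrightarrow> (LBINT x:{0..}. p x)"
    by simp
  from tendsto_add[OF lim0 this] show ?thesis
    unfolding eq by simp
qed

end

section \<open>The asymptotic covariance\<close>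

lemma inner_congruence: "x \<bullet> ((E ** \<Gamma> ** transpose E) *v y) =
    (transpose E *v x) \<bullet> (\<Gamma> *v (transpose E *v y))"
  for E \<Gamma> :: "real ^ 'n ^ 'n"
  by (simp add: matrix_vector_mul_assoc[symmetric] dot_lmul_matrix)

lemma continuous_on_matrix_mult [continuous_intros]:
  fixes f g :: "real \<Rightarrow> real ^ 'n ^ 'n"
  assumes "continuous_on S f" "continuous_on S g"
  shows "continuous_on S (\<lambda>s. f s ** g s)"
  unfolding matrix_matrix_mult_def using assms
  by (intro continuous_on_vec_lambda continuous_intros)

lemma continuous_on_transpose [continuous_intros]:
  fixes f :: "real \<Rightarrow> real ^ 'n ^ 'n"
  assumes "continuous_on S f"
  shows "continuous_on S (\<lambda>s. transpose (f s))"
  unfolding transpose_def using assms by (intro continuous_on_vec_lambda continuous_intros)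

lemma matrix_exp_eq_mflow:
  "matrix_exp ((- s) *\<^sub>R (A - \<zeta> *\<^sub>R mat 1)) = exp (\<zeta> * s) *\<^sub>R mflow A \<zeta> s"
  by (simp add: mflow_def exp_add[symmetric])

context
  fixes A \<Gamma> :: "real ^ 'n ^ 'n" and lam \<zeta> :: real
  assumes A: "\<And>v. v \<bullet> (A *v v) \<ge> lam * (norm v)\<^sup>2" and rate: "\<zeta> < lam"
begin

definition cov_density :: "real \<Rightarrow> real ^ 'n ^ 'n" where
  "cov_density s = matrix_exp ((- s) *\<^sub>R (A - \<zeta> *\<^sub>R mat 1)) ** \<Gamma> **
        transpose (matrix_exp ((- s) *\<^sub>R (A - \<zeta> *\<^sub>R mat 1)))"

lemma inner_cov_density:
  "x \<bullet> (cov_density s *v y) = exp (2 * \<zeta> * s) *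
     ((transpose (mflow A \<zeta> s) *v x) \<bullet> (\<Gamma> *v (transpose (mflow A \<zeta> s) *v y)))"
proof -
  have t: "transpose (c *\<^sub>R M) = c *\<^sub>R transpose M" for c and M :: "real ^ 'n ^ 'n"
    by (simp add: transpose_def vec_eq_iff)
  have "exp (2 * \<zeta> * s) = exp (\<zeta> * s) * exp (\<zeta> * s)"
    by (simp add: exp_add[symmetric])
  then show ?thesis
    unfolding cov_density_def inner_congruence
    unfolding matrix_exp_eq_mflow t
    by (simp add: scaleR_matrix_vector_assoc[symmetric] matrix_vector_mult_scaleR del: transpose_matrix_vector)
qed

text \<open>The shift contributes \<open>exp (2 * \<zeta> * s)\<close> and the two flows at most
  \<open>exp (- 2 * lam * s)\<close>; \<open>\<zeta> < lam\<close> makes the product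
  integrable.\<close>

lemma set_integrable_cov_density: "set_integrable lborel {0..} cov_density"
proof (rule set_integrable_bound)
  define c where "c = 2 * (lam - \<zeta>)"
  have c: "c > 0" using rate by (simp add: c_def)
  let ?K = "(\<Sum>i\<in>(UNIV::'n set). \<Sum>j\<in>(UNIV::'n set). norm \<Gamma>)"
  show "set_integrable lborel {0..} (\<lambda>s. ?K * exp (- c * s))"
    using set_integrable_exp_minus[OF c] by (intro set_integrable_mult_right) simp
  have "continuous_on {0..} cov_density"
    unfolding cov_density_def matrix_exp_eq_mflow
    by (intro continuous_intros continuous_on_mflow)
  from borel_measurable_continuous_on_indicator[OF _ this]
  show "set_borel_measurable lborel {0..} cov_density"
    unfolding set_borel_measurable_def by simp
  have "norm (cov_density s) \<le> ?K * exp (- c * s)" if s: "s \<ge> 0" for s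
  proof -
    have "\<bar>cov_density s $ i $ j\<bar> \<le> norm \<Gamma> * exp (- c * s)" for i j
    proof -
      define w where "w i = transpose (mflow A \<zeta> s) *v axis i 1" for i
      have w: "norm (w i) \<le> exp (- lam * s)" for i
        unfolding w_def using norm_transpose_mflow_le[OF A s, of \<zeta> "axis i 1"] by simp
      have "cov_density s $ i $ j = exp (2 * \<zeta> * s) * (w i \<bullet> (\<Gamma> *v w j))"
        unfolding inner_axis_matrix[symmetric] w_def by (rule inner_cov_density)
      also have "\<bar>\<dots>\<bar> \<le> exp (2 * \<zeta> * s) * (exp (- lam * s) * (norm \<Gamma> * exp (- lam * s)))"
        unfolding abs_mult using w
        by (intro mult_mono order_trans[OF Cauchy_Schwarz_ineq2] order_trans[OF norm_matrix_vector_mult_le]) auto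
      also have "\<dots> = norm \<Gamma> * exp (- c * s)"
        by (simp add: c_def exp_add[symmetric] algebra_simps mult_exp_exp)
      finally show ?thesis .
    qed
    then have "norm (cov_density s) \<le> (\<Sum>i\<in>(UNIV::'n set). \<Sum>j\<in>(UNIV::'n set). norm \<Gamma> * exp (- c * s))"
      by (intro order_trans[OF norm_matrix_le_sum] sum_mono)
    then show ?thesis by (simp add: sum_distrib_right)
  qed
  then show "AE s in lborel. s \<in> {0..} \<longrightarrow> norm (cov_density s) \<le> norm (?K * exp (- c * s))"
    by (intro AE_I2) (auto intro: order_trans)
qed

lemma inner_asymptotic_covariance:
  "x \<bullet> (asymptotic_covariance A \<Gamma> \<zeta> *v y) = (LBINT s:{0..}. exp (2 * \<zeta> * s) *
     ((transpose (mflow A \<zeta> s) *v x) \<bullet> (\<Gamma> *v (transpose (mflow A \<zeta> s) *v y))))"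
proof -
  define T where "T M = x \<bullet> (M *v y)" for M :: "real ^ 'n ^ 'n"
  have T: "bounded_linear T" unfolding T_def by (rule bounded_linear_bilinear_form)
  have "T (asymptotic_covariance A \<Gamma> \<zeta>) = T (LBINT s:{0..}. cov_density s)"
    by (simp add: asymptotic_covariance_def cov_density_def)
  also have "\<dots> = (LBINT s:{0..}. T (cov_density s))"
    using integral_bounded_linear[OF T set_integrable_cov_density[unfolded set_integrable_def]]
    unfolding set_lebesgue_integral_def by (simp add: linear_scale[OF bounded_linear.linear[OF T]])
  finally show ?thesis
    by (simp add: T_def inner_cov_density)
qed

text \<open>The integrand is at each time a congruence of \<Gamma>, which keeps symmetry and
  nonnegativity. With \<open>psd_factorization\<close> this makes \<open>gaussian_char\<close>
  applicable to the limit law.\<close>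

lemma psd_asymptotic_covariance:
  assumes "psd \<Gamma>"
  shows "psd (asymptotic_covariance A \<Gamma> \<zeta>)"
  unfolding psd_def
proof
  have sym: "x \<bullet> (asymptotic_covariance A \<Gamma> \<zeta> *v y) = y \<bullet> (asymptotic_covariance A \<Gamma> \<zeta> *v x)" for x y
    unfolding inner_asymptotic_covariance using psd_inner_sym[OF assms] by simp
  show "transpose (asymptotic_covariance A \<Gamma> \<zeta>) = asymptotic_covariance A \<Gamma> \<zeta>"
    using sym[of "axis _ 1" "axis _ 1"] by (simp add: inner_axis_matrix transpose_def vec_eq_iff)
  show "\<forall>v. 0 \<le> v \<bullet> (asymptotic_covariance A \<Gamma> \<zeta> *v v)"
    unfolding inner_asymptotic_covariance set_lebesgue_integral_def
    using assms by (auto intro!: integral_nonneg_AE AE_I2 simp: psd_def)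
qed

end

section \<open>Regularly varying step sequences\<close>

text \<open>Monotonicity turns the limit of the single ratio at \<open>1 + \<delta>\<close> into a
  bound for all \<open>u\<close> up to \<open>(1 + \<delta>) * t\<close>; \<delta> is chosen so that
  \<open>(1 + \<delta>) powr \<rho>\<close> is still above \<open>1 - \<epsilon>\<close>.\<close>

lemma regularly_varying_near:
  assumes pos: "\<And>t. t \<ge> 0 \<Longrightarrow> \<gamma> t > 0" and anti: "antimono_on {0..} \<gamma>"
    and rv: "regularly_varying \<gamma> \<rho>" and "\<epsilon> > 0"
  shows "\<exists>\<delta>>0. \<exists>T>0. \<forall>t\<ge>T. \<forall>u\<ge>0. u \<le> (1 + \<delta>) * t \<longrightarrow> \<gamma> u \<ge> (1 - \<epsilon>) * \<gamma> t"
proof -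
  have "((\<lambda>x. x powr \<rho>) \<longlongrightarrow> 1 powr \<rho>) (at 1)"
    by (intro tendsto_intros) auto
  then have "\<forall>\<^sub>F x in at 1. x powr \<rho> > 1 - \<epsilon>"
    using \<open>\<epsilon> > 0\<close> by (intro order_tendstoD(1)) auto
  then obtain d where d: "d > 0" "\<And>x. x \<noteq> 1 \<Longrightarrow> dist x 1 < d \<Longrightarrow> x powr \<rho> > 1 - \<epsilon>"
    by (auto simp: eventually_at)
  define \<delta> where "\<delta> = d / 2"
  have "(1 + \<delta>) powr \<rho> > 1 - \<epsilon>"
    using d(1) by (intro d(2)) (auto simp: \<delta>_def dist_real_def)
  moreover have "((\<lambda>t. \<gamma> (t * (1 + \<delta>)) / \<gamma> t) \<longlongrightarrow> (1 + \<delta>) powr \<rho>) at_top"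
    using rv d(1) by (simp add: regularly_varying_def \<delta>_def)
  ultimately have "\<forall>\<^sub>F t in at_top. \<gamma> (t * (1 + \<delta>)) / \<gamma> t > 1 - \<epsilon>"
    by (intro order_tendstoD(1))
  then obtain T where T: "\<And>t. t \<ge> T \<Longrightarrow> \<gamma> (t * (1 + \<delta>)) / \<gamma> t > 1 - \<epsilon>"
    by (auto simp: eventually_at_top_linorder)
  show ?thesis
  proof (rule exI[of _ \<delta>], rule conjI[OF _ exI[of _ "max T 1"]], safe)
    show "\<delta> > 0" using d by (simp add: \<delta>_def)
    fix t u assume t: "t \<ge> max T 1" and u: "0 \<le> u" "u \<le> (1 + \<delta>) * t"
    have "(1 - \<epsilon>) * \<gamma> t \<le> \<gamma> (t * (1 + \<delta>))"
      using T[of t] t pos[of t] by (simp add: field_simps)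
    also have "\<dots> \<le> \<gamma> u"
      using u t d by (intro monotone_onD[OF anti]) (auto simp: \<delta>_def algebra_simps)
    finally show "\<gamma> u \<ge> (1 - \<epsilon>) * \<gamma> t" .
  qed auto
qed

text \<open>Doubling \<open>t\<close> multiplies \<open>t * \<gamma> t\<close> by nearly
  \<open>2 powr (1 - a) > 1\<close>, so it grows geometrically along \<open>2 ^ m * t0\<close>;
  between dyadic points monotonicity of \<gamma> loses at most a factor 2.\<close>

lemma regularly_varying_ident_mult_at_top:
  assumes pos: "\<And>t. t \<ge> 0 \<Longrightarrow> \<gamma> t > 0" and anti: "antimono_on {0..} \<gamma>"
    and rv: "regularly_varying \<gamma> (- a)" and a: "a < 1"
  shows "filterlim (\<lambda>t. t * \<gamma> t) at_top at_top"
  unfolding filterlim_at_top_ge[where c=0]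
proof safe
  fix Z :: real assume "Z \<ge> 0"
  define c where "c = (1 + 2 powr (1 - a)) / 2"
  have "(2::real) powr (1 - a) > 2 powr 0" using a by (intro powr_less_mono) auto
  then have c: "c > 1" "c < 2 powr (1 - a)" by (auto simp: c_def)
  have "((\<lambda>t. 2 * (\<gamma> (t * 2) / \<gamma> t)) \<longlongrightarrow> 2 * 2 powr (- a)) at_top"
    using rv by (intro tendsto_intros) (simp add: regularly_varying_def)
  moreover have "2 * 2 powr (- a) = (2::real) powr (1 - a)" by (simp add: powr_diff powr_minus field_simps)
  ultimately have "\<forall>\<^sub>F t in at_top. 2 * (\<gamma> (t * 2) / \<gamma> t) > c"
    using c by (intro order_tendstoD(1)) auto
  then obtain T where T: "\<And>t. t \<ge> T \<Longrightarrow> 2 * (\<gamma> (t * 2) / \<gamma> t) > c"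
    by (auto simp: eventually_at_top_linorder)
  define t0 where "t0 = max T 1"
  have t0: "t0 \<ge> 1" "t0 \<ge> T" by (auto simp: t0_def)
  define G where "G t = t * \<gamma> t" for t
  have G0: "G t0 > 0" using t0 pos[of t0] by (simp add: G_def)
  have dbl: "G (2 ^ m * t0) \<ge> c ^ m * G t0" for m
  proof (induction m)
    case (Suc m)
    define t where "t = 2 ^ m * t0"
    have "t0 \<le> t" using t0 by (simp add: t_def)
    then have "T \<le> t" "t > 0" using t0 by auto
    then have "c * G t \<le> G (t * 2)"
      using T[of t] pos[of t] by (simp add: G_def field_simps)
    moreover have "c * (c ^ m * G t0) \<le> c * G t"
      using Suc c by (intro mult_left_mono) (auto simp: t_def)
    ultimately show ?case by (simp add: t_def mult_ac)
  qed simp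
  obtain m where m: "2 * Z / G t0 < c ^ m"
    using real_arch_pow[OF c(1)] by blast
  have "Z \<le> G t" if t: "t \<ge> 2 ^ m * t0" for t
  proof -
    \<comment> \<open>The dyadic block with \<open>2 ^ k * t0 \<le> t\<close> and
      \<open>t < 2 ^ Suc k * t0\<close>.\<close>
    define k where "k = (LEAST k. t < 2 ^ Suc k * t0)"
    have "\<exists>k. t < 2 ^ Suc k * t0"
    proof -
      obtain k where "t / t0 < 2 ^ k" using real_arch_pow[of 2 "t / t0"] by auto
      then have "t < 2 ^ k * t0" using t0 by (simp add: field_simps)
      also have "\<dots> \<le> 2 ^ Suc k * t0" using t0 by simp
      finally show ?thesis by blast
    qed
    then have k: "t < 2 ^ Suc k * t0" unfolding k_def by (rule LeastI_ex)
    have k2: "2 ^ k * t0 \<le> t"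
    proof (cases k)
      case 0
      have "1 * t0 \<le> 2 ^ m * t0" using t0 by (intro mult_right_mono) auto
      then show ?thesis using 0 t by simp
    next
      case (Suc j)
      then have "\<not> t < 2 ^ Suc j * t0" unfolding k_def by (intro not_less_Least) simp
      then show ?thesis using Suc by simp
    qed
    have "m < Suc k"
    proof -
      have "2 ^ m * t0 < 2 ^ Suc k * t0" using t k by linarith
      then have "(2::real) ^ m < 2 ^ Suc k" using t0 by simp
      then show ?thesis by (rule power_less_imp_less_exp[rotated]) simp
    qed
    have "t \<ge> 0" using t t0 by (smt (verit) zero_le_mult_iff zero_le_power)
    have "2 * Z \<le> c ^ m * G t0" using m G0 by (simp add: field_simps)
    also have "\<dots> \<le> c ^ Suc k * G t0"
      using \<open>m < Suc k\<close> c G0 by (intro mult_right_mono power_increasing) auto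
    also have "\<dots> \<le> G (2 ^ Suc k * t0)" by (rule dbl)
    also have "\<dots> \<le> 2 ^ Suc k * t0 * \<gamma> t"
      unfolding G_def using k t0 \<open>t \<ge> 0\<close> by (intro mult_left_mono monotone_onD[OF anti]) auto
    also have "\<dots> \<le> 2 * t * \<gamma> t"
      using k2 pos[OF \<open>t \<ge> 0\<close>] by (intro mult_right_mono) auto
    finally show ?thesis by (simp add: G_def)
  qed
  then show "\<forall>\<^sub>F t in at_top. Z \<le> t * \<gamma> t"
    unfolding G_def eventually_at_top_linorder by blast
qed

lemma sum_const_le_clock_diff:
  assumes "\<And>k l. k \<le> l \<Longrightarrow> g l \<le> g k" "k \<le> l"
  shows "real (l - k) * g l \<le> clock g l - clock g k"
  using assms(2)
proof (induction l rule: dec_induct)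
  case (step l)
  have "real (Suc l - k) * g (Suc l) = real (l - k) * g (Suc l) + g (Suc l)"
    using step by (simp add: Suc_diff_le algebra_simps)
  also have "\<dots> \<le> real (l - k) * g l + g (Suc l)"
    using assms(1)[of l "Suc l"] by (intro add_right_mono mult_left_mono) auto
  finally show ?case using step by (simp add: clock_Suc)
qed simp

text \<open>As \<open>k * g k\<close> tends to infinity, a bounded amount of time after index
  \<open>k\<close> is used up by o(k) further steps, over which a regularly varying \<gamma> hardly
  changes. So the steps are asymptotically constant on time windows, which gives \<zeta> = 0, and
  grow backwards more slowly than any exponential, which gives every \<kappa> > 0.\<close>

theorem step_sequence_subharmonic:
  assumes pos: "\<And>t. t \<ge> 0 \<Longrightarrow> \<gamma> t > 0" and anti: "antimono_on {0..} \<gamma>"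
    and lim: "(\<gamma> \<longlongrightarrow> 0) at_top"
    and rv: "regularly_varying \<gamma> (- a)" and a: "a < 1" and \<kappa>: "\<kappa> > 0"
  shows "step_sequence (\<lambda>k. \<gamma> (real k)) \<kappa> 0"
proof -
  define g where "g k = \<gamma> (real k)" for k :: nat
  have g_pos: "g k > 0" for k using pos by (simp add: g_def)
  have g_anti: "g l \<le> g k" if "k \<le> l" for k l
    unfolding g_def using that by (intro monotone_onD[OF anti]) auto
  have g_lim: "g \<longlonglongrightarrow> 0"
    unfolding g_def using lim filterlim_real_sequentially by (rule filterlim_compose)
  have kg: "filterlim (\<lambda>k. real k * g k) at_top sequentially"
    unfolding g_def using regularly_varying_ident_mult_at_top[OF pos anti rv a] filterlim_real_sequentially
    by (rule filterlim_compose)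
  have cmono: "clock g k \<le> clock g l" if "k \<le> l" for k l
    unfolding clock_def using that g_pos by (intro sum_mono2) (auto intro: less_imp_le)
  have c_top: "filterlim (clock g) at_top sequentially"
  proof (rule filterlim_at_top_mono[OF kg], rule always_eventually, rule allI)
    fix k show "real k * g k \<le> clock g k"
      using sum_const_le_clock_diff[of g 0 k, OF g_anti] by (simp add: clock_def)
  qed
  have window: "\<exists>m. \<forall>k\<ge>m. \<forall>N\<ge>k. clock g N - clock g k \<le> T \<longrightarrow> (1 - \<epsilon>) * g k \<le> g N"
    if eps: "0 < \<epsilon>" "\<epsilon> < 1" for T \<epsilon>
  proof -
    obtain \<delta> T0 where \<delta>: "\<delta> > 0" "T0 > 0"
      "\<And>t u. t \<ge> T0 \<Longrightarrow> u \<ge> 0 \<Longrightarrow> u \<le> (1 + \<delta>) * t \<Longrightarrow> \<gamma> u \<ge> (1 - \<epsilon>) * \<gamma> t"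
      using regularly_varying_near[OF pos anti rv eps(1)] by blast
    have "filterlim (\<lambda>k. (1 - \<epsilon>) * (\<delta> * (real k * g k) - g k)) at_top sequentially"
    proof (intro filterlim_tendsto_pos_mult_at_top[OF tendsto_const])
      show "filterlim (\<lambda>k. \<delta> * (real k * g k) - g k) at_top sequentially"
        using filterlim_tendsto_add_at_top[OF tendsto_minus[OF g_lim]
          filterlim_tendsto_pos_mult_at_top[OF tendsto_const \<open>\<delta> > 0\<close> kg]] by simp
    qed (use eps in auto)
    then have "\<forall>\<^sub>F k in sequentially. T < (1 - \<epsilon>) * (\<delta> * (real k * g k) - g k)"
      by (simp add: filterlim_at_top_dense)
    moreover have "\<forall>\<^sub>F k in sequentially. real k \<ge> T0"
      using filterlim_real_sequentially by (simp add: filterlim_at_top)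
    ultimately have "\<forall>\<^sub>F k in sequentially. \<forall>N\<ge>k. clock g N - clock g k \<le> T \<longrightarrow> (1 - \<epsilon>) * g k \<le> g N"
    proof eventually_elim
      case (elim k)
      show ?case
      proof safe
        fix N assume N: "k \<le> N" "clock g N - clock g k \<le> T"
        show "(1 - \<epsilon>) * g k \<le> g N"
        proof (cases "real N \<le> (1 + \<delta>) * real k")
          case True
          then show ?thesis using \<delta>(3)[of "real k" "real N"] elim by (simp add: g_def)
        next
          case False
          \<comment> \<open>With \<open>N\<close> beyond \<open>(1 + \<delta>) * k\<close>, the
            stretch from \<open>k\<close> to \<open>l\<close> alone takes more time than
            \<open>T\<close>, because its steps are at least \<open>(1 - \<epsilon>) * g k\<close>:
            a contradiction.\<close>
          define l where "l = k + nat \<lfloor>\<delta> * real k\<rfloor>"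
          have l: "real (l - k) \<ge> \<delta> * real k - 1" "real l \<le> (1 + \<delta>) * real k"
            using \<delta>(1) floor_correct[of "\<delta> * real k"] unfolding l_def by (auto simp: distrib_right)
          have "k \<le> l" "l \<le> N" using False l by (auto simp: l_def[symmetric]) (auto simp: l_def)
          have "(1 - \<epsilon>) * (\<delta> * (real k * g k) - g k) = (\<delta> * real k - 1) * ((1 - \<epsilon>) * g k)"
            by (simp add: algebra_simps)
          also have "\<dots> \<le> real (l - k) * ((1 - \<epsilon>) * g k)"
            using l eps g_pos[of k] by (intro mult_right_mono) auto
          also have "\<dots> \<le> real (l - k) * g l"
            using \<delta>(3)[of "real k" "real l"] elim l by (intro mult_left_mono) (auto simp: g_def)
          also have "\<dots> \<le> clock g l - clock g k"
            using g_anti \<open>k \<le> l\<close> by (rule sum_const_le_clock_diff)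
          also have "\<dots> \<le> T" using N(2) cmono[OF \<open>l \<le> N\<close>] by simp
          finally show ?thesis using elim(1) by simp
        qed
      qed
    qed
    then show ?thesis by (simp add: eventually_sequentially)
  qed
  have growth: "\<exists>C. \<forall>N. \<forall>k\<in>{1..N}. g k \<le> C * g N * exp (\<kappa> * (clock g N - clock g k))"
  proof -
    \<comment> \<open>Over a time window of length at most \<open>T + g 0\<close> the late steps
      shrink by at most the factor 2, and \<open>exp (\<kappa> * T) \<ge> 2\<close> pays for it if
      the window is at least \<open>T\<close> long. Chaining such windows gives the exponential
      bound.\<close>
    define T where "T = 1 / \<kappa>"
    have T: "T > 0" "exp (\<kappa> * T) \<ge> 2" using \<kappa> exp_ge_add_one_self[of 1] by (auto simp: T_def)
    obtain m where m: "\<And>k N. k \<ge> m \<Longrightarrow> N \<ge> k \<Longrightarrow> clock g N - clock g k \<le> T + g 0 \<Longrightarrow> g k \<le> 2 * g N"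
    proof -
      have "\<exists>m. \<forall>k\<ge>m. \<forall>N\<ge>k. clock g N - clock g k \<le> T + g 0 \<longrightarrow> g k \<le> 2 * g N"
        using window[of "1/2" "T + g 0"] by (simp add: mult.commute)
      then show thesis using that by blast
    qed
    have late: "g k \<le> 2 * g N * exp (\<kappa> * (clock g N - clock g k))" if "m \<le> k" "k \<le> N" for k N
      using that
    proof (induction "N - k" arbitrary: k rule: less_induct)
      case less
      show ?case
      proof (cases "clock g N - clock g k \<le> T + g 0")
        case True
        have "1 * g N \<le> exp (\<kappa> * (clock g N - clock g k)) * g N"
          using cmono[OF less.prems(2)] \<kappa> g_pos[of N] by (intro mult_right_mono) auto
        then show ?thesis using m[OF less.prems True] by (simp add: mult_ac)
      next
        case False
        \<comment> \<open>The first index at least \<open>T\<close> later; minimality bounds the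
          overshoot by one step, hence by \<open>g 0\<close>.\<close>
        define j where "j = (LEAST j. k \<le> j \<and> clock g j - clock g k \<ge> T)"
        have ex: "k \<le> N \<and> clock g N - clock g k \<ge> T" using False less.prems g_pos[of 0] by auto
        then have j: "k \<le> j" "clock g j - clock g k \<ge> T" "j \<le> N"
          using LeastI[of "\<lambda>j. k \<le> j \<and> clock g j - clock g k \<ge> T", OF ex]
            Least_le[of "\<lambda>j. k \<le> j \<and> clock g j - clock g k \<ge> T", OF ex]
          unfolding j_def by auto
        have "k \<noteq> j" using j(2) T by auto
        then obtain i where i: "j = Suc i" "k \<le> i" using j(1) by (cases j) auto
        have "\<not> (k \<le> i \<and> clock g i - clock g k \<ge> T)"
          using i(1) unfolding j_def by (intro not_less_Least) simp
        then have "clock g j - clock g k \<le> T + g 0"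
          using i g_anti[of 0 j] by (simp add: clock_Suc)
        then have "g k \<le> 2 * g j" using m less.prems j by simp
        also have "g j \<le> 2 * g N * exp (\<kappa> * (clock g N - clock g j))"
          using less.prems j \<open>k \<noteq> j\<close> by (intro less.hyps) auto
        also have "2 * (2 * g N * exp (\<kappa> * (clock g N - clock g j))) \<le>
            2 * (exp (\<kappa> * T) * g N * exp (\<kappa> * (clock g N - clock g j)))"
          using T g_pos[of N] by (intro mult_left_mono mult_right_mono) auto
        also have "\<dots> = 2 * g N * exp (\<kappa> * (T + (clock g N - clock g j)))"
          by (simp add: distrib_left exp_add)
        also have "\<dots> \<le> 2 * g N * exp (\<kappa> * (clock g N - clock g k))"
          using j \<kappa> g_pos[of N] by (intro mult_left_mono) auto
        finally show ?thesis by simp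
      qed
    qed
    \<comment> \<open>Indices before \<open>m\<close> are compared with \<open>g m\<close>, at the
      price of \<open>g 0 / g m\<close>.\<close>
    have "g k \<le> (2 * g 0 / g m) * g N * exp (\<kappa> * (clock g N - clock g k))" if k: "1 \<le> k" "k \<le> N" for k N
    proof -
      have e: "exp (\<kappa> * (clock g N - clock g k)) \<ge> 1" using \<kappa> cmono[OF k(2)] by simp
      have c: "g 0 / g m \<ge> 1" using g_anti[of 0 m] g_pos[of m] by simp
      show ?thesis
      proof (cases "m \<le> k")
        case True
        have "1 * (2 * g N * exp (\<kappa> * (clock g N - clock g k))) \<le>
            (g 0 / g m) * (2 * g N * exp (\<kappa> * (clock g N - clock g k)))"
          using c g_pos[of N] by (intro mult_right_mono) auto
        then show ?thesis using late[OF True k(2)] by (simp add: mult_ac)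
      next
        case False
        have "g m \<le> 2 * g N * exp (\<kappa> * (clock g N - clock g k))"
        proof (cases "m \<le> N")
          case True
          have "g m \<le> 2 * g N * exp (\<kappa> * (clock g N - clock g m))" by (rule late) (use True in auto)
          also have "\<dots> \<le> 2 * g N * exp (\<kappa> * (clock g N - clock g k))"
            using False cmono[of k m] \<kappa> g_pos[of N] by (intro mult_left_mono) auto
          finally show ?thesis .
        next
          case False
          have "g m \<le> g N" using False by (intro g_anti) auto
          also have "\<dots> \<le> g N * (2 * exp (\<kappa> * (clock g N - clock g k)))"
          proof -
            have "1 \<le> 2 * exp (\<kappa> * (clock g N - clock g k))" using e by linarith
            from mult_left_mono[OF this, of "g N"] show ?thesis using g_pos[of N] by simp
          qed
          finally show ?thesis by (simp add: mult_ac)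
        qed
        then have "(g 0 / g m) * g m \<le> (g 0 / g m) * (2 * g N * exp (\<kappa> * (clock g N - clock g k)))"
          using c by (intro mult_left_mono) auto
        moreover have "g k \<le> (g 0 / g m) * g m" using g_anti[of 0 k] g_pos[of m] by simp
        ultimately show ?thesis by (simp add: mult_ac)
      qed
    qed
    then show ?thesis by (intro exI[of _ "2 * g 0 / g m"]) auto
  qed
  have ratio: "\<forall>\<^sub>F N in sequentially. \<forall>k\<in>{1..N}. clock g N - clock g k \<le> T \<longrightarrow>
      \<bar>g k / g N * exp (- 2 * 0 * (clock g N - clock g k)) - 1\<bar> \<le> \<epsilon>" if "\<epsilon> > 0" for T \<epsilon>
  proof -
    define e where "e = \<epsilon> / (1 + \<epsilon>)"
    have e: "0 < e" "e < 1" "1 / (1 - e) = 1 + \<epsilon>" using that by (auto simp: e_def field_simps)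
    obtain m where m: "\<And>k N. k \<ge> m \<Longrightarrow> N \<ge> k \<Longrightarrow> clock g N - clock g k \<le> T \<Longrightarrow> (1 - e) * g k \<le> g N"
      using window[OF e(1,2)] by metis
    have "\<forall>\<^sub>F N in sequentially. clock g N > clock g m + T"
      using c_top by (simp add: filterlim_at_top_dense)
    then show ?thesis
    proof (rule eventually_mono, safe)
      fix N k assume N: "clock g m + T < clock g N" and k: "k \<in> {1..N}" "clock g N - clock g k \<le> T"
      then have "\<not> k \<le> m" using cmono[of k m] by linarith
      then have "(1 - e) * g k \<le> g N" using m k by simp
      then have "g k / g N \<le> 1 / (1 - e)" using e g_pos[of N] by (simp add: field_simps)
      moreover have "g k / g N \<ge> 1" using g_anti[of k N] k g_pos[of N] by simp
      ultimately show "\<bar>g k / g N * exp (- 2 * 0 * (clock g N - clock g k)) - 1\<bar> \<le> \<epsilon>"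
        using e by simp
    qed
  qed
  have "step_sequence g \<kappa> 0"
    by unfold_locales (use g_pos g_anti g_lim c_top growth ratio in blast)+
  then show ?thesis by (simp add: g_def[abs_def])
qed

text \<open>Here \<open>clock g N\<close> is \<open>\<gamma>0 * harm N\<close>, and
  \<open>harm N - ln N\<close> converges. Hence \<open>g k / g N = N / k\<close> is
  \<open>exp ((clock g N - clock g k) / \<gamma>0)\<close> up to a factor that is bounded and tends
  to 1 for late indices, which fixes \<kappa> = 2\<zeta> = 1/\<gamma>0.\<close>

theorem step_sequence_harmonic:
  assumes pos: "\<And>t. t \<ge> 0 \<Longrightarrow> \<gamma> t > 0" and anti: "antimono_on {0..} \<gamma>"
    and lim: "(\<gamma> \<longlongrightarrow> 0) at_top"
    and \<gamma>: "\<And>t. t \<ge> 1 \<Longrightarrow> \<gamma> t = \<gamma>0 / t"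
  shows "step_sequence (\<lambda>k. \<gamma> (real k)) (1 / \<gamma>0) (1 / (2 * \<gamma>0))"
proof -
  define g where "g k = \<gamma> (real k)" for k :: nat
  have \<gamma>0: "\<gamma>0 > 0" using pos[of 1] \<gamma>[of 1] by simp
  have g_pos: "g k > 0" for k using pos by (simp add: g_def)
  have g_anti: "g l \<le> g k" if "k \<le> l" for k l
    unfolding g_def using that by (intro monotone_onD[OF anti]) auto
  have g_lim: "g \<longlonglongrightarrow> 0"
    unfolding g_def using lim filterlim_real_sequentially by (rule filterlim_compose)
  have g: "g k = \<gamma>0 / real k" if "k \<ge> 1" for k using \<gamma>[of "real k"] that by (simp add: g_def)
  have clock: "clock g N = \<gamma>0 * harm N" for N
    by (simp add: clock_def harm_def sum_distrib_left g divide_inverse)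
  define e where "e n = (harm n - ln (real n) :: real)" for n :: nat
  have e: "e \<longlonglongrightarrow> euler_mascheroni" unfolding e_def[abs_def] by (rule euler_mascheroni_LIMSEQ)
  have cmono: "clock g k \<le> clock g l" if "k \<le> l" for k l
    unfolding clock_def using that g_pos by (intro sum_mono2) (auto intro: less_imp_le)
  have c_top: "filterlim (clock g) at_top sequentially"
  proof -
    have "filterlim (\<lambda>n. \<gamma>0 * (e n + ln (real n))) at_top sequentially"
      by (intro filterlim_tendsto_pos_mult_at_top[OF tendsto_const \<gamma>0] filterlim_tendsto_add_at_top[OF e]
        filterlim_compose[OF ln_at_top] filterlim_real_sequentially)
    then show ?thesis by (simp add: clock[abs_def] e_def)
  qed
  have key: "g k / g N * exp (- (harm N - harm k)) = exp (e k - e N)" if "1 \<le> k" "k \<le> N" for k N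
  proof -
    have "exp (e k - e N) = exp (- (harm N - harm k)) * (exp (ln (real N)) / exp (ln (real k)))"
      by (simp add: e_def exp_diff[symmetric] exp_add[symmetric])
    also have "exp (ln (real N)) / exp (ln (real k)) = g k / g N"
      using that \<gamma>0 by (simp add: g)
    finally show ?thesis by simp
  qed
  have growth: "\<exists>C. \<forall>N. \<forall>k\<in>{1..N}. g k \<le> C * g N * exp (1 / \<gamma>0 * (clock g N - clock g k))"
  proof -
    obtain B where B: "\<And>k. \<bar>e k\<bar> \<le> B"
      using convergent_imp_Bseq[OF convergentI[OF e]] by (auto simp: Bseq_def)
    have "g k \<le> exp (2 * B) * g N * exp (1 / \<gamma>0 * (clock g N - clock g k))" if k: "1 \<le> k" "k \<le> N" for k N
    proof -
      have "g k / g N * exp (- (harm N - harm k)) \<le> exp (2 * B)"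
        unfolding key[OF k] using B[of k] B[of N] by (simp add: abs_le_iff)
      moreover have "g k = (g k / g N * exp (- (harm N - harm k))) * (g N * exp (harm N - harm k))"
        using g_pos[of N] by (simp add: exp_add[symmetric])
      ultimately have "g k \<le> exp (2 * B) * (g N * exp (harm N - harm k))"
        using g_pos[of N] by (metis exp_gt_zero less_imp_le mult_pos_pos mult_right_mono)
      moreover have "1 / \<gamma>0 * (clock g N - clock g k) = harm N - harm k"
        using \<gamma>0 by (simp add: clock right_diff_distrib[symmetric])
      ultimately show ?thesis by (simp only: mult.assoc)
    qed
    then show ?thesis by (intro exI[of _ "exp (2 * B)"]) auto
  qed
  have ratio: "\<forall>\<^sub>F N in sequentially. \<forall>k\<in>{1..N}. clock g N - clock g k \<le> T \<longrightarrow>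
      \<bar>g k / g N * exp (- 2 * (1 / (2 * \<gamma>0)) * (clock g N - clock g k)) - 1\<bar> \<le> \<epsilon>" if "\<epsilon> > 0" for T \<epsilon>
  proof -
    have "(exp \<longlongrightarrow> exp (0::real)) (at 0)" by (intro tendsto_intros)
    then obtain d where d: "d > 0" "\<And>x::real. x \<noteq> 0 \<Longrightarrow> \<bar>x\<bar> < d \<Longrightarrow> \<bar>exp x - 1\<bar> < \<epsilon>"
      using \<open>\<epsilon> > 0\<close> by (auto simp: tendsto_iff eventually_at dist_real_def)
    then have d': "\<bar>exp x - 1\<bar> \<le> \<epsilon>" if "\<bar>x\<bar> < d" for x using that \<open>\<epsilon> > 0\<close> by (cases "x = 0") (auto intro: less_imp_le)
    obtain m where m: "\<And>k N. k \<ge> m \<Longrightarrow> N \<ge> m \<Longrightarrow> \<bar>e k - e N\<bar> < d"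
      using LIMSEQ_imp_Cauchy[OF e] d(1) unfolding Cauchy_def dist_real_def by metis
    have "\<forall>\<^sub>F N in sequentially. clock g N > clock g m + T"
      using c_top by (simp add: filterlim_at_top_dense)
    then show ?thesis
    proof (rule eventually_mono, safe)
      fix N k assume N: "clock g m + T < clock g N" and k: "k \<in> {1..N}" "clock g N - clock g k \<le> T"
      then have "\<not> k \<le> m" using cmono[of k m] by linarith
      then have "\<bar>e k - e N\<bar> < d" using m[of k N] k by simp
      moreover have "- 2 * (1 / (2 * \<gamma>0)) * (clock g N - clock g k) = - (harm N - harm k)"
        using \<gamma>0 by (simp add: clock field_simps)
      ultimately show "\<bar>g k / g N * exp (- 2 * (1 / (2 * \<gamma>0)) * (clock g N - clock g k)) - 1\<bar> \<le> \<epsilon>"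
        using key[of k N] k d' by simp
    qed
  qed
  have "step_sequence g (1 / \<gamma>0) (1 / (2 * \<gamma>0))"
    by unfold_locales (use g_pos g_anti g_lim c_top growth ratio in blast)+
  then show ?thesis by (simp add: g_def[abs_def])
qed

lemma regularly_varying_harmonic:
  assumes "\<And>t. t \<ge> 1 \<Longrightarrow> \<gamma> t = \<gamma>0 / t" "\<gamma>0 > 0"
  shows "regularly_varying \<gamma> (- 1)"
  unfolding regularly_varying_def
proof safe
  fix x :: real assume "x > 0"
  have "\<forall>\<^sub>F t in at_top. \<gamma> (t * x) / \<gamma> t = x powr (- 1)"
    using eventually_ge_at_top[of "max 1 (1 / x)"]
  proof eventually_elim
    case (elim t)
    then have "t \<ge> 1" "t * x \<ge> 1" using \<open>x > 0\<close> by (auto simp: field_simps)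
    then have "\<gamma> (t * x) = \<gamma>0 / (t * x)" "\<gamma> t = \<gamma>0 / t" using assms(1) by blast+
    then show ?case using assms(2) \<open>t \<ge> 1\<close> \<open>x > 0\<close> by (simp only:) (simp add: powr_minus field_simps)
  qed
  then show "((\<lambda>t. \<gamma> (t * x) / \<gamma> t) \<longlongrightarrow> x powr (- 1)) at_top"
    by (rule tendsto_eventually)
qed

text \<open>\<gamma> may jump across the level \<open>y n\<close>, so the level is only enclosed by
  the values at neighbouring indices: \<open>\<gamma> (N n + 1) \<le> y n\<close> and
  \<open>y n < \<gamma> (N n - 1)\<close>. Regular variation makes these values asymptotically
  equal.\<close>

theorem decreasing_inverse_asymptotics:
  fixes y :: "nat \<Rightarrow> real"
  assumes pos: "\<And>t. t \<ge> 0 \<Longrightarrow> \<gamma> t > 0" and anti: "antimono_on {0..} \<gamma>"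
    and lim: "(\<gamma> \<longlongrightarrow> 0) at_top" and rv: "regularly_varying \<gamma> \<rho>"
    and y: "\<forall>\<^sub>F n in sequentially. y n > 0" "y \<longlonglongrightarrow> 0"
  defines "N \<equiv> \<lambda>n. nat \<lfloor>decreasing_inverse \<gamma> (y n)\<rfloor>"
  shows "filterlim N at_top sequentially" "(\<lambda>n. \<gamma> (real (N n)) / y n) \<longlonglongrightarrow> 1"
proof -
  have "\<gamma> (real (N n) + 1) \<le> y n \<and> (N n \<ge> 1 \<longrightarrow> y n < \<gamma> (real (N n) - 1))" if "y n > 0" for n
  proof -
    define D where "D = {t. 0 \<le> t \<and> \<gamma> t \<le> y n}"
    define \<tau> where "\<tau> = Inf D"
    have "\<forall>\<^sub>F t in at_top. \<gamma> t < y n" using lim that by (rule order_tendstoD(2))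
    then have "\<forall>\<^sub>F t in at_top. \<gamma> t < y n \<and> 0 \<le> t" using eventually_ge_at_top[of 0] by (rule eventually_conj)
    then obtain t where "\<gamma> t < y n" "0 \<le> t" using eventually_happens'[OF trivial_limit_at_top_linorder] by blast
    then have ne: "D \<noteq> {}" by (auto simp: D_def intro: less_imp_le)
    have bd: "bdd_below D" by (rule bdd_belowI[of _ 0]) (auto simp: D_def)
    have \<tau>0: "\<tau> \<ge> 0" unfolding \<tau>_def by (rule cInf_greatest[OF ne]) (auto simp: D_def)
    have above: "\<gamma> t \<le> y n" if "t > \<tau>" for t
    proof -
      obtain d where d: "d \<in> D" "d < t" using \<open>t > \<tau>\<close> unfolding \<tau>_def cInf_less_iff[OF ne bd] by blast
      have "\<gamma> t \<le> \<gamma> d" using d by (intro monotone_onD[OF anti]) (auto simp: D_def)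
      then show ?thesis using d by (simp add: D_def)
    qed
    have below: "y n < \<gamma> t" if "t < \<tau>" "0 \<le> t" for t
      using cInf_lower[OF _ bd, of t] that by (force simp: D_def \<tau>_def not_le[symmetric])
    have "real (N n) = of_int \<lfloor>\<tau>\<rfloor>" using \<tau>0 by (simp add: N_def \<tau>_def D_def decreasing_inverse_def)
    then have "real (N n) \<le> \<tau>" "\<tau> < real (N n) + 1" by linarith+
    then show ?thesis using above below by auto
  qed
  note N = this[THEN conjunct1] this[THEN conjunct2, rule_format]
  show top: "filterlim N at_top sequentially"
    unfolding filterlim_at_top
  proof
    fix m :: nat
    have "\<forall>\<^sub>F n in sequentially. y n < \<gamma> (real m)" using y(2) pos[of "real m"] by (intro order_tendstoD(2)) auto
    with y(1) show "\<forall>\<^sub>F n in sequentially. m \<le> N n"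
    proof eventually_elim
      case (elim n)
      show ?case
      proof (rule ccontr)
        assume "\<not> m \<le> N n"
        then have "\<gamma> (real m) \<le> \<gamma> (real (N n) + 1)" by (intro monotone_onD[OF anti]) auto
        with N(1)[OF elim(1)] elim(2) show False by simp
      qed
    qed
  qed
  show "(\<lambda>n. \<gamma> (real (N n)) / y n) \<longlonglongrightarrow> 1"
  proof (rule tendstoI)
    fix \<epsilon> :: real assume "\<epsilon> > 0"
    \<comment> \<open>The cap 1/2 gives \<open>1 / (1 - e) \<le> 1 + 2 * e\<close>, and
      \<open>\<epsilon> / 4\<close> keeps \<open>2 * e\<close> below \<epsilon>.\<close>
    define e where "e = min (1/2) (\<epsilon> / 4)"
    have e: "e > 0" "e \<le> 1 / 2" "e \<le> \<epsilon> / 4" using \<open>\<epsilon> > 0\<close> by (auto simp: e_def)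
    obtain \<delta> T where \<delta>: "\<delta> > 0" "T > 0"
      "\<And>t u. t \<ge> T \<Longrightarrow> u \<ge> 0 \<Longrightarrow> u \<le> (1 + \<delta>) * t \<Longrightarrow> \<gamma> u \<ge> (1 - e) * \<gamma> t"
      using regularly_varying_near[OF pos anti rv e(1)] by blast
    have "\<forall>\<^sub>F n in sequentially. N n \<ge> nat \<lceil>max 1 (max T (1 / \<delta>)) + 1\<rceil>"
      using top by (simp add: filterlim_at_top)
    with y(1) show "\<forall>\<^sub>F n in sequentially. dist (\<gamma> (real (N n)) / y n) 1 < \<epsilon>"
    proof eventually_elim
      case (elim n)
      define r where "r = real (N n)"
      have r: "r \<ge> max 1 (max T (1 / \<delta>)) + 1" using elim(2) unfolding r_def by linarith
      \<comment> \<open>A step of one index stays within the ratio \<open>1 + \<delta>\<close> as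
        soon as \<open>\<delta> * (r - 1) \<ge> 1\<close>.\<close>
      then have r': "r - 1 \<ge> T" "r \<ge> T" "r - 1 \<ge> 1" "\<delta> * (r - 1) \<ge> 1" "\<delta> * r \<ge> 1"
      proof -
        have "r - 1 \<ge> 1 / \<delta>" using r by linarith
        then show "\<delta> * (r - 1) \<ge> 1" using \<delta>(1) by (simp add: field_simps)
        also have "\<delta> * (r - 1) \<le> \<delta> * r" using \<delta>(1) by simp
        finally show "\<delta> * r \<ge> 1" .
      qed (use r in linarith)+
      have "\<gamma> (r + 1) \<le> y n" "y n < \<gamma> (r - 1)"
        using N[OF elim(1)] r by (auto simp: r_def)
      moreover have "\<gamma> (r + 1) \<ge> (1 - e) * \<gamma> r" "\<gamma> r \<ge> (1 - e) * \<gamma> (r - 1)"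
        using r' by (auto intro!: \<delta>(3)[rule_format] simp: distrib_right)
      ultimately have u: "(1 - e) * \<gamma> r \<le> y n" and l: "(1 - e) * y n \<le> \<gamma> r"
      proof -
        assume a: "\<gamma> (r + 1) \<le> y n" "y n < \<gamma> (r - 1)"
          "(1 - e) * \<gamma> r \<le> \<gamma> (r + 1)" "(1 - e) * \<gamma> (r - 1) \<le> \<gamma> r"
        show "(1 - e) * \<gamma> r \<le> y n" using a by linarith
        have "(1 - e) * y n \<le> (1 - e) * \<gamma> (r - 1)" using a e by (intro mult_left_mono) auto
        then show "(1 - e) * y n \<le> \<gamma> r" using a by linarith
      qed
      have "\<gamma> r / y n \<ge> 1 - e" using l elim(1) by (simp add: field_simps)
      moreover have "\<gamma> r / y n \<le> 1 + 2 * e"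
      proof -
        have "\<gamma> r / y n \<le> 1 / (1 - e)" using u elim(1) e by (simp add: field_simps)
        also have "\<dots> \<le> 1 + 2 * e" using e by (simp add: field_simps)
        finally show ?thesis .
      qed
      ultimately show ?case using e \<open>\<epsilon> > 0\<close> by (simp add: dist_real_def r_def abs_less_iff)
    qed
  qed
qed

section \<open>Weak convergence from characteristic functions\<close>

text \<open>Finite sums of exponentials, that is, functions whose integrals are linear combinations
  of values of the characteristic function. Products stay in the class because frequencies
  add.\<close>

inductive trig_poly :: "('a::euclidean_space \<Rightarrow> complex) \<Rightarrow> bool" where
  trig_poly_iexp: "trig_poly (\<lambda>x. c * iexp (v \<bullet> x))"
| trig_poly_add: "trig_poly p \<Longrightarrow> trig_poly q \<Longrightarrow> trig_poly (\<lambda>x. p x + q x)"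

lemma trig_poly_const: "trig_poly (\<lambda>x. c)"
  using trig_poly_iexp[of c 0] by simp

lemma trig_poly_mult: "trig_poly p \<Longrightarrow> trig_poly q \<Longrightarrow> trig_poly (\<lambda>x. p x * q x)"
proof (induction p rule: trig_poly.induct)
  case (trig_poly_iexp c v)
  then show ?case
  proof (induction q rule: trig_poly.induct)
    case (trig_poly_iexp c' v')
    show ?case
      using trig_poly.trig_poly_iexp[of "c * c'" "v + v'"]
      by (simp add: inner_add_left distrib_left exp_add mult_ac)
  next
    case (trig_poly_add p q)
    then show ?case by (simp add: distrib_left trig_poly.trig_poly_add)
  qed
next
  case (trig_poly_add p r)
  then show ?case by (simp add: distrib_right trig_poly.trig_poly_add)
qed

lemma trig_poly_sum: "(\<And>i. i \<in> I \<Longrightarrow> trig_poly (p i)) \<Longrightarrow> trig_poly (\<lambda>x. \<Sum>i\<in>I. p i x)"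
  by (induction I rule: infinite_finite_induct) (auto intro: trig_poly_const trig_poly_add)

lemma trig_poly_sin: "trig_poly (\<lambda>x. complex_of_real (sin (v \<bullet> x)))"
proof -
  have "complex_of_real (sin t) = (- \<i> / 2) * iexp t + (\<i> / 2) * iexp (- t)" for t
    by (simp add: complex_eq_iff sin_exp_eq Re_exp Im_exp)
  then have "(\<lambda>x. complex_of_real (sin (v \<bullet> x))) = (\<lambda>x. (- \<i> / 2) * iexp (v \<bullet> x) + (\<i> / 2) * iexp ((- v) \<bullet> x))"
    by simp
  then show ?thesis
    by (simp only:) (intro trig_poly_add trig_poly_iexp)
qed

text \<open>A bounded substitute for the coordinates: the values lie in the cube with sides [-1, 1],
  and polynomials in them are trigonometric polynomials on the whole space.\<close>

definition sin_vec :: "real \<Rightarrow> 'a::euclidean_space \<Rightarrow> 'a" where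
  "sin_vec L x = (\<Sum>b\<in>Basis. sin ((x \<bullet> b) / L) *\<^sub>R b)"

lemma inner_sin_vec: "b \<in> Basis \<Longrightarrow> sin_vec L x \<bullet> b = sin ((x \<bullet> b) / L)"
  by (simp add: sin_vec_def inner_sum_left inner_Basis if_distrib[of "(*) _"] cong: if_cong)

lemma trig_poly_polynomial_sin_vec:
  assumes "real_polynomial_function p"
  shows "trig_poly (\<lambda>x. complex_of_real (p (sin_vec L x)))"
  using assms
proof (induction p rule: real_polynomial_function.induct)
  case (linear f)
  interpret bounded_linear f by fact
  have "complex_of_real (f (sin_vec L x)) = (\<Sum>b\<in>Basis. complex_of_real (f b) * complex_of_real (sin ((b /\<^sub>R L) \<bullet> x)))" for x
    by (simp add: sin_vec_def sum scaleR inner_commute divide_inverse mult_ac)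
  then show ?case
    by (simp only:) (intro trig_poly_sum trig_poly_mult trig_poly_const trig_poly_sin)
qed (simp_all add: trig_poly_const trig_poly_add trig_poly_mult)

lemma trig_poly_bounded_measurable:
  "trig_poly p \<Longrightarrow> p \<in> borel_measurable borel \<and> (\<exists>B. \<forall>x. cmod (p x) \<le> B)"
proof (induction p rule: trig_poly.induct)
  case (trig_poly_iexp c v)
  show ?case by (auto intro!: exI[of _ "cmod c"] simp: norm_mult)
next
  case (trig_poly_add p q)
  then obtain B C where "\<And>x. cmod (p x) \<le> B" "\<And>x. cmod (q x) \<le> C" by blast
  then have "\<forall>x. cmod (p x + q x) \<le> B + C"
    by (intro allI order_trans[OF norm_triangle_ineq] add_mono)
  with trig_poly_add show ?case by auto
qed

lemma integrable_trig_poly: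
  assumes "prob_space M" "sets M = sets borel" "trig_poly p"
  shows "integrable M p"
proof -
  interpret prob_space M by fact
  obtain B where B: "\<And>x. cmod (p x) \<le> B" "p \<in> borel_measurable borel"
    using trig_poly_bounded_measurable[OF assms(3)] by blast
  show ?thesis
    using B by (intro integrable_const_bound[where B=B]) (auto simp: measurable_cong_sets[OF assms(2) refl])
qed

lemma trig_poly_integral_tendsto:
  fixes \<mu> :: "nat \<Rightarrow> 'a::euclidean_space measure"
  assumes "\<And>n. prob_space (\<mu> n)" "\<And>n. sets (\<mu> n) = sets borel" "prob_space \<nu>" "sets \<nu> = sets borel"
    and char: "\<And>v. (\<lambda>n. CLINT x|\<mu> n. iexp (v \<bullet> x)) \<longlonglongrightarrow> (CLINT x|\<nu>. iexp (v \<bullet> x))"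
    and p: "trig_poly p"
  shows "(\<lambda>n. CLINT x|\<mu> n. p x) \<longlonglongrightarrow> (CLINT x|\<nu>. p x)"
  using p
proof (induction p rule: trig_poly.induct)
  case (trig_poly_iexp c v)
  then show ?case by (simp only: integral_mult_right_zero) (intro tendsto_intros char)
next
  case (trig_poly_add p q)
  then show ?case by (subst (1 2) Bochner_Integration.integral_add)
      (auto intro: integrable_trig_poly[OF assms(1,2)] integrable_trig_poly[OF assms(3,4)] tendsto_add)
qed

lemma tight_prob_space:
  fixes \<nu> :: "'a::euclidean_space measure"
  assumes "prob_space \<nu>" "sets \<nu> = sets borel" "\<epsilon> > 0"
  obtains R where "R > 0" "measure \<nu> {x. norm x > R} < \<epsilon>"
proof -
  interpret prob_space \<nu> by fact
  have sp: "space \<nu> = UNIV" using sets_eq_imp_space_eq[OF assms(2)] by simp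
  define A where "A n = {x::'a. norm x > real n}" for n
  have "(\<lambda>n. measure \<nu> (A n)) \<longlonglongrightarrow> measure \<nu> (\<Inter>n. A n)"
    by (rule finite_Lim_measure_decseq) (auto simp: A_def assms(2) decseq_def)
  also have "(\<Inter>n. A n) = {}"
  proof -
    have "x \<notin> (\<Inter>n. A n)" for x
    proof -
      obtain n where "norm x \<le> real n" using real_arch_simple by blast
      then have "x \<notin> A n" by (simp add: A_def)
      then show ?thesis by blast
    qed
    then show ?thesis by blast
  qed
  finally have "\<forall>\<^sub>F n in sequentially. measure \<nu> (A n) < \<epsilon>"
    using \<open>\<epsilon> > 0\<close> by (intro order_tendstoD(2)) auto
  then have "\<forall>\<^sub>F n in sequentially. measure \<nu> (A n) < \<epsilon> \<and> n \<ge> 1"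
    using eventually_ge_at_top by (rule eventually_conj)
  then obtain n where "measure \<nu> (A n) < \<epsilon>" "n \<ge> 1"
    using eventually_happens' sequentially_bot by blast
  then show thesis by (intro that[of "real n"]) (auto simp: A_def)
qed

text \<open>A bounded continuous \<open>f\<close> agrees on the ball of radius \<open>R\<close> with \<open>f (R arcsin (sin (x / R)))\<close>
  (coordinatewise), which by Stone--Weierstrass is uniformly close to a polynomial in the
  \<open>sin (x\<^sub>b / R)\<close>, that is, to a trigonometric polynomial.\<close>

lemma trig_poly_approx:
  fixes f :: "'a::euclidean_space \<Rightarrow> real"
  assumes f: "continuous_on UNIV f" "\<And>x. \<bar>f x\<bar> \<le> B" and "\<epsilon> > 0" "R > 0"
  obtains p :: "'a \<Rightarrow> real" where "trig_poly (\<lambda>x. complex_of_real (p x))"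
    "\<And>x. \<bar>f x - p x\<bar> \<le> \<epsilon> + 2 * B * indicator {x. norm x > R} x"
proof -
  define G where "G y = f (\<Sum>b\<in>Basis. (R * arcsin (y \<bullet> b)) *\<^sub>R b)" for y :: 'a
  define K where "K = cbox (- One) (One :: 'a)"
  have K: "y \<bullet> b \<in> {-1..1}" if "y \<in> K" "b \<in> Basis" for y b
    using that by (auto simp: K_def mem_box)
  have "continuous_on K (\<lambda>y. (\<Sum>b\<in>Basis. (R * arcsin (y \<bullet> b)) *\<^sub>R b) :: 'a)"
    using K by (intro continuous_intros) auto
  then have "continuous_on K G"
    unfolding G_def by (rule continuous_on_compose2[OF f(1)]) auto
  moreover have "compact K" by (simp add: K_def)
  ultimately obtain P where P: "real_polynomial_function P" "\<And>y. y \<in> K \<Longrightarrow> \<bar>G y - P y\<bar> < \<epsilon>"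
    using Stone_Weierstrass_real_polynomial_function[of K G \<epsilon>] \<open>\<epsilon> > 0\<close> by blast
  show thesis
  proof (rule that[of "\<lambda>x. P (sin_vec R x)"])
    show "trig_poly (\<lambda>x. complex_of_real (P (sin_vec R x)))"
      using P(1) by (rule trig_poly_polynomial_sin_vec)
    fix x :: 'a
    have "sin_vec R x \<in> K" by (auto simp: K_def mem_box inner_sin_vec)
    then have 1: "\<bar>G (sin_vec R x) - P (sin_vec R x)\<bar> < \<epsilon>" by (rule P)
    show "\<bar>f x - P (sin_vec R x)\<bar> \<le> \<epsilon> + 2 * B * indicator {x. norm x > R} x"
    proof (cases "norm x > R")
      case True
      have "\<bar>f x\<bar> \<le> B" "\<bar>G (sin_vec R x)\<bar> \<le> B" using f(2) by (auto simp: G_def)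
      then show ?thesis using 1 True by simp
    next
      case False
      \<comment> \<open>The arguments are at most 1 in modulus, below \<open>pi / 2\<close>, so
        \<open>arcsin\<close> undoes \<open>sin\<close>.\<close>
      have "arcsin (sin ((x \<bullet> b) / R)) = (x \<bullet> b) / R" if "b \<in> Basis" for b
      proof (rule arcsin_sin)
        have "\<bar>x \<bullet> b\<bar> \<le> R" using Basis_le_norm[OF that, of x] False by linarith
        then have "\<bar>(x \<bullet> b) / R\<bar> \<le> 1" using \<open>R > 0\<close> by (simp add: field_simps)
        then show "- (pi / 2) \<le> (x \<bullet> b) / R" "(x \<bullet> b) / R \<le> pi / 2" using pi_gt3 by linarith+
      qed
      then have "G (sin_vec R x) = f (\<Sum>b\<in>Basis. (x \<bullet> b) *\<^sub>R b)"
        unfolding G_def using \<open>R > 0\<close> by (intro arg_cong[of _ _ f] sum.cong refl) (simp add: inner_sin_vec)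
      then have "G (sin_vec R x) = f x" by (simp add: euclidean_representation)
      then show ?thesis using 1 False by simp
    qed
  qed
qed

text \<open>One trigonometric polynomial approximates \<open>f\<close> up to \<epsilon> plus
  \<open>2 * B\<close> times the mass outside a ball. Tightness makes that mass small for all late
  \<open>\<mu> n\<close> at once, and on trigonometric polynomials convergence is the hypothesis on
  characteristic functions.\<close>

theorem conv_in_law_char:
  fixes \<mu> :: "nat \<Rightarrow> 'a::euclidean_space measure"
  assumes \<mu>: "\<And>n. prob_space (\<mu> n)" "\<And>n. sets (\<mu> n) = sets borel"
    and \<nu>: "prob_space \<nu>" "sets \<nu> = sets borel"
    and char: "\<And>v. (\<lambda>n. CLINT x|\<mu> n. iexp (v \<bullet> x)) \<longlonglongrightarrow> (CLINT x|\<nu>. iexp (v \<bullet> x))"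
    and tight: "\<And>\<epsilon>. \<epsilon> > 0 \<Longrightarrow> \<exists>R. \<forall>\<^sub>F n in sequentially. measure (\<mu> n) {x. norm x > R} \<le> \<epsilon>"
  shows "conv_in_law \<mu> \<nu>"
  unfolding conv_in_law_def
proof (intro allI impI)
  fix f :: "'a \<Rightarrow> real"
  assume f: "continuous_on UNIV f" "bounded (range f)"
  then obtain B where B: "B > 0" "\<And>x. \<bar>f x\<bar> \<le> B" by (auto simp: bounded_pos)
  have meas: "f \<in> borel_measurable borel" using f(1) by (rule borel_measurable_continuous_onI)
  show "(\<lambda>n. \<integral>x. f x \<partial>\<mu> n) \<longlonglongrightarrow> (\<integral>x. f x \<partial>\<nu>)"
  proof (rule tendstoI)
    fix r :: real assume "r > 0"
    \<comment> \<open>With these values \<open>2 * B * \<delta> = \<epsilon>\<close>: each of the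
      two replacements of \<open>f\<close> by \<open>p\<close> costs \<open>2 * \<epsilon>\<close>,
      the convergence of the integrals of \<open>p\<close> costs \<epsilon>, in total 5/8 of
      \<open>r\<close>.\<close>
    define \<epsilon> where "\<epsilon> = r / 8"
    define \<delta> where "\<delta> = r / (16 * B)"
    have pos: "\<epsilon> > 0" "\<delta> > 0" using \<open>r > 0\<close> B by (auto simp: \<epsilon>_def \<delta>_def)
    obtain R1 where R1: "\<forall>\<^sub>F n in sequentially. measure (\<mu> n) {x. norm x > R1} \<le> \<delta>"
      using tight[OF pos(2)] by blast
    obtain R2 where R2: "R2 > 0" "measure \<nu> {x. norm x > R2} < \<delta>"
      by (rule tight_prob_space[OF \<nu> pos(2)])
    define R where "R = max R1 R2"
    have "R > 0" using R2 by (simp add: R_def)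
    then obtain p :: "'a \<Rightarrow> real" where p: "trig_poly (\<lambda>x. complex_of_real (p x))"
      "\<And>x. \<bar>f x - p x\<bar> \<le> \<epsilon> + 2 * B * indicator {x. norm x > R} x"
      using trig_poly_approx[OF f(1) B(2) pos(1)] by blast
    have approx: "\<bar>(\<integral>x. f x \<partial>N) - (\<integral>x. p x \<partial>N)\<bar> \<le> 2 * \<epsilon>"
      if N: "prob_space N" "sets N = sets borel" and le: "measure N {x. norm x > R} \<le> \<delta>" for N
    proof -
      interpret prob_space N by fact
      note [measurable_cong] = N(2)
      have sp: "space N = UNIV" using sets_eq_imp_space_eq[OF N(2)] by simp
      note [measurable] = meas
      have fi: "integrable N f" by (rule integrable_const_bound[where B=B]) (use B in auto)
      have "integrable N (\<lambda>x. complex_of_real (p x))" by (rule integrable_trig_poly[OF N p(1)])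
      then have pi: "integrable N p" using complex_of_real_integrable_eq by blast
      have ind: "integrable N (\<lambda>x. indicator {x. norm x > R} x :: real)"
        by (intro integrable_real_indicator) (auto simp: less_top[symmetric])
      have "\<bar>(\<integral>x. f x \<partial>N) - (\<integral>x. p x \<partial>N)\<bar> = \<bar>\<integral>x. f x - p x \<partial>N\<bar>"
        using fi pi by simp
      also have "\<dots> \<le> (\<integral>x. \<bar>f x - p x\<bar> \<partial>N)" by (rule integral_abs_bound)
      also have "\<dots> \<le> (\<integral>x. \<epsilon> + 2 * B * indicator {x. norm x > R} x \<partial>N)"
        using fi pi p(2) ind by (intro integral_mono) auto
      also have "\<dots> = \<epsilon> + 2 * B * measure N {x. norm x > R}"
        using ind by (subst Bochner_Integration.integral_add) (auto simp: sp prob_space[unfolded sp])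
      also have "\<dots> \<le> \<epsilon> + 2 * B * \<delta>" using le B by simp
      also have "\<dots> = 2 * \<epsilon>" using B by (simp add: \<epsilon>_def \<delta>_def)
      finally show ?thesis .
    qed
    have mono: "measure N {x. norm x > R} \<le> measure N {x. norm x > R'}"
      if "prob_space N" "sets N = sets borel" "R' \<le> R" for N :: "'a measure" and R'
    proof -
      interpret prob_space N by fact
      show ?thesis using that by (intro finite_measure_mono) auto
    qed
    have "(\<lambda>n. CLINT x|\<mu> n. complex_of_real (p x)) \<longlonglongrightarrow> (CLINT x|\<nu>. complex_of_real (p x))"
      using trig_poly_integral_tendsto[OF \<mu> \<nu> char p(1)] .
    then have "(\<lambda>n. \<integral>x. p x \<partial>\<mu> n) \<longlonglongrightarrow> (\<integral>x. p x \<partial>\<nu>)"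
      by (simp only: integral_complex_of_real tendsto_of_real_iff)
    then have "\<forall>\<^sub>F n in sequentially. dist (\<integral>x. p x \<partial>\<mu> n) (\<integral>x. p x \<partial>\<nu>) < \<epsilon>"
      using pos(1) by (rule tendstoD)
    with R1 show "\<forall>\<^sub>F n in sequentially. dist (\<integral>x. f x \<partial>\<mu> n) (\<integral>x. f x \<partial>\<nu>) < r"
    proof eventually_elim
      case (elim n)
      have "\<bar>(\<integral>x. f x \<partial>\<mu> n) - (\<integral>x. p x \<partial>\<mu> n)\<bar> \<le> 2 * \<epsilon>"
        using \<mu> elim(1) mono[OF \<mu>, of R1 n] by (intro approx) (auto simp: R_def)
      moreover have "\<bar>(\<integral>x. f x \<partial>\<nu>) - (\<integral>x. p x \<partial>\<nu>)\<bar> \<le> 2 * \<epsilon>"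
        using \<nu> R2 mono[OF \<nu>, of R2] by (intro approx) (auto simp: R_def)
      ultimately show ?case using elim(2) \<open>r > 0\<close> unfolding dist_real_def \<epsilon>_def by linarith
    qed
  qed
qed

section \<open>Characteristic functions of independent sums\<close>

text \<open>Interpolates between the cubic remainder, used for \<open>\<bar>x\<bar> \<le> 1\<close>,
  and the quadratic one, used beyond, so that a moment of order 2 + \<eta> suffices.\<close>

lemma iexp_second_order:
  fixes x \<eta> :: real
  assumes "0 < \<eta>" "\<eta> \<le> 1"
  shows "cmod (iexp x - (1 + \<i> * x - complex_of_real (x\<^sup>2 / 2))) \<le> \<bar>x\<bar> powr (2 + \<eta>)"
proof -
  have *: "(\<Sum>k\<le>2. (\<i> * complex_of_real x) ^ k / fact k) = 1 + \<i> * x - complex_of_real (x\<^sup>2 / 2)"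
    by (simp add: numeral_2_eq_2 power2_eq_square complex_eq_iff)
  have a1: "cmod (iexp x - (1 + \<i> * x - complex_of_real (x\<^sup>2 / 2))) \<le> \<bar>x\<bar> ^ 3 / 6"
    using iexp_approx1[of x 2] unfolding * by (simp add: eval_nat_numeral)
  have a2: "cmod (iexp x - (1 + \<i> * x - complex_of_real (x\<^sup>2 / 2))) \<le> \<bar>x\<bar> ^ 2"
    using iexp_approx2[of x 2] unfolding * by (simp add: eval_nat_numeral)
  show ?thesis
  proof (cases "x = 0")
    case False
    then have x: "\<bar>x\<bar> > 0" by simp
    show ?thesis
    proof (cases "\<bar>x\<bar> \<le> 1")
      case True
      have "\<bar>x\<bar> ^ 3 = \<bar>x\<bar> powr 3" using x by (simp add: powr_numeral)
      also have "\<dots> \<le> \<bar>x\<bar> powr (2 + \<eta>)" using True x assms by (intro powr_mono') auto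
      finally show ?thesis using a1 zero_le_power[of "\<bar>x\<bar>" 3] x by linarith
    next
      case False
      have "\<bar>x\<bar> ^ 2 = \<bar>x\<bar> powr 2" using x by (simp add: powr_numeral)
      also have "\<dots> \<le> \<bar>x\<bar> powr (2 + \<eta>)" using False assms by (intro powr_mono) auto
      finally show ?thesis using a2 by linarith
    qed
  qed simp
qed

lemma square_le_one_plus_powr: "x\<^sup>2 \<le> 1 + \<bar>x\<bar> powr (2 + \<eta>)" if "\<eta> \<ge> 0" for x \<eta> :: real
proof (cases "\<bar>x\<bar> \<le> 1")
  case True
  then have "x\<^sup>2 \<le> 1" by (simp add: abs_square_le_1)
  then show ?thesis using powr_ge_zero[of "\<bar>x\<bar>" "2 + \<eta>"] by linarith
next
  case False
  then have "\<bar>x\<bar> powr 2 \<le> \<bar>x\<bar> powr (2 + \<eta>)" using that by (intro powr_mono) auto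
  then show ?thesis using False by (simp add: powr_numeral)
qed

lemma abs_exp_minus_linear_le: "\<bar>exp (- y) - (1 - y)\<bar> \<le> y\<^sup>2 / 2" if "y \<ge> 0" for y :: real
proof -
  have 1: "exp (- y) \<ge> 1 - y" using exp_ge_add_one_self[of "- y"] by simp
  define f where "f y = 1 - y + y\<^sup>2 / 2 - exp (- y)" for y :: real
  have "f 0 \<le> f y"
  proof (rule DERIV_nonneg_imp_nondecreasing[OF that])
    fix x :: real assume "0 \<le> x"
    have "(f has_real_derivative (- 1 + x + exp (- x))) (at x)"
      unfolding f_def by (auto intro!: derivative_eq_intros)
    then show "\<exists>d. (f has_real_derivative d) (at x) \<and> 0 \<le> d"
      using exp_ge_add_one_self[of "- x"] by (intro exI conjI) auto
  qed
  then show ?thesis using 1 by (simp add: f_def)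
qed

context prob_space
begin

lemma integrable_square_of_powr:
  fixes X :: "'a \<Rightarrow> real"
  assumes [measurable]: "X \<in> borel_measurable M" and "\<eta> \<ge> 0"
    and "integrable M (\<lambda>\<omega>. \<bar>X \<omega>\<bar> powr (2 + \<eta>))"
  shows "integrable M (\<lambda>\<omega>. (X \<omega>)\<^sup>2)"
  by (rule Bochner_Integration.integrable_bound[of _ "\<lambda>\<omega>. 1 + \<bar>X \<omega>\<bar> powr (2 + \<eta>)"])
     (use assms square_le_one_plus_powr in auto)

lemma char_second_order:
  fixes X :: "'a \<Rightarrow> real"
  assumes X [measurable]: "X \<in> borel_measurable M" and \<eta>: "0 < \<eta>" "\<eta> \<le> 1"
    and int: "integrable M (\<lambda>\<omega>. \<bar>X \<omega>\<bar> powr (2 + \<eta>))" and mean: "expectation X = 0"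
  shows "cmod ((CLINT \<omega>|M. iexp (X \<omega>)) - complex_of_real (1 - expectation (\<lambda>\<omega>. (X \<omega>)\<^sup>2) / 2))
    \<le> expectation (\<lambda>\<omega>. \<bar>X \<omega>\<bar> powr (2 + \<eta>))"
proof -
  have int2: "integrable M (\<lambda>\<omega>. (X \<omega>)\<^sup>2)"
    by (rule integrable_square_of_powr[OF X _ int]) (use \<eta> in simp)
  have int1: "integrable M X" by (rule square_integrable_imp_integrable[OF X int2])
  have ie: "integrable M (\<lambda>\<omega>. iexp (X \<omega>))" by (intro integrable_iexp) auto
  have "(CLINT \<omega>|M. 1 + \<i> * X \<omega> - complex_of_real ((X \<omega>)\<^sup>2 / 2)) =
      complex_of_real (1 - expectation (\<lambda>\<omega>. (X \<omega>)\<^sup>2) / 2)"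
    using int1 int2 by (simp add: mean prob_space del: of_real_power of_real_divide)
  then have "(CLINT \<omega>|M. iexp (X \<omega>)) - complex_of_real (1 - expectation (\<lambda>\<omega>. (X \<omega>)\<^sup>2) / 2) =
      (CLINT \<omega>|M. iexp (X \<omega>) - (1 + \<i> * X \<omega> - complex_of_real ((X \<omega>)\<^sup>2 / 2)))"
    using int1 int2 ie by (subst Bochner_Integration.integral_diff) (auto simp del: of_real_power of_real_divide)
  also have "cmod \<dots> \<le> expectation (\<lambda>\<omega>. \<bar>X \<omega>\<bar> powr (2 + \<eta>))"
    by (rule order_trans[OF integral_norm_bound], rule integral_mono[OF _ int iexp_second_order[OF \<eta>]])
      (intro integrable_norm Bochner_Integration.integrable_diff Bochner_Integration.integrable_add
        ie integrable_mult_right integrable_of_real integrable_divide int1 int2 integrable_const)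
  finally show ?thesis .
qed

text \<open>As all factors have modulus at most 1, a product of characteristic functions can be
  replaced factor by factor, errors adding up. The reference variances \<open>q i\<close> are free,
  so a limiting covariance can be inserted directly; \<open>(q i)\<^sup>2 / 8\<close> is the error
  of \<open>exp (- q i / 2)\<close> against \<open>1 - q i / 2\<close>.\<close>

lemma char_indep_sum:
  fixes X :: "'i \<Rightarrow> 'a \<Rightarrow> real"
  assumes indep: "indep_vars (\<lambda>_. borel) X I" and fin: "finite I"
    and \<eta>: "0 < \<eta>" "\<eta> \<le> 1"
    and int: "\<And>i. i \<in> I \<Longrightarrow> integrable M (\<lambda>\<omega>. \<bar>X i \<omega>\<bar> powr (2 + \<eta>))"
    and mean: "\<And>i. i \<in> I \<Longrightarrow> expectation (X i) = 0"
    and q: "\<And>i. i \<in> I \<Longrightarrow> q i \<ge> 0"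
  shows "cmod ((CLINT \<omega>|M. iexp (\<Sum>i\<in>I. X i \<omega>)) - complex_of_real (exp (- (\<Sum>i\<in>I. q i) / 2)))
    \<le> (\<Sum>i\<in>I. expectation (\<lambda>\<omega>. \<bar>X i \<omega>\<bar> powr (2 + \<eta>)) +
          \<bar>expectation (\<lambda>\<omega>. (X i \<omega>)\<^sup>2) - q i\<bar> / 2 + (q i)\<^sup>2 / 8)"
proof -
  have rv: "X i \<in> borel_measurable M" if "i \<in> I" for i
    using indep that by (auto simp: indep_vars_def)
  have sum_rv: "(\<lambda>\<omega>. \<Sum>i\<in>I. X i \<omega>) \<in> borel_measurable M" using rv by (rule borel_measurable_sum)
  have "(CLINT \<omega>|M. iexp (\<Sum>i\<in>I. X i \<omega>)) = char (distr M borel (\<lambda>\<omega>. \<Sum>i\<in>I. X i \<omega>)) 1"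
    unfolding char_def by (subst integral_distr[OF sum_rv]) simp_all
  also have "\<dots> = (\<Prod>i\<in>I. char (distr M borel (X i)) 1)"
    by (rule char_distr_sum[OF indep])
  also have "\<dots> = (\<Prod>i\<in>I. CLINT \<omega>|M. iexp (X i \<omega>))"
    unfolding char_def by (intro prod.cong refl, subst integral_distr[OF rv]) simp_all
  finally have prod: "(CLINT \<omega>|M. iexp (\<Sum>i\<in>I. X i \<omega>)) = (\<Prod>i\<in>I. CLINT \<omega>|M. iexp (X i \<omega>))" .
  have "complex_of_real (exp (- (\<Sum>i\<in>I. q i) / 2)) = (\<Prod>i\<in>I. complex_of_real (exp (- q i / 2)))"
    using fin by (simp add: exp_sum[symmetric] sum_negf sum_divide_distrib flip: of_real_prod)
  then have "cmod ((CLINT \<omega>|M. iexp (\<Sum>i\<in>I. X i \<omega>)) - complex_of_real (exp (- (\<Sum>i\<in>I. q i) / 2)))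
      = cmod ((\<Prod>i\<in>I. CLINT \<omega>|M. iexp (X i \<omega>)) - (\<Prod>i\<in>I. complex_of_real (exp (- q i / 2))))"
    by (simp only: prod)
  also have "\<dots> \<le> (\<Sum>i\<in>I. cmod ((CLINT \<omega>|M. iexp (X i \<omega>)) - complex_of_real (exp (- q i / 2))))"
  proof (rule norm_prod_diff)
    fix i assume i: "i \<in> I"
    have "cmod (CLINT \<omega>|M. iexp (X i \<omega>)) \<le> (\<integral>\<omega>. cmod (iexp (X i \<omega>)) \<partial>M)" by (rule integral_norm_bound)
    then show "cmod (CLINT \<omega>|M. iexp (X i \<omega>)) \<le> 1" by (simp add: prob_space)
    show "cmod (complex_of_real (exp (- q i / 2))) \<le> 1" using q[OF i] by simp
  qed
  also have "\<dots> \<le> (\<Sum>i\<in>I. expectation (\<lambda>\<omega>. \<bar>X i \<omega>\<bar> powr (2 + \<eta>)) +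
          \<bar>expectation (\<lambda>\<omega>. (X i \<omega>)\<^sup>2) - q i\<bar> / 2 + (q i)\<^sup>2 / 8)"
  proof (rule sum_mono)
    fix i assume i: "i \<in> I"
    let ?s = "expectation (\<lambda>\<omega>. (X i \<omega>)\<^sup>2)"
    have 1: "cmod ((CLINT \<omega>|M. iexp (X i \<omega>)) - complex_of_real (1 - ?s / 2)) \<le> expectation (\<lambda>\<omega>. \<bar>X i \<omega>\<bar> powr (2 + \<eta>))"
      by (rule char_second_order[OF rv[OF i] \<eta> int[OF i] mean[OF i]])
    have "\<bar>(1 - ?s / 2) - exp (- q i / 2)\<bar> \<le> \<bar>?s - q i\<bar> / 2 + \<bar>exp (- (q i / 2)) - (1 - q i / 2)\<bar>"
      by (simp add: abs_if field_simps)
    also have "\<dots> \<le> \<bar>?s - q i\<bar> / 2 + (q i)\<^sup>2 / 8"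
      using abs_exp_minus_linear_le[of "q i / 2"] q[OF i] by (simp add: power_divide)
    finally have 2: "cmod (complex_of_real (1 - ?s / 2) - complex_of_real (exp (- q i / 2))) \<le> \<bar>?s - q i\<bar> / 2 + (q i)\<^sup>2 / 8"
      by (simp only: of_real_diff[symmetric] norm_of_real)
    show "cmod ((CLINT \<omega>|M. iexp (X i \<omega>)) - complex_of_real (exp (- q i / 2))) \<le>
       expectation (\<lambda>\<omega>. \<bar>X i \<omega>\<bar> powr (2 + \<eta>)) + \<bar>?s - q i\<bar> / 2 + (q i)\<^sup>2 / 8"
      using norm_triangle_le[OF add_mono[OF 1 2]] by simp
  qed
  finally show ?thesis .
qed

end

section \<open>The stochastic approximation chain\<close>

lemma integrable_nn_bound:
  fixes f :: "'a \<Rightarrow> real"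
  assumes [measurable]: "f \<in> borel_measurable M" and "\<And>x. f x \<ge> 0"
    and le: "(\<integral>\<^sup>+x. ennreal (f x) \<partial>M) \<le> ennreal C" and C: "C \<ge> 0"
  shows "integrable M f" "(\<integral>x. f x \<partial>M) \<le> C"
proof -
  show "integrable M f"
  proof (rule integrableI_bounded)
    show "(\<integral>\<^sup>+x. ennreal (norm (f x)) \<partial>M) < \<infinity>"
      using le assms(2) by (simp add: le_less_trans[OF _ ennreal_less_top])
  qed simp
  show "(\<integral>x. f x \<partial>M) \<le> C"
    using C le by (rule integral_real_bounded)
qed

lemma (in prob_space) integrable_norm_of_square:
  fixes f :: "'a \<Rightarrow> 'b::{banach, second_countable_topology}"
  assumes [measurable]: "f \<in> borel_measurable M" and "integrable M (\<lambda>x. (norm (f x))\<^sup>2)"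
  shows "integrable M f"
proof -
  have "integrable M (\<lambda>x. norm (f x))"
    by (rule square_integrable_imp_integrable) (use assms in auto)
  then show ?thesis by (simp add: integrable_norm_iff)
qed

lemma (in prob_space) expectation_le_sqrt:
  fixes f :: "'a \<Rightarrow> real"
  assumes [measurable]: "f \<in> borel_measurable M" and "integrable M (\<lambda>x. (f x)\<^sup>2)"
  shows "expectation (\<lambda>x. \<bar>f x\<bar>) \<le> sqrt (expectation (\<lambda>x. (f x)\<^sup>2))"
proof -
  have i: "integrable M (\<lambda>x. \<bar>f x\<bar>)"
    using square_integrable_imp_integrable[OF assms] by simp
  have "0 \<le> variance (\<lambda>x. \<bar>f x\<bar>)" by (intro integral_nonneg_AE) auto
  also have "\<dots> = expectation (\<lambda>x. (f x)\<^sup>2) - (expectation (\<lambda>x. \<bar>f x\<bar>))\<^sup>2"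
    using assms i by (subst variance_eq) auto
  finally show ?thesis by (intro real_le_rsqrt) simp
qed

text \<open>A single chain, with \<open>n\<close> fixed. \<open>X\<close> represents the law of the
  innovations; its joint law with \<open>V\<close> and \<open>\<theta>0\<close> is left
  open.\<close>

locale sa_chain = prob_space M for M :: "'w measure" +
  fixes H :: "real ^ 'd \<Rightarrow> real ^ 'q \<Rightarrow> real ^ 'd" and X :: "'w \<Rightarrow> real ^ 'q"
    and V :: "nat \<Rightarrow> 'w \<Rightarrow> real ^ 'q" and \<theta>0 :: "'w \<Rightarrow> real ^ 'd" and \<gamma> :: "real \<Rightarrow> real"
  assumes H_borel: "(\<lambda>(\<theta>, u). H \<theta> u) \<in> borel_measurable borel"
    and X [measurable]: "X \<in> borel_measurable M"
    and V_indep: "indep_vars (\<lambda>_. borel) V {1..}"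
    and V_law: "\<And>p. p \<ge> 1 \<Longrightarrow> distr M borel (V p) = distr M borel X"
    and \<theta>0 [measurable]: "\<theta>0 \<in> borel_measurable M"
    and \<theta>0_indep: "indep_rvs M borel \<theta>0 (\<Pi>\<^sub>M p\<in>{1..}. borel) (\<lambda>\<omega>. \<lambda>p\<in>{1..}. V p \<omega>)"
begin

abbreviation "\<theta> \<equiv> sa_scheme \<gamma> H \<theta>0 V"

definition "\<nu> = distr M borel X"

lemma H_measurable [measurable (raw)]:
  assumes "f \<in> borel_measurable N" "v \<in> borel_measurable N"
  shows "(\<lambda>x. H (f x) (v x)) \<in> borel_measurable N"
proof -
  have "(\<lambda>x. (f x, v x)) \<in> borel_measurable N"
    using assms by (rule borel_measurable_Pair)
  from measurable_compose[OF this H_borel] show ?thesis by simp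
qed

lemma V_measurable [measurable]: "p \<ge> 1 \<Longrightarrow> V p \<in> borel_measurable M"
  using V_indep by (auto simp: indep_vars_def)

lemma sets_\<nu> [measurable_cong, simp]: "sets \<nu> = sets borel"
  by (simp add: \<nu>_def)

lemma prob_space_\<nu>: "prob_space \<nu>"
  unfolding \<nu>_def by (rule prob_space_distr) simp

sublocale \<nu>: prob_space \<nu> by (rule prob_space_\<nu>)

lemma integral_\<nu>:
  fixes f :: "real ^ 'q \<Rightarrow> 'b::{banach, second_countable_topology}"
  shows "f \<in> borel_measurable borel \<Longrightarrow> (\<integral>u. f u \<partial>\<nu>) = (\<integral>\<omega>. f (X \<omega>) \<partial>M)"
  unfolding \<nu>_def by (rule integral_distr) auto

lemma integral_\<nu>':
  fixes f :: "real ^ 'q \<Rightarrow> 'b::{banach, second_countable_topology}"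
  assumes "f \<in> borel_measurable borel" "p \<ge> 1"
  shows "(\<integral>u. f u \<partial>\<nu>) = (\<integral>\<omega>. f (V p \<omega>) \<partial>M)"
  unfolding \<nu>_def V_law[OF assms(2), symmetric]
  by (rule integral_distr) (use assms in auto)

lemma integrable_\<nu>':
  fixes f :: "real ^ 'q \<Rightarrow> 'b::{banach, second_countable_topology}"
  assumes "f \<in> borel_measurable borel" "p \<ge> 1"
  shows "integrable \<nu> f \<longleftrightarrow> integrable M (\<lambda>\<omega>. f (V p \<omega>))"
  unfolding \<nu>_def V_law[OF assms(2), symmetric]
  by (rule integrable_distr_eq) (use assms in auto)

section \<open>The history of the chain and its independence of the next innovation\<close>

definition past :: "nat \<Rightarrow> 'w \<Rightarrow> nat \<Rightarrow> real ^ 'q" where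
  "past p \<omega> = (\<lambda>k\<in>{1..p}. V k \<omega>)"

text \<open>Rectangles rather than all joint events: they form an intersection-stable generator of
  \<open>history p\<close> on which independence can be computed.\<close>

definition past_events :: "nat \<Rightarrow> 'w set set" where
  "past_events p = {\<theta>0 -` A \<inter> past p -` B \<inter> space M | A B. A \<in> sets borel \<and> B \<in> sets (\<Pi>\<^sub>M k\<in>{1..p}. borel)}"

definition history :: "nat \<Rightarrow> 'w measure" where
  "history p = sigma (space M) (past_events p)"

lemma past_measurable: "past p \<in> measurable M (\<Pi>\<^sub>M k\<in>{1..p}. borel)"
  unfolding past_def by (rule measurable_restrict) auto

lemma past_events_subset: "past_events p \<subseteq> sets M"
proof
  fix E assume "E \<in> past_events p"
  then obtain A B where E: "E = \<theta>0 -` A \<inter> past p -` B \<inter> space M"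
    and A: "A \<in> sets borel" and B: "B \<in> sets (\<Pi>\<^sub>M k\<in>{1..p}. borel)"
    unfolding past_events_def by blast
  have "E = (\<theta>0 -` A \<inter> space M) \<inter> (past p -` B \<inter> space M)" using E by blast
  then show "E \<in> sets M"
    using measurable_sets[OF \<theta>0 A] measurable_sets[OF past_measurable B] by simp
qed

lemma space_history [simp]: "space (history p) = space M"
  using past_events_subset[of p] sets.space_closed[of M] unfolding history_def by (intro space_measure_of) blast

lemma sets_history: "sets (history p) = sigma_sets (space M) (past_events p)"
  using past_events_subset[of p] sets.space_closed[of M] unfolding history_def by (intro sets_measure_of) blast

lemma history_measurable:
  assumes "Z \<in> measurable (history p) N"
  shows "Z \<in> measurable M N"
proof -
  have "sets (history p) \<subseteq> sets M"
    unfolding sets_history using past_events_subset sets.sigma_sets_subset by blast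
  then show ?thesis
    using assms by (auto simp: measurable_def)
qed

lemma \<theta>0_history: "\<theta>0 \<in> borel_measurable (history p)"
proof (rule measurableI)
  fix A :: "(real ^ 'd) set" assume "A \<in> sets borel"
  moreover have "past p -` space (\<Pi>\<^sub>M k\<in>{1..p}. borel) \<inter> space M = space M"
    using past_measurable[of p] by (auto dest: measurable_space)
  ultimately have "\<theta>0 -` A \<inter> space M \<in> past_events p"
    unfolding past_events_def
    by (intro CollectI exI[of _ A] exI[of _ "space (\<Pi>\<^sub>M k\<in>{1..p}. borel)"]) auto
  then show "\<theta>0 -` A \<inter> space (history p) \<in> sets (history p)"
    by (simp add: sets_history)
qed simp

lemma past_history: "past p \<in> measurable (history p) (\<Pi>\<^sub>M k\<in>{1..p}. borel)"
proof (rule measurableI)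
  fix B :: "(nat \<Rightarrow> real ^ 'q) set" assume B: "B \<in> sets (\<Pi>\<^sub>M k\<in>{1..p}. borel)"
  then have "past p -` B \<inter> space M \<in> past_events p"
    unfolding past_events_def by (intro CollectI exI[of _ UNIV] exI[of _ B]) auto
  then show "past p -` B \<inter> space (history p) \<in> sets (history p)"
    by (simp add: sets_history)
qed (use past_measurable in \<open>auto dest: measurable_space\<close>)

lemma V_history: "1 \<le> k \<Longrightarrow> k \<le> p \<Longrightarrow> V k \<in> borel_measurable (history p)"
proof -
  assume k: "1 \<le> k" "k \<le> p"
  have "(\<lambda>\<omega>. past p \<omega> k) \<in> borel_measurable (history p)"
    by (rule measurable_compose[OF past_history measurable_component_singleton]) (use k in auto)
  then show ?thesis using k by (simp add: past_def)
qed

lemma \<theta>_history: "p \<le> q \<Longrightarrow> \<theta> p \<in> borel_measurable (history q)"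
proof (induction p)
  case 0
  have "\<theta> 0 = \<theta>0" by (simp add: fun_eq_iff)
  then show ?case using \<theta>0_history[of q] by simp
next
  case (Suc p)
  note [measurable] = Suc.IH[OF Suc_leD[OF Suc.prems]] V_history[OF _ Suc.prems]
  show ?case
    unfolding sa_scheme.simps by measurable
qed

lemma \<theta>_measurable [measurable]: "\<theta> p \<in> borel_measurable M"
  using \<theta>_history[OF order.refl] by (rule history_measurable)

text \<open>Combines two independences: \<open>\<theta>0\<close> is independent of the whole
  innovation sequence, and inside that sequence the block \<open>1..p\<close> is independent of
  \<open>Suc p\<close>. The probability of a rectangle factorises in three.\<close>

lemma indep_past_next:
  "indep_set (past_events p) {V (Suc p) -` C \<inter> space M | C. C \<in> sets borel}"
proof (rule indep_setI)
  show "past_events p \<subseteq> events" by (rule past_events_subset)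
  show "{V (Suc p) -` C \<inter> space M |C. C \<in> sets borel} \<subseteq> events"
    by auto
  fix a b assume "a \<in> past_events p" "b \<in> {V (Suc p) -` C \<inter> space M |C. C \<in> sets borel}"
  then obtain A B C where a: "a = \<theta>0 -` A \<inter> past p -` B \<inter> space M" and b: "b = V (Suc p) -` C \<inter> space M"
    and [measurable]: "A \<in> sets borel" "B \<in> sets (\<Pi>\<^sub>M k\<in>{1..p}. borel)" "C \<in> sets borel"
    by (auto simp: past_events_def)
  let ?P = "\<Pi>\<^sub>M k\<in>{1..}. (borel :: (real ^ 'q) measure)"
  have ind: "prob ((\<theta>0 -` A \<inter> space M) \<inter> ((\<lambda>\<omega>. \<lambda>p\<in>{1..}. V p \<omega>) -` D \<inter> space M)) =
    prob (\<theta>0 -` A \<inter> space M) * prob ((\<lambda>\<omega>. \<lambda>p\<in>{1..}. V p \<omega>) -` D \<inter> space M)"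
    if "D \<in> sets ?P" for D
    using \<theta>0_indep that unfolding indep_rvs_def by (intro indep_setD) auto
  define r where "r f = restrict f {1..p}" for f :: "nat \<Rightarrow> real ^ 'q"
  have r: "r \<in> measurable ?P (\<Pi>\<^sub>M k\<in>{1..p}. borel)"
    unfolding r_def by (rule measurable_restrict_subset) auto
  have VP: "(\<lambda>\<omega>. \<lambda>p\<in>{1..}. V p \<omega>) \<in> measurable M ?P" by (rule measurable_restrict) simp
  \<comment> \<open>Past and next innovation are written as events of the whole sequence, the form
    in which the independence of \<open>\<theta>0\<close> is given.\<close>
  define D1 where "D1 = r -` B \<inter> space ?P"
  define D2 where "D2 = (\<lambda>f. f (Suc p)) -` C \<inter> space ?P"
  have D: "D1 \<in> sets ?P" "D2 \<in> sets ?P"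
    unfolding D1_def D2_def
    by (rule measurable_sets[OF r], fact) (rule measurable_sets[OF measurable_component_singleton], auto)
  have pre1: "(\<lambda>\<omega>. \<lambda>p\<in>{1..}. V p \<omega>) -` D1 \<inter> space M = past p -` B \<inter> space M"
  proof -
    have "r (\<lambda>p\<in>{1..}. V p \<omega>) = past p \<omega>" for \<omega>
      by (auto simp: r_def past_def fun_eq_iff)
    then show ?thesis using measurable_space[OF VP] by (auto simp: D1_def)
  qed
  have pre2: "(\<lambda>\<omega>. \<lambda>p\<in>{1..}. V p \<omega>) -` D2 \<inter> space M = b"
    using measurable_space[OF VP] by (auto simp: D2_def b)
  have "prob (a \<inter> b) = prob ((\<theta>0 -` A \<inter> space M) \<inter> ((\<lambda>\<omega>. \<lambda>p\<in>{1..}. V p \<omega>) -` (D1 \<inter> D2) \<inter> space M))"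
    using pre1 pre2 by (intro arg_cong[of _ _ prob]) (auto simp: a b)
  also have "\<dots> = prob (\<theta>0 -` A \<inter> space M) * prob ((\<lambda>\<omega>. \<lambda>p\<in>{1..}. V p \<omega>) -` (D1 \<inter> D2) \<inter> space M)"
    using D by (intro ind) auto
  also have "(\<lambda>\<omega>. \<lambda>p\<in>{1..}. V p \<omega>) -` (D1 \<inter> D2) \<inter> space M = (past p -` B \<inter> space M) \<inter> b"
    using pre1 pre2 by auto
  also have "prob ((past p -` B \<inter> space M) \<inter> b) = prob (past p -` B \<inter> space M) * prob b"
  proof -
    have iv: "indep_var (PiM {1..p} (\<lambda>_. borel)) (\<lambda>\<omega>. restrict (\<lambda>i. V i \<omega>) {1..p})
       (PiM {Suc p} (\<lambda>_. borel)) (\<lambda>\<omega>. restrict (\<lambda>i. V i \<omega>) {Suc p})"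
      using V_indep by (rule indep_var_restrict) auto
    define C' where "C' = (\<lambda>f. f (Suc p)) -` C \<inter> space (PiM {Suc p} (\<lambda>_. borel :: (real ^ 'q) measure))"
    have C': "C' \<in> sets (PiM {Suc p} (\<lambda>_. borel))"
      unfolding C'_def by (rule measurable_sets[OF measurable_component_singleton]) auto
    have pc: "(\<lambda>\<omega>. restrict (\<lambda>i. V i \<omega>) {Suc p}) -` C' \<inter> space M = b"
      by (auto simp: C'_def b space_PiM)
    have "prob ((\<lambda>x. (restrict (\<lambda>i. V i x) {1..p}, restrict (\<lambda>i. V i x) {Suc p})) -` (B \<times> C') \<inter> space M) =
       prob ((\<lambda>\<omega>. restrict (\<lambda>i. V i \<omega>) {1..p}) -` B \<inter> space M) * prob ((\<lambda>\<omega>. restrict (\<lambda>i. V i \<omega>) {Suc p}) -` C' \<inter> space M)"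
      by (rule indep_varD[OF iv _ C']) fact
    moreover have "(\<lambda>x. (restrict (\<lambda>i. V i x) {1..p}, restrict (\<lambda>i. V i x) {Suc p})) -` (B \<times> C') \<inter> space M
       = (past p -` B \<inter> space M) \<inter> b"
      using pc by (auto simp: past_def)
    ultimately show ?thesis unfolding pc by (simp add: past_def[abs_def])
  qed
  also have "prob (\<theta>0 -` A \<inter> space M) * (prob (past p -` B \<inter> space M) * prob b) = prob a * prob b"
  proof -
    have "a = (\<theta>0 -` A \<inter> space M) \<inter> (past p -` B \<inter> space M)" using a by blast
    then show ?thesis using ind[OF D(1)] unfolding pre1 by (simp only: mult.assoc)
  qed
  finally show "prob (a \<inter> b) = prob a * prob b" .
qed

lemma indep_history_next:
  "indep_set (sets (history p)) {V (Suc p) -` C \<inter> space M | C. C \<in> sets borel}"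
proof -
  have s1: "Int_stable (past_events p)"
  proof (rule Int_stableI)
    fix a b assume "a \<in> past_events p" "b \<in> past_events p"
    then obtain A B A' B' where *: "a = \<theta>0 -` A \<inter> past p -` B \<inter> space M" "b = \<theta>0 -` A' \<inter> past p -` B' \<inter> space M"
      "A \<in> sets borel" "A' \<in> sets borel" "B \<in> sets (\<Pi>\<^sub>M k\<in>{1..p}. borel)" "B' \<in> sets (\<Pi>\<^sub>M k\<in>{1..p}. borel)"
      unfolding past_events_def by blast
    then show "a \<inter> b \<in> past_events p"
      unfolding past_events_def by (intro CollectI exI[of _ "A \<inter> A'"] exI[of _ "B \<inter> B'"]) auto
  qed
  have s2: "Int_stable {V (Suc p) -` C \<inter> space M | C. C \<in> sets borel}"
  proof (rule Int_stableI, safe)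
    fix C C' :: "(real ^ 'q) set" assume "C \<in> sets borel" "C' \<in> sets borel"
    then show "\<exists>C''. V (Suc p) -` C \<inter> space M \<inter> (V (Suc p) -` C' \<inter> space M) = V (Suc p) -` C'' \<inter> space M \<and> C'' \<in> sets borel"
      by (intro exI[of _ "C \<inter> C'"]) auto
  qed
  show ?thesis
    unfolding sets_history using indep_set_sigma_sets[OF indep_past_next s1 s2]
    by (auto simp: indep_sets2_eq intro: sigma_sets.Basic)
qed

text \<open>With the joint law a product, Fubini integrates out the next innovation while the
  history stays frozen; this plays the part of conditional expectation.\<close>

lemma distr_history_next:
  assumes Z: "Z \<in> measurable (history p) N"
  shows "distr M (N \<Otimes>\<^sub>M borel) (\<lambda>\<omega>. (Z \<omega>, V (Suc p) \<omega>)) = distr M N Z \<Otimes>\<^sub>M \<nu>"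
proof -
  note [measurable] = history_measurable[OF Z]
  have D1: "prob_space (distr M N Z)" by (rule prob_space_distr) simp
  interpret D1: prob_space "distr M N Z" by fact
  show ?thesis
  proof (rule pair_measure_eqI[symmetric])
    show "sigma_finite_measure (distr M N Z)" by unfold_locales
    show "sigma_finite_measure \<nu>" by unfold_locales
    show "sets (distr M N Z \<Otimes>\<^sub>M \<nu>) = sets (distr M (N \<Otimes>\<^sub>M borel) (\<lambda>\<omega>. (Z \<omega>, V (Suc p) \<omega>)))"
      by (simp cong: sets_pair_measure_cong)
    fix A B assume A: "A \<in> sets (distr M N Z)" and B: "B \<in> sets \<nu>"
    then have [measurable]: "A \<in> sets N" "B \<in> sets borel" by auto
    have "emeasure (distr M (N \<Otimes>\<^sub>M borel) (\<lambda>\<omega>. (Z \<omega>, V (Suc p) \<omega>))) (A \<times> B) =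
        prob ((Z -` A \<inter> space M) \<inter> (V (Suc p) -` B \<inter> space M))"
      by (subst emeasure_distr) (auto simp: emeasure_eq_measure intro!: arg_cong[of _ _ prob])
    also have "prob ((Z -` A \<inter> space M) \<inter> (V (Suc p) -` B \<inter> space M)) = prob (Z -` A \<inter> space M) * prob (V (Suc p) -` B \<inter> space M)"
      using measurable_sets[OF Z \<open>A \<in> sets N\<close>] by (intro indep_setD[OF indep_history_next]) auto
    also have "ennreal \<dots> = emeasure (distr M N Z) A * emeasure \<nu> B"
      unfolding \<nu>_def V_law[of "Suc p", simplified, symmetric]
      by (simp add: emeasure_distr emeasure_eq_measure ennreal_mult)
    finally show "emeasure (distr M N Z) A * emeasure \<nu> B =
        emeasure (distr M (N \<Otimes>\<^sub>M borel) (\<lambda>\<omega>. (Z \<omega>, V (Suc p) \<omega>))) (A \<times> B)" by simp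
  qed
qed

text \<open>Free of an integrability premise, this form is what proves the increments square
  integrable in the first place.\<close>

lemma nn_integral_freeze:
  assumes Z: "Z \<in> measurable (history p) N" and f [measurable]: "f \<in> borel_measurable (N \<Otimes>\<^sub>M borel)"
  shows "(\<integral>\<^sup>+\<omega>. f (Z \<omega>, V (Suc p) \<omega>) \<partial>M) = (\<integral>\<^sup>+\<omega>. (\<integral>\<^sup>+u. f (Z \<omega>, u) \<partial>\<nu>) \<partial>M)"
proof -
  note [measurable] = history_measurable[OF Z]
  have f': "f \<in> borel_measurable (distr M N Z \<Otimes>\<^sub>M \<nu>)"
    using f by (simp cong: measurable_cong_sets sets_pair_measure_cong)
  have "(\<integral>\<^sup>+\<omega>. f (Z \<omega>, V (Suc p) \<omega>) \<partial>M) = (\<integral>\<^sup>+z. f z \<partial>(distr M N Z \<Otimes>\<^sub>M \<nu>))"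
    unfolding distr_history_next[OF Z, symmetric] by (subst nn_integral_distr) auto
  also have "\<dots> = (\<integral>\<^sup>+z. (\<integral>\<^sup>+u. f (z, u) \<partial>\<nu>) \<partial>distr M N Z)"
    by (rule \<nu>.nn_integral_fst[symmetric, OF f'])
  also have "\<dots> = (\<integral>\<^sup>+\<omega>. (\<integral>\<^sup>+u. f (Z \<omega>, u) \<partial>\<nu>) \<partial>M)"
    by (subst nn_integral_distr) auto
  finally show ?thesis .
qed

lemma integral_freeze:
  fixes f :: "'z \<times> (real ^ 'q) \<Rightarrow> real"
  assumes Z: "Z \<in> measurable (history p) N" and f [measurable]: "f \<in> borel_measurable (N \<Otimes>\<^sub>M borel)"
    and int: "integrable M (\<lambda>\<omega>. f (Z \<omega>, V (Suc p) \<omega>))"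
  shows "(\<integral>\<omega>. f (Z \<omega>, V (Suc p) \<omega>) \<partial>M) = (\<integral>\<omega>. (\<integral>u. f (Z \<omega>, u) \<partial>\<nu>) \<partial>M)"
    "integrable M (\<lambda>\<omega>. \<integral>u. f (Z \<omega>, u) \<partial>\<nu>)"
proof -
  note [measurable] = history_measurable[OF Z]
  interpret D1: prob_space "distr M N Z" by (rule prob_space_distr) simp
  interpret P: pair_prob_space "distr M N Z" \<nu> by unfold_locales
  have f': "f \<in> borel_measurable (distr M N Z \<Otimes>\<^sub>M \<nu>)"
    using f by (simp cong: measurable_cong_sets sets_pair_measure_cong)
  have int': "integrable (distr M N Z \<Otimes>\<^sub>M \<nu>) f"
    unfolding distr_history_next[OF Z, symmetric] using int by (subst integrable_distr_eq) auto
  have "(\<integral>\<omega>. f (Z \<omega>, V (Suc p) \<omega>) \<partial>M) = (\<integral>z. f z \<partial>(distr M N Z \<Otimes>\<^sub>M \<nu>))"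
    unfolding distr_history_next[OF Z, symmetric] by (subst integral_distr) auto
  also have "\<dots> = (\<integral>z. (\<integral>u. f (z, u) \<partial>\<nu>) \<partial>distr M N Z)"
    by (rule P.integral_fst'[symmetric, OF int'])
  also have "\<dots> = (\<integral>\<omega>. (\<integral>u. f (Z \<omega>, u) \<partial>\<nu>) \<partial>M)"
    by (subst integral_distr) auto
  finally show "(\<integral>\<omega>. f (Z \<omega>, V (Suc p) \<omega>) \<partial>M) = (\<integral>\<omega>. (\<integral>u. f (Z \<omega>, u) \<partial>\<nu>) \<partial>M)" .
  have "integrable (distr M N Z) (\<lambda>z. \<integral>u. f (z, u) \<partial>\<nu>)"
    by (rule P.integrable_fst'[OF int'])
  then show "integrable M (\<lambda>\<omega>. \<integral>u. f (Z \<omega>, u) \<partial>\<nu>)"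
    by (subst (asm) integrable_distr_eq) auto
qed

end

section \<open>Contracting chains\<close>

lemma powr_double_le_one_plus_square:
  fixes y b :: real
  assumes "y \<ge> 0" "0 < b" "b \<le> 1"
  shows "y powr (2 * b) \<le> 1 + y\<^sup>2"
proof (cases "y \<le> 1")
  case True
  then have "y powr (2 * b) \<le> 1" using assms by (intro powr_le1) auto
  then show ?thesis using zero_le_power2[of y] by linarith
next
  case False
  then have "y powr (2 * b) \<le> y powr 2" using assms by (intro powr_mono) auto
  then show ?thesis using False by (simp add: powr_numeral)
qed

lemma norm_diff_square_le: "(norm (x - y))\<^sup>2 \<le> 2 * (norm x)\<^sup>2 + 2 * (norm y)\<^sup>2"
  for x y :: "'a::real_inner"
proof -
  have "0 \<le> (norm (x + y))\<^sup>2" by simp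
  then show ?thesis by (simp add: power2_norm_eq_inner inner_add_left inner_add_right
    inner_diff_left inner_diff_right inner_commute)
qed

lemma norm_diff_scaleR_square:
  "(norm (x - g *\<^sub>R y))\<^sup>2 = (norm x)\<^sup>2 - 2 * g * (x \<bullet> y) + g\<^sup>2 * (norm y)\<^sup>2"
  for x y :: "'a::real_inner"
  unfolding power2_norm_eq_inner
  by (simp add: inner_diff_left inner_diff_right inner_commute algebra_simps) (simp add: power2_eq_square)

text \<open>Bounds are stated with explicit constants, so that the same \<open>lam\<close>,
  \<open>C0\<close>, \<open>Cb\<close>, \<open>b\<close> can serve all \<open>n\<close>. Moments are
  given as nonnegative integrals, from which integrability follows.\<close>

locale sa_contraction = sa_chain M H X V \<theta>0 \<gamma>
  for M :: "'w measure" and H :: "real ^ 'd \<Rightarrow> real ^ 'q \<Rightarrow> real ^ 'd" and X V \<theta>0 \<gamma> +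
  fixes h :: "real ^ 'd \<Rightarrow> real ^ 'd" and \<theta>s :: "real ^ 'd" and lam C0 Cb b :: real
  assumes h: "h = mean_field M H X" and h_zero: "h \<theta>s = 0"
    and lam: "lam > 0" "\<And>\<theta>. (\<theta> - \<theta>s) \<bullet> h \<theta> \<ge> lam * (norm (\<theta> - \<theta>s))\<^sup>2"
    and b: "0 < b" "b \<le> 1" and C0: "C0 \<ge> 0" and Cb: "Cb \<ge> 0"
    and star_moment: "(\<integral>\<^sup>+\<omega>. ennreal ((norm (H \<theta>s (X \<omega>)))\<^sup>2) \<partial>M) \<le> ennreal C0"
    and hoelder: "\<And>\<theta> \<theta>'. (\<integral>\<^sup>+\<omega>. ennreal ((norm (H \<theta> (X \<omega>) - H \<theta>' (X \<omega>)))\<^sup>2) \<partial>M)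
      \<le> ennreal (Cb * norm (\<theta> - \<theta>') powr (2 * b))"
    and \<theta>0_L2: "integrable M (\<lambda>\<omega>. (norm (\<theta>0 \<omega>))\<^sup>2)"
begin

text \<open>Comes from writing \<open>H x\<close> as
  \<open>(H x - H \<theta>s) + H \<theta>s\<close> together with
  \<open>y powr (2 * b) \<le> 1 + y\<^sup>2\<close>; it is the constant of quadratic growth in
  \<open>H_L2\<close>.\<close>

definition "C1 = 2 * C0 + 2 * Cb"

lemma C1: "C1 \<ge> 0" using C0 Cb by (simp add: C1_def)

abbreviation "\<delta> p \<omega> \<equiv> \<theta> p \<omega> - \<theta>s"

definition "m p = expectation (\<lambda>\<omega>. (norm (\<delta> p \<omega>))\<^sup>2)"

abbreviation "step p \<equiv> \<gamma> (real p)"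

lemma h_integral: "h x = (\<integral>u. H x u \<partial>\<nu>)"
  unfolding h mean_field_def by (subst integral_\<nu>) auto

lemma h_measurable [measurable]: "h \<in> borel_measurable borel"
proof -
  have "(\<lambda>\<theta>. \<integral>u. H \<theta> u \<partial>\<nu>) \<in> borel_measurable borel"
    by measurable
  then show ?thesis by (simp add: h_integral[abs_def] cong: measurable_cong)
qed

lemma nn_integral_\<nu>: "f \<in> borel_measurable borel \<Longrightarrow> (\<integral>\<^sup>+u. f u \<partial>\<nu>) = (\<integral>\<^sup>+\<omega>. f (X \<omega>) \<partial>M)"
  unfolding \<nu>_def by (rule nn_integral_distr) auto

lemma diff_L2:
  shows "integrable \<nu> (\<lambda>u. (norm (H x u - H y u))\<^sup>2)"
    and "(\<integral>u. (norm (H x u - H y u))\<^sup>2 \<partial>\<nu>) \<le> Cb * norm (x - y) powr (2 * b)"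
proof -
  have *: "(\<integral>\<^sup>+u. ennreal ((norm (H x u - H y u))\<^sup>2) \<partial>\<nu>) \<le> ennreal (Cb * norm (x - y) powr (2 * b))"
    by (subst nn_integral_\<nu>) (use hoelder in auto)
  show "integrable \<nu> (\<lambda>u. (norm (H x u - H y u))\<^sup>2)"
    by (rule integrable_nn_bound(1)[OF _ _ *]) (use Cb in auto)
  show "(\<integral>u. (norm (H x u - H y u))\<^sup>2 \<partial>\<nu>) \<le> Cb * norm (x - y) powr (2 * b)"
    by (rule integrable_nn_bound(2)[OF _ _ *]) (use Cb in auto)
qed

lemma star_L2:
  shows "integrable \<nu> (\<lambda>u. (norm (H \<theta>s u))\<^sup>2)" and "(\<integral>u. (norm (H \<theta>s u))\<^sup>2 \<partial>\<nu>) \<le> C0"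
proof -
  have *: "(\<integral>\<^sup>+u. ennreal ((norm (H \<theta>s u))\<^sup>2) \<partial>\<nu>) \<le> ennreal C0"
    by (subst nn_integral_\<nu>) (use star_moment in auto)
  show "integrable \<nu> (\<lambda>u. (norm (H \<theta>s u))\<^sup>2)"
    by (rule integrable_nn_bound(1)[OF _ _ * C0]) auto
  show "(\<integral>u. (norm (H \<theta>s u))\<^sup>2 \<partial>\<nu>) \<le> C0"
    by (rule integrable_nn_bound(2)[OF _ _ * C0]) auto
qed

lemma H_L2:
  shows "integrable \<nu> (\<lambda>u. (norm (H x u))\<^sup>2)"
    and "(\<integral>u. (norm (H x u))\<^sup>2 \<partial>\<nu>) \<le> C1 * (1 + (norm (x - \<theta>s))\<^sup>2)"
proof -
  have le: "(norm (H x u))\<^sup>2 \<le> 2 * (norm (H x u - H \<theta>s u))\<^sup>2 + 2 * (norm (H \<theta>s u))\<^sup>2" for u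
    using norm_diff_square_le[of "H x u - H \<theta>s u" "- H \<theta>s u"] by simp
  have int: "integrable \<nu> (\<lambda>u. 2 * (norm (H x u - H \<theta>s u))\<^sup>2 + 2 * (norm (H \<theta>s u))\<^sup>2)"
    using diff_L2 star_L2 by auto
  show i: "integrable \<nu> (\<lambda>u. (norm (H x u))\<^sup>2)"
    by (rule Bochner_Integration.integrable_bound[OF int]) (use le in auto)
  have "(\<integral>u. (norm (H x u))\<^sup>2 \<partial>\<nu>) \<le> (\<integral>u. 2 * (norm (H x u - H \<theta>s u))\<^sup>2 + 2 * (norm (H \<theta>s u))\<^sup>2 \<partial>\<nu>)"
    by (intro integral_mono i int le)
  also have "\<dots> \<le> 2 * (Cb * norm (x - \<theta>s) powr (2 * b)) + 2 * C0"
    using diff_L2[of x \<theta>s] star_L2 by simp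
  also have "\<dots> \<le> 2 * (Cb * (1 + (norm (x - \<theta>s))\<^sup>2)) + 2 * C0 * (1 + (norm (x - \<theta>s))\<^sup>2)"
    using Cb C0 b by (intro add_mono mult_left_mono powr_double_le_one_plus_square) (auto simp: mult_le_cancel_left1)
  also have "\<dots> = C1 * (1 + (norm (x - \<theta>s))\<^sup>2)" by (simp add: C1_def algebra_simps)
  finally show "(\<integral>u. (norm (H x u))\<^sup>2 \<partial>\<nu>) \<le> C1 * (1 + (norm (x - \<theta>s))\<^sup>2)" .
qed

lemma H_integrable: "integrable \<nu> (H x)"
  by (rule \<nu>.integrable_norm_of_square) (use H_L2 in auto)

section \<open>Second moments of increments and errors\<close>

lemma increment_L2:
  assumes i: "integrable M (\<lambda>\<omega>. (norm (\<delta> p \<omega>))\<^sup>2)"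
  shows "integrable M (\<lambda>\<omega>. (norm (H (\<theta> p \<omega>) (V (Suc p) \<omega>)))\<^sup>2)"
    and "expectation (\<lambda>\<omega>. (norm (H (\<theta> p \<omega>) (V (Suc p) \<omega>)))\<^sup>2) \<le> C1 * (1 + m p)"
proof -
  have "(\<integral>\<^sup>+\<omega>. ennreal ((norm (H (\<theta> p \<omega>) (V (Suc p) \<omega>)))\<^sup>2) \<partial>M) =
      (\<integral>\<^sup>+\<omega>. (\<integral>\<^sup>+u. ennreal ((norm (H (\<theta> p \<omega>) u))\<^sup>2) \<partial>\<nu>) \<partial>M)"
    using nn_integral_freeze[OF \<theta>_history[OF order.refl], of "\<lambda>(\<theta>, u). ennreal ((norm (H \<theta> u))\<^sup>2)"] by simp
  also have "\<dots> \<le> (\<integral>\<^sup>+\<omega>. ennreal (C1 * (1 + (norm (\<delta> p \<omega>))\<^sup>2)) \<partial>M)"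
    using H_L2 by (intro nn_integral_mono) (simp add: nn_integral_eq_integral ennreal_leI)
  also have "\<dots> = ennreal (C1 * (1 + m p))"
    using i C1 by (subst nn_integral_eq_integral) (auto simp: m_def prob_space)
  finally have *: "(\<integral>\<^sup>+\<omega>. ennreal ((norm (H (\<theta> p \<omega>) (V (Suc p) \<omega>)))\<^sup>2) \<partial>M) \<le> ennreal (C1 * (1 + m p))" .
  have nn: "0 \<le> C1 * (1 + m p)" using C1 by (simp add: m_def integral_nonneg_AE)
  show "integrable M (\<lambda>\<omega>. (norm (H (\<theta> p \<omega>) (V (Suc p) \<omega>)))\<^sup>2)"
    by (rule integrable_nn_bound(1)[OF _ _ * nn]) auto
  show "expectation (\<lambda>\<omega>. (norm (H (\<theta> p \<omega>) (V (Suc p) \<omega>)))\<^sup>2) \<le> C1 * (1 + m p)"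
    by (rule integrable_nn_bound(2)[OF _ _ * nn]) auto
qed

lemma \<delta>_L2: "integrable M (\<lambda>\<omega>. (norm (\<delta> p \<omega>))\<^sup>2)"
proof (induction p)
  case 0
  have "integrable M (\<lambda>\<omega>. 2 * (norm (\<theta>0 \<omega>))\<^sup>2 + 2 * (norm \<theta>s)\<^sup>2)" using \<theta>0_L2 by simp
  then show ?case
    by (rule Bochner_Integration.integrable_bound) (use norm_diff_square_le in auto)
next
  case (Suc p)
  have "integrable M (\<lambda>\<omega>. 2 * (norm (\<delta> p \<omega>))\<^sup>2 + 2 * (norm (step (Suc p) *\<^sub>R H (\<theta> p \<omega>) (V (Suc p) \<omega>)))\<^sup>2)"
    using Suc increment_L2(1)[OF Suc] by (simp add: power_mult_distrib)
  then show ?case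
  proof (rule Bochner_Integration.integrable_bound)
    show "AE \<omega> in M. norm ((norm (\<delta> (Suc p) \<omega>))\<^sup>2) \<le>
       norm (2 * (norm (\<delta> p \<omega>))\<^sup>2 + 2 * (norm (step (Suc p) *\<^sub>R H (\<theta> p \<omega>) (V (Suc p) \<omega>)))\<^sup>2)"
    proof (rule AE_I2)
      fix \<omega>
      have "\<delta> (Suc p) \<omega> = \<delta> p \<omega> - step (Suc p) *\<^sub>R H (\<theta> p \<omega>) (V (Suc p) \<omega>)" by simp
      then have "(norm (\<delta> (Suc p) \<omega>))\<^sup>2 \<le>
          2 * (norm (\<delta> p \<omega>))\<^sup>2 + 2 * (norm (step (Suc p) *\<^sub>R H (\<theta> p \<omega>) (V (Suc p) \<omega>)))\<^sup>2"
        by (simp only: norm_diff_square_le)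
      then show "norm ((norm (\<delta> (Suc p) \<omega>))\<^sup>2) \<le>
         norm (2 * (norm (\<delta> p \<omega>))\<^sup>2 + 2 * (norm (step (Suc p) *\<^sub>R H (\<theta> p \<omega>) (V (Suc p) \<omega>)))\<^sup>2)"
        by (simp del: sa_scheme.simps)
    qed
  qed measurable
qed

lemma m_nonneg: "m p \<ge> 0"
  unfolding m_def by (intro integral_nonneg_AE) auto

lemma expectation_norm_\<delta>_le:
  shows "integrable M (\<lambda>\<omega>. norm (\<delta> p \<omega>))" "expectation (\<lambda>\<omega>. norm (\<delta> p \<omega>)) \<le> sqrt (m p)"
proof -
  show "integrable M (\<lambda>\<omega>. norm (\<delta> p \<omega>))"
    using integrable_norm_of_square[OF _ \<delta>_L2] by auto
  show "expectation (\<lambda>\<omega>. norm (\<delta> p \<omega>)) \<le> sqrt (m p)"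
    using expectation_le_sqrt[of "\<lambda>\<omega>. norm (\<delta> p \<omega>)"] \<delta>_L2 by (simp add: m_def)
qed

text \<open>The Robbins--Monro recursion: expand the square and integrate out the innovation in the
  cross term, which thus becomes a pairing of the error with \<open>h\<close>, to which coercivity
  applies.\<close>

lemma m_Suc_le:
  assumes "step (Suc p) \<ge> 0"
  shows "m (Suc p) \<le> (1 - 2 * lam * step (Suc p) + C1 * (step (Suc p))\<^sup>2) * m p + C1 * (step (Suc p))\<^sup>2"
proof -
  let ?g = "step (Suc p)" and ?H = "\<lambda>\<omega>. H (\<theta> p \<omega>) (V (Suc p) \<omega>)"
  note H2 = increment_L2[OF \<delta>_L2[of p]]
  have int_cross: "integrable M (\<lambda>\<omega>. \<delta> p \<omega> \<bullet> ?H \<omega>)"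
  proof (rule Bochner_Integration.integrable_bound[OF Bochner_Integration.integrable_add[OF \<delta>_L2[of p] H2(1)]])
    show "AE \<omega> in M. norm (\<delta> p \<omega> \<bullet> ?H \<omega>) \<le> norm ((norm (\<delta> p \<omega>))\<^sup>2 + (norm (?H \<omega>))\<^sup>2)"
    proof (rule AE_I2)
      fix \<omega>
      have "norm (\<delta> p \<omega> \<bullet> ?H \<omega>) \<le> norm (\<delta> p \<omega>) * norm (?H \<omega>)"
        using Cauchy_Schwarz_ineq2 by simp
      also have "\<dots> \<le> (norm (\<delta> p \<omega>))\<^sup>2 + (norm (?H \<omega>))\<^sup>2"
        using sum_squares_bound[of "norm (\<delta> p \<omega>)" "norm (?H \<omega>)"]
          mult_nonneg_nonneg[OF norm_ge_zero[of "\<delta> p \<omega>"] norm_ge_zero[of "?H \<omega>"]] by linarith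
      finally show "norm (\<delta> p \<omega> \<bullet> ?H \<omega>) \<le> norm ((norm (\<delta> p \<omega>))\<^sup>2 + (norm (?H \<omega>))\<^sup>2)" by simp
    qed
  qed measurable
  have fr: "expectation (\<lambda>\<omega>. \<delta> p \<omega> \<bullet> ?H \<omega>) = expectation (\<lambda>\<omega>. \<integral>u. \<delta> p \<omega> \<bullet> H (\<theta> p \<omega>) u \<partial>\<nu>)"
    "integrable M (\<lambda>\<omega>. \<integral>u. \<delta> p \<omega> \<bullet> H (\<theta> p \<omega>) u \<partial>\<nu>)"
    using integral_freeze[OF \<theta>_history[OF order.refl], of "\<lambda>(\<theta>, u). (\<theta> - \<theta>s) \<bullet> H \<theta> u" p] int_cross by simp_all
  have inner_h: "(\<integral>u. x \<bullet> H y u \<partial>\<nu>) = x \<bullet> h y" for x y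
    unfolding h_integral by (intro integral_inner_right H_integrable)
  have "lam * m p = expectation (\<lambda>\<omega>. lam * (norm (\<delta> p \<omega>))\<^sup>2)" by (simp add: m_def)
  also have "\<dots> \<le> expectation (\<lambda>\<omega>. \<integral>u. \<delta> p \<omega> \<bullet> H (\<theta> p \<omega>) u \<partial>\<nu>)"
    using \<delta>_L2 fr(2) lam(2) by (intro integral_mono) (auto simp: inner_h)
  finally have cross: "lam * m p \<le> expectation (\<lambda>\<omega>. \<delta> p \<omega> \<bullet> ?H \<omega>)" unfolding fr .
  have eq: "(norm (\<delta> (Suc p) \<omega>))\<^sup>2 = (norm (\<delta> p \<omega>))\<^sup>2 - 2 * ?g * (\<delta> p \<omega> \<bullet> ?H \<omega>) + ?g\<^sup>2 * (norm (?H \<omega>))\<^sup>2" for \<omega>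
  proof -
    have "\<delta> (Suc p) \<omega> = \<delta> p \<omega> - ?g *\<^sub>R ?H \<omega>" by simp
    then show ?thesis by (simp only: norm_diff_scaleR_square)
  qed
  have "m (Suc p) = m p - 2 * ?g * expectation (\<lambda>\<omega>. \<delta> p \<omega> \<bullet> ?H \<omega>) + ?g\<^sup>2 * expectation (\<lambda>\<omega>. (norm (?H \<omega>))\<^sup>2)"
    unfolding m_def eq using \<delta>_L2[of p] int_cross H2(1) by simp
  also have "\<dots> \<le> m p - 2 * ?g * (lam * m p) + ?g\<^sup>2 * (C1 * (1 + m p))"
    using assms cross H2(2) by (intro add_mono diff_mono mult_left_mono) auto
  also have "\<dots> = (1 - 2 * lam * ?g + C1 * ?g\<^sup>2) * m p + C1 * ?g\<^sup>2"
    by (simp add: algebra_simps)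
  finally show ?thesis .
qed

text \<open>A fractional moment through the scaling \<open>|x|^(2b) = t^b (|x|^2 / t)^b\<close>.
  When \<open>m p\<close> is of order \<open>t\<close>, the bound is of order
  \<open>t powr b\<close>.\<close>

lemma \<delta>_powr_le:
  assumes "t > 0"
  shows "integrable M (\<lambda>\<omega>. norm (\<delta> p \<omega>) powr (2 * b))"
    and "expectation (\<lambda>\<omega>. norm (\<delta> p \<omega>) powr (2 * b)) \<le> t powr b * (1 + m p / t)"
proof -
  have le: "norm x powr (2 * b) \<le> t powr b * (1 + (norm x)\<^sup>2 / t)" for x :: "real ^ 'd"
  proof -
    define y where "y = norm x / sqrt t"
    have "norm x powr (2 * b) = (sqrt t) powr (2 * b) * y powr (2 * b)"
      using assms by (simp add: y_def powr_mult[symmetric])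
    also have "(sqrt t) powr (2 * b) = t powr b"
      using assms by (simp add: powr_powr powr_half_sqrt[symmetric])
    also have "t powr b * y powr (2 * b) \<le> t powr b * (1 + y\<^sup>2)"
      using b assms by (intro mult_left_mono powr_double_le_one_plus_square) (auto simp: y_def)
    finally show ?thesis using assms by (simp add: y_def power_divide)
  qed
  have int: "integrable M (\<lambda>\<omega>. t powr b * (1 + (norm (\<delta> p \<omega>))\<^sup>2 / t))" using \<delta>_L2 by simp
  show i: "integrable M (\<lambda>\<omega>. norm (\<delta> p \<omega>) powr (2 * b))"
    by (rule Bochner_Integration.integrable_bound[OF int]) (use le assms in auto)
  have "expectation (\<lambda>\<omega>. norm (\<delta> p \<omega>) powr (2 * b)) \<le> expectation (\<lambda>\<omega>. t powr b * (1 + (norm (\<delta> p \<omega>))\<^sup>2 / t))"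
    by (intro integral_mono i int le)
  also have "\<dots> = t powr b * (1 + m p / t)" using \<delta>_L2 by (simp add: m_def prob_space)
  finally show "expectation (\<lambda>\<omega>. norm (\<delta> p \<omega>) powr (2 * b)) \<le> t powr b * (1 + m p / t)" .
qed

text \<open>The innovation splits as \<open>H(\<theta>\<^sub>p,V) = h(\<theta>\<^sub>p) + H(\<theta>s,V) + D\<^sub>p\<close>: the middle term is i.i.d., and
  by the \<open>L\<^sup>2\<close>-Hoelder continuity of \<open>H\<close> the martingale increment \<open>D\<^sub>p\<close> is negligible.\<close>

definition D :: "nat \<Rightarrow> 'w \<Rightarrow> real ^ 'd" where
  "D p \<omega> = H (\<theta> p \<omega>) (V (Suc p) \<omega>) - h (\<theta> p \<omega>) - H \<theta>s (V (Suc p) \<omega>)"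

lemma D_history: "p < q \<Longrightarrow> D p \<in> borel_measurable (history q)"
proof -
  assume "p < q"
  then have [measurable]: "\<theta> p \<in> borel_measurable (history q)" "V (Suc p) \<in> borel_measurable (history q)"
    by (auto intro: \<theta>_history V_history)
  show ?thesis unfolding D_def by measurable
qed

lemma D_centred:
  shows "(\<integral>u. w \<bullet> (H x u - h x - H \<theta>s u) \<partial>\<nu>) = 0"
    and "integrable \<nu> (\<lambda>u. w \<bullet> (H x u - h x - H \<theta>s u))"
proof -
  have i: "integrable \<nu> (\<lambda>u. H x u - h x - H \<theta>s u)" by (intro Bochner_Integration.integrable_diff H_integrable) simp
  then show "integrable \<nu> (\<lambda>u. w \<bullet> (H x u - h x - H \<theta>s u))" by (rule integrable_inner_right)
  have "(\<integral>u. w \<bullet> (H x u - h x - H \<theta>s u) \<partial>\<nu>) = w \<bullet> (\<integral>u. H x u - h x - H \<theta>s u \<partial>\<nu>)"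
    by (rule integral_inner_right) (rule i)
  also have "(\<integral>u. H x u - h x - H \<theta>s u \<partial>\<nu>) = h x - h x - h \<theta>s"
    by (simp add: H_integrable h_integral \<nu>.prob_space)
  finally show "(\<integral>u. w \<bullet> (H x u - h x - H \<theta>s u) \<partial>\<nu>) = 0" by (simp add: h_zero)
qed

text \<open>As \<open>h \<theta>s = 0\<close>, the integrand is the square of \<open>Y\<close> minus
  its mean, with \<open>Y = w \<bullet> (H x - H \<theta>s)\<close>. The variance is at most the
  second moment of \<open>Y\<close>, which the Hoelder condition bounds.\<close>

lemma D_variance:
  shows "integrable \<nu> (\<lambda>u. (w \<bullet> (H x u - h x - H \<theta>s u))\<^sup>2)"
    and "(\<integral>u. (w \<bullet> (H x u - h x - H \<theta>s u))\<^sup>2 \<partial>\<nu>) \<le> (norm w)\<^sup>2 * (Cb * norm (x - \<theta>s) powr (2 * b))"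
proof -
  define Y where "Y u = w \<bullet> (H x u - H \<theta>s u)" for u
  have le: "(Y u)\<^sup>2 \<le> (norm w)\<^sup>2 * (norm (H x u - H \<theta>s u))\<^sup>2" for u
    unfolding Y_def power_mult_distrib[symmetric] using Cauchy_Schwarz_ineq2[of w "H x u - H \<theta>s u"]
    by (metis abs_le_square_iff abs_mult abs_norm_cancel)
  have Y2: "integrable \<nu> (\<lambda>u. (Y u)\<^sup>2)"
    by (rule Bochner_Integration.integrable_bound[of _ "\<lambda>u. (norm w)\<^sup>2 * (norm (H x u - H \<theta>s u))\<^sup>2"])
       (use diff_L2 le in \<open>auto simp: Y_def\<close>)
  have Y1: "integrable \<nu> Y" unfolding Y_def by (intro integrable_inner_right Bochner_Integration.integrable_diff H_integrable)
  have mean: "(\<integral>u. Y u \<partial>\<nu>) = w \<bullet> h x"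
    unfolding Y_def using H_integrable by (subst integral_inner_right) (auto simp: h_integral[symmetric] h_zero)
  have eq: "w \<bullet> (H x u - h x - H \<theta>s u) = Y u - (\<integral>u. Y u \<partial>\<nu>)" for u
    unfolding mean by (simp add: Y_def inner_diff_right)
  have "integrable \<nu> (\<lambda>u. (Y u)\<^sup>2 - 2 * (w \<bullet> h x) * Y u + (w \<bullet> h x)\<^sup>2)"
    using Y1 Y2 by simp
  then show "integrable \<nu> (\<lambda>u. (w \<bullet> (H x u - h x - H \<theta>s u))\<^sup>2)"
    unfolding eq mean by (simp add: power2_diff algebra_simps)
  have "(\<integral>u. (w \<bullet> (H x u - h x - H \<theta>s u))\<^sup>2 \<partial>\<nu>) = (\<integral>u. (Y u)\<^sup>2 \<partial>\<nu>) - (\<integral>u. Y u \<partial>\<nu>)\<^sup>2"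
    unfolding eq by (rule \<nu>.variance_eq[OF Y1 Y2])
  also have "\<dots> \<le> (\<integral>u. (norm w)\<^sup>2 * (norm (H x u - H \<theta>s u))\<^sup>2 \<partial>\<nu>)"
    using integral_mono[OF Y2 _ le] diff_L2(1) by simp (smt (verit) zero_le_power2)
  also have "\<dots> \<le> (norm w)\<^sup>2 * (Cb * norm (x - \<theta>s) powr (2 * b))"
    using diff_L2(2) by (simp add: mult_left_mono)
  finally show "(\<integral>u. (w \<bullet> (H x u - h x - H \<theta>s u))\<^sup>2 \<partial>\<nu>) \<le> (norm w)\<^sup>2 * (Cb * norm (x - \<theta>s) powr (2 * b))" .
qed

lemma D_L2:
  shows "integrable M (\<lambda>\<omega>. (w \<bullet> D p \<omega>)\<^sup>2)"
    and "expectation (\<lambda>\<omega>. (w \<bullet> D p \<omega>)\<^sup>2) \<le> (norm w)\<^sup>2 * (Cb * expectation (\<lambda>\<omega>. norm (\<delta> p \<omega>) powr (2 * b)))"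
proof -
  note i = \<delta>_powr_le(1)[OF zero_less_one, of p]
  have [measurable]: "D p \<in> borel_measurable M" using D_history[of p "Suc p"] by (auto intro: history_measurable)
  have "(\<integral>\<^sup>+\<omega>. ennreal ((w \<bullet> D p \<omega>)\<^sup>2) \<partial>M) =
      (\<integral>\<^sup>+\<omega>. (\<integral>\<^sup>+u. ennreal ((w \<bullet> (H (\<theta> p \<omega>) u - h (\<theta> p \<omega>) - H \<theta>s u))\<^sup>2) \<partial>\<nu>) \<partial>M)"
    using nn_integral_freeze[OF \<theta>_history[OF order.refl], of "\<lambda>(\<theta>, u). ennreal ((w \<bullet> (H \<theta> u - h \<theta> - H \<theta>s u))\<^sup>2)" p]
    by (simp add: D_def)
  also have "\<dots> \<le> (\<integral>\<^sup>+\<omega>. ennreal ((norm w)\<^sup>2 * (Cb * norm (\<delta> p \<omega>) powr (2 * b))) \<partial>M)"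
    using D_variance by (intro nn_integral_mono) (simp add: nn_integral_eq_integral ennreal_leI)
  also have "\<dots> = ennreal ((norm w)\<^sup>2 * (Cb * expectation (\<lambda>\<omega>. norm (\<delta> p \<omega>) powr (2 * b))))"
    using i Cb by (subst nn_integral_eq_integral) auto
  finally have *: "(\<integral>\<^sup>+\<omega>. ennreal ((w \<bullet> D p \<omega>)\<^sup>2) \<partial>M) \<le>
    ennreal ((norm w)\<^sup>2 * (Cb * expectation (\<lambda>\<omega>. norm (\<delta> p \<omega>) powr (2 * b))))" .
  have nn: "0 \<le> (norm w)\<^sup>2 * (Cb * expectation (\<lambda>\<omega>. norm (\<delta> p \<omega>) powr (2 * b)))"
    using Cb by (simp add: integral_nonneg_AE)
  show "integrable M (\<lambda>\<omega>. (w \<bullet> D p \<omega>)\<^sup>2)" by (rule integrable_nn_bound(1)[OF _ _ * nn]) auto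
  show "expectation (\<lambda>\<omega>. (w \<bullet> D p \<omega>)\<^sup>2) \<le> (norm w)\<^sup>2 * (Cb * expectation (\<lambda>\<omega>. norm (\<delta> p \<omega>) powr (2 * b)))"
    by (rule integrable_nn_bound(2)[OF _ _ * nn]) auto
qed

text \<open>Orthogonality of martingale increments: \<open>S N\<close> is known when the innovation
  of \<open>D N\<close> is drawn, so the cross term vanishes.\<close>

lemma martingale_L2:
  fixes w :: "nat \<Rightarrow> real ^ 'd"
  defines "S \<equiv> \<lambda>N \<omega>. \<Sum>p<N. w p \<bullet> D p \<omega>"
  shows "integrable M (\<lambda>\<omega>. (S N \<omega>)\<^sup>2) \<and> expectation (\<lambda>\<omega>. (S N \<omega>)\<^sup>2) \<le>
    (\<Sum>p<N. (norm (w p))\<^sup>2 * (Cb * expectation (\<lambda>\<omega>. norm (\<delta> p \<omega>) powr (2 * b))))"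
proof (induction N)
  case 0
  show ?case by (simp add: S_def)
next
  case (Suc N)
  let ?Y = "\<lambda>\<omega>. w N \<bullet> D N \<omega>"
  have [measurable]: "D p \<in> borel_measurable M" for p using D_history[of p "Suc p"] by (auto intro: history_measurable)
  have S_hist: "S N \<in> borel_measurable (history N)"
    unfolding S_def by (intro borel_measurable_sum borel_measurable_inner D_history borel_measurable_const) auto
  \<comment> \<open>The pair is frozen because the cross term involves \<open>S N\<close> as a
    factor and \<open>\<theta> N\<close> inside \<open>D N\<close>.\<close>
  have Z: "(\<lambda>\<omega>. (S N \<omega>, \<theta> N \<omega>)) \<in> measurable (history N) (borel \<Otimes>\<^sub>M borel)"
    using S_hist \<theta>_history[OF order.refl] by (rule measurable_Pair)
  note [measurable] = history_measurable[OF S_hist]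
  have S2: "integrable M (\<lambda>\<omega>. (S N \<omega>)\<^sup>2)" and D2: "integrable M (\<lambda>\<omega>. (?Y \<omega>)\<^sup>2)"
    using Suc D_L2 by auto
  have cross_int: "integrable M (\<lambda>\<omega>. S N \<omega> * ?Y \<omega>)"
  proof (rule Bochner_Integration.integrable_bound[OF Bochner_Integration.integrable_add[OF S2 D2]])
    show "AE \<omega> in M. norm (S N \<omega> * ?Y \<omega>) \<le> norm ((S N \<omega>)\<^sup>2 + (?Y \<omega>)\<^sup>2)"
    proof (rule AE_I2)
      fix \<omega>
      have "2 * (\<bar>S N \<omega>\<bar> * \<bar>?Y \<omega>\<bar>) \<le> (S N \<omega>)\<^sup>2 + (?Y \<omega>)\<^sup>2"
        using sum_squares_bound[of "\<bar>S N \<omega>\<bar>" "\<bar>?Y \<omega>\<bar>"] by (simp add: mult.assoc)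
      moreover have "0 \<le> \<bar>S N \<omega>\<bar> * \<bar>?Y \<omega>\<bar>" by simp
      ultimately show "norm (S N \<omega> * ?Y \<omega>) \<le> norm ((S N \<omega>)\<^sup>2 + (?Y \<omega>)\<^sup>2)"
        unfolding real_norm_def abs_mult by linarith
    qed
  qed measurable
  have f_meas: "(\<lambda>z. fst (fst z) * (w N \<bullet> (H (snd (fst z)) (snd z) - h (snd (fst z)) - H \<theta>s (snd z)))) \<in> borel_measurable ((borel \<Otimes>\<^sub>M borel) \<Otimes>\<^sub>M borel)"
    by measurable
  have "expectation (\<lambda>\<omega>. S N \<omega> * ?Y \<omega>) =
      expectation (\<lambda>\<omega>. \<integral>u. S N \<omega> * (w N \<bullet> (H (\<theta> N \<omega>) u - h (\<theta> N \<omega>) - H \<theta>s u)) \<partial>\<nu>)"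
    using integral_freeze(1)[OF Z f_meas] cross_int unfolding D_def by (simp del: integral_mult_right_zero)
  also have "\<dots> = 0" by (simp add: D_centred)
  finally have cross: "expectation (\<lambda>\<omega>. S N \<omega> * ?Y \<omega>) = 0" .
  have eq: "(S (Suc N) \<omega>)\<^sup>2 = (S N \<omega>)\<^sup>2 + 2 * (S N \<omega> * ?Y \<omega>) + (?Y \<omega>)\<^sup>2" for \<omega>
    by (simp add: S_def power2_sum)
  show ?case
    unfolding eq using S2 D2 cross_int Suc D_L2(2)[of "w N" N] by (simp add: cross)
qed

lemma expectation_inner_square:
  "expectation (\<lambda>\<omega>. (w \<bullet> H \<theta>s (X \<omega>))\<^sup>2) = w \<bullet> (second_moment M H X \<theta>s *v w)"
proof -
  define T where "T A = w \<bullet> (A *v w)" for A :: "real ^ 'd ^ 'd"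
  have T: "bounded_linear T" unfolding T_def by (rule bounded_linear_bilinear_form)
  have "integrable M (\<lambda>\<omega>. outer (H \<theta>s (X \<omega>)))"
    using integrable_nn_bound(1)[OF _ _ star_moment C0] by (intro integrable_outer) simp_all
  from integral_bounded_linear[OF T this]
  have "expectation (\<lambda>\<omega>. T (outer (H \<theta>s (X \<omega>)))) = T (second_moment M H X \<theta>s)"
    by (simp add: second_moment_def)
  then show ?thesis
    by (simp add: T_def outer_mult_vec power2_eq_square inner_commute)
qed

text \<open>At the fixed argument \<open>\<theta>s\<close> the innovations are independent and
  centred and the weights deterministic, so \<open>char_indep_sum\<close> applies; \<open>q\<close>
  will be the variance computed from the limit matrix.\<close>

lemma char_star_sum:
  fixes w :: "nat \<Rightarrow> real ^ 'd"
  assumes \<eta>: "0 < \<eta>" "\<eta> \<le> 1"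
    and K: "integrable M (\<lambda>\<omega>. norm (H \<theta>s (X \<omega>)) powr (2 + \<eta>))"
      "expectation (\<lambda>\<omega>. norm (H \<theta>s (X \<omega>)) powr (2 + \<eta>)) \<le> K"
    and q: "\<And>p. p < N \<Longrightarrow> q p \<ge> 0"
  shows "cmod ((CLINT \<omega>|M. iexp (\<Sum>p<N. w p \<bullet> H \<theta>s (V (Suc p) \<omega>))) - complex_of_real (exp (- (\<Sum>p<N. q p) / 2)))
    \<le> (\<Sum>p<N. norm (w p) powr (2 + \<eta>) * K + \<bar>w p \<bullet> (second_moment M H X \<theta>s *v w p) - q p\<bar> / 2 + (q p)\<^sup>2 / 8)"
proof -
  \<comment> \<open>Innovations are numbered from 1 and the sum from 0; \<open>?Y\<close> is
    \<open>?X\<close> with the index shifted.\<close>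
  let ?X = "\<lambda>p \<omega>. w p \<bullet> H \<theta>s (V (Suc p) \<omega>)" and ?Y = "\<lambda>k \<omega>. w (k - 1) \<bullet> H \<theta>s (V k \<omega>)"
  have "indep_vars (\<lambda>_. borel) V {1..N}"
    by (rule indep_vars_subset[OF V_indep]) auto
  then have ind: "indep_vars (\<lambda>_. borel) ?Y {1..N}"
    by (rule indep_vars_compose2[where Y="\<lambda>k u. w (k - 1) \<bullet> H \<theta>s u"]) measurable
  have law: "expectation (\<lambda>\<omega>. f (V (Suc p) \<omega>)) = expectation (\<lambda>\<omega>. f (X \<omega>))"
    and law_int: "integrable M (\<lambda>\<omega>. f (V (Suc p) \<omega>)) \<longleftrightarrow> integrable M (\<lambda>\<omega>. f (X \<omega>))"
    if "f \<in> borel_measurable borel" for f :: "real ^ 'q \<Rightarrow> real" and p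
    using that integral_\<nu>'[OF that, of "Suc p"] integral_\<nu>[OF that] integrable_\<nu>'[OF that, of "Suc p"]
    by (simp_all add: \<nu>_def integrable_distr_eq)
  have pw: "\<bar>w p \<bullet> y\<bar> powr (2 + \<eta>) \<le> norm (w p) powr (2 + \<eta>) * norm y powr (2 + \<eta>)" for p y
    using \<eta> by (simp add: powr_mult[symmetric] powr_mono2 Cauchy_Schwarz_ineq2)
  have int0: "integrable M (\<lambda>\<omega>. \<bar>w p \<bullet> H \<theta>s (X \<omega>)\<bar> powr (2 + \<eta>))" for p
    by (rule Bochner_Integration.integrable_bound[OF integrable_mult_right[OF K(1), of "norm (w p) powr (2 + \<eta>)"]])
       (use pw in auto)
  have intX: "integrable M (\<lambda>\<omega>. \<bar>?X p \<omega>\<bar> powr (2 + \<eta>))" for p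
    using law_int[of "\<lambda>u. \<bar>w p \<bullet> H \<theta>s u\<bar> powr (2 + \<eta>)" p] int0 by simp
  have meanX: "expectation (?X p) = 0" for p
  proof -
    have "expectation (?X p) = expectation (\<lambda>\<omega>. w p \<bullet> H \<theta>s (X \<omega>))"
      using law[of "\<lambda>u. w p \<bullet> H \<theta>s u" p] by simp
    also have "\<dots> = (\<integral>u. w p \<bullet> H \<theta>s u \<partial>\<nu>)" by (subst integral_\<nu>) auto
    also have "\<dots> = w p \<bullet> h \<theta>s" unfolding h_integral by (rule integral_inner_right) (rule H_integrable)
    finally show ?thesis by (simp add: h_zero)
  qed
  have "cmod ((CLINT \<omega>|M. iexp (\<Sum>k=1..N. ?Y k \<omega>)) - complex_of_real (exp (- (\<Sum>k=1..N. q (k - 1)) / 2)))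
    \<le> (\<Sum>k=1..N. expectation (\<lambda>\<omega>. \<bar>?Y k \<omega>\<bar> powr (2 + \<eta>)) +
      \<bar>expectation (\<lambda>\<omega>. (?Y k \<omega>)\<^sup>2) - q (k - 1)\<bar> / 2 + (q (k - 1))\<^sup>2 / 8)"
  proof (rule char_indep_sum[OF ind _ \<eta>])
    fix k assume "k \<in> {1..N}"
    then show "integrable M (\<lambda>\<omega>. \<bar>?Y k \<omega>\<bar> powr (2 + \<eta>))" "expectation (?Y k) = 0" "0 \<le> q (k - 1)"
      using intX[of "k - 1"] meanX[of "k - 1"] q[of "k - 1"] by auto
  qed simp
  then have "cmod ((CLINT \<omega>|M. iexp (\<Sum>p<N. ?X p \<omega>)) - complex_of_real (exp (- (\<Sum>p<N. q p) / 2)))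
    \<le> (\<Sum>p<N. expectation (\<lambda>\<omega>. \<bar>?X p \<omega>\<bar> powr (2 + \<eta>)) + \<bar>expectation (\<lambda>\<omega>. (?X p \<omega>)\<^sup>2) - q p\<bar> / 2 + (q p)\<^sup>2 / 8)"
    unfolding One_nat_def sum.atLeast1_atMost_eq by (simp only: diff_Suc_Suc diff_zero)
  also have "\<dots> \<le> (\<Sum>p<N. norm (w p) powr (2 + \<eta>) * K + \<bar>w p \<bullet> (second_moment M H X \<theta>s *v w p) - q p\<bar> / 2 + (q p)\<^sup>2 / 8)"
  proof (intro sum_mono add_mono)
    fix p
    have "expectation (\<lambda>\<omega>. \<bar>?X p \<omega>\<bar> powr (2 + \<eta>)) = expectation (\<lambda>\<omega>. \<bar>w p \<bullet> H \<theta>s (X \<omega>)\<bar> powr (2 + \<eta>))"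
      using law[of "\<lambda>u. \<bar>w p \<bullet> H \<theta>s u\<bar> powr (2 + \<eta>)" p] by simp
    also have "\<dots> \<le> expectation (\<lambda>\<omega>. norm (w p) powr (2 + \<eta>) * norm (H \<theta>s (X \<omega>)) powr (2 + \<eta>))"
      by (intro integral_mono int0 integrable_mult_right K pw)
    also have "\<dots> \<le> norm (w p) powr (2 + \<eta>) * K" using K(2) by (simp add: mult_left_mono)
    finally show "expectation (\<lambda>\<omega>. \<bar>?X p \<omega>\<bar> powr (2 + \<eta>)) \<le> norm (w p) powr (2 + \<eta>) * K" .
    have "expectation (\<lambda>\<omega>. (?X p \<omega>)\<^sup>2) = w p \<bullet> (second_moment M H X \<theta>s *v w p)"
      using law[of "\<lambda>u. (w p \<bullet> H \<theta>s u)\<^sup>2" p] by (simp add: expectation_inner_square)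
    then show "\<bar>expectation (\<lambda>\<omega>. (?X p \<omega>)\<^sup>2) - q p\<bar> / 2 \<le> \<bar>w p \<bullet> (second_moment M H X \<theta>s *v w p) - q p\<bar> / 2" by simp
  qed simp
  finally show ?thesis .
qed

text \<open>Discrete variation of constants. The weights almost solve the adjoint recursion, each
  being obtained from the next by the transpose of \<open>I - g A\<close>, so the pairing with the
  error telescopes up to three terms: the starting value, the remainder \<open>R\<close> from
  weights and nonlinear drift, bounded in mean, and the martingale \<open>S\<close>, bounded in mean
  square. The quadratic drift error meets \<open>m p\<close> rather than its root.\<close>

lemma linearisation:
  fixes w :: "nat \<Rightarrow> real ^ 'd" and A :: "real ^ 'd ^ 'd"
  assumes pos: "\<And>p. step p \<ge> 0"
    and drift: "\<And>\<theta>. norm (h \<theta> - A *v (\<theta> - \<theta>s)) \<le> \<epsilon> * norm (\<theta> - \<theta>s) + L * (norm (\<theta> - \<theta>s))\<^sup>2"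
    and \<epsilon>: "\<epsilon> \<ge> 0" and L: "L \<ge> 0" and a: "a \<ge> 0"
    and w: "\<And>p x. p < N \<Longrightarrow> \<bar>w (Suc p) \<bullet> x - w p \<bullet> x - step (Suc p) * (w (Suc p) \<bullet> (A *v x))\<bar> \<le>
       norm (w (Suc p)) * (a * (step (Suc p))\<^sup>2 * norm x)"
  shows "integrable M (\<lambda>\<omega>. w N \<bullet> \<delta> N \<omega> + (\<Sum>p<N. (step (Suc p) *\<^sub>R w (Suc p)) \<bullet> H \<theta>s (V (Suc p) \<omega>)))"
    and "expectation (\<lambda>\<omega>. \<bar>w N \<bullet> \<delta> N \<omega> + (\<Sum>p<N. (step (Suc p) *\<^sub>R w (Suc p)) \<bullet> H \<theta>s (V (Suc p) \<omega>))\<bar>) \<le>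
      norm (w 0) * sqrt (m 0) +
      (\<Sum>p<N. norm (w (Suc p)) * (a * (step (Suc p))\<^sup>2 * sqrt (m p) + step (Suc p) * (\<epsilon> * sqrt (m p) + L * m p))) +
      sqrt (\<Sum>p<N. (norm (step (Suc p) *\<^sub>R w (Suc p)))\<^sup>2 * (Cb * expectation (\<lambda>\<omega>. norm (\<delta> p \<omega>) powr (2 * b))))"
proof -
  define R where "R p \<omega> = w (Suc p) \<bullet> \<delta> p \<omega> - w p \<bullet> \<delta> p \<omega> - step (Suc p) * (w (Suc p) \<bullet> h (\<theta> p \<omega>))" for p \<omega>
  define S where "S \<omega> = (\<Sum>p<N. (step (Suc p) *\<^sub>R w (Suc p)) \<bullet> D p \<omega>)" for \<omega>
  have [measurable]: "D p \<in> borel_measurable M" for p using D_history[of p "Suc p"] by (auto intro: history_measurable)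
  have S_meas [measurable]: "S \<in> borel_measurable M" unfolding S_def by measurable
  have R_meas [measurable]: "R p \<in> borel_measurable M" for p unfolding R_def by measurable
  \<comment> \<open>Stated for every \<open>n\<close> with the weights fixed, so that induction
    telescopes; then specialised to \<open>n = N\<close>.\<close>
  have "w n \<bullet> \<delta> n \<omega> + (\<Sum>p<n. (step (Suc p) *\<^sub>R w (Suc p)) \<bullet> H \<theta>s (V (Suc p) \<omega>)) =
      w 0 \<bullet> \<delta> 0 \<omega> + (\<Sum>p<n. R p \<omega>) - (\<Sum>p<n. (step (Suc p) *\<^sub>R w (Suc p)) \<bullet> D p \<omega>)" for n \<omega>
  proof (induction n)
    case (Suc n)
    have "\<delta> (Suc n) \<omega> = \<delta> n \<omega> - step (Suc n) *\<^sub>R (h (\<theta> n \<omega>) + H \<theta>s (V (Suc n) \<omega>) + D n \<omega>)"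
      by (simp add: D_def)
    then have "w (Suc n) \<bullet> \<delta> (Suc n) \<omega> = w (Suc n) \<bullet> \<delta> n \<omega> - step (Suc n) * (w (Suc n) \<bullet> h (\<theta> n \<omega>)) -
       (step (Suc n) *\<^sub>R w (Suc n)) \<bullet> H \<theta>s (V (Suc n) \<omega>) - (step (Suc n) *\<^sub>R w (Suc n)) \<bullet> D n \<omega>"
      by (simp only: inner_diff_right inner_add_right inner_scaleR_right inner_scaleR_left distrib_left diff_diff_eq add.assoc)
    then show ?case using Suc by (simp add: R_def)
  qed simp
  then have id: "w N \<bullet> \<delta> N \<omega> + (\<Sum>p<N. (step (Suc p) *\<^sub>R w (Suc p)) \<bullet> H \<theta>s (V (Suc p) \<omega>)) =
      w 0 \<bullet> \<delta> 0 \<omega> + (\<Sum>p<N. R p \<omega>) - S \<omega>" for \<omega>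
    by (simp add: S_def)
  note n1 = expectation_norm_\<delta>_le
  have w0: "integrable M (\<lambda>\<omega>. w 0 \<bullet> \<delta> 0 \<omega>)" "expectation (\<lambda>\<omega>. \<bar>w 0 \<bullet> \<delta> 0 \<omega>\<bar>) \<le> norm (w 0) * sqrt (m 0)"
  proof -
    have "integrable M (\<lambda>\<omega>. \<delta> 0 \<omega>)" using n1(1)[of 0] by (subst (asm) integrable_norm_iff) auto
    then show i: "integrable M (\<lambda>\<omega>. w 0 \<bullet> \<delta> 0 \<omega>)" by (rule integrable_inner_right)
    have "expectation (\<lambda>\<omega>. \<bar>w 0 \<bullet> \<delta> 0 \<omega>\<bar>) \<le> expectation (\<lambda>\<omega>. norm (w 0) * norm (\<delta> 0 \<omega>))"
      using i n1(1)[of 0] by (intro integral_mono Cauchy_Schwarz_ineq2) auto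
    also have "\<dots> \<le> norm (w 0) * sqrt (m 0)" using n1(2)[of 0] by (simp add: mult_left_mono)
    finally show "expectation (\<lambda>\<omega>. \<bar>w 0 \<bullet> \<delta> 0 \<omega>\<bar>) \<le> norm (w 0) * sqrt (m 0)" .
  qed
  have R: "integrable M (R p)" "expectation (\<lambda>\<omega>. \<bar>R p \<omega>\<bar>) \<le>
      norm (w (Suc p)) * (a * (step (Suc p))\<^sup>2 * sqrt (m p) + step (Suc p) * (\<epsilon> * sqrt (m p) + L * m p))"
    if p: "p < N" for p
  proof -
    let ?g = "step (Suc p)" and ?n = "\<lambda>\<omega>. norm (\<delta> p \<omega>)"
    let ?B = "\<lambda>\<omega>. norm (w (Suc p)) * (a * ?g\<^sup>2 * ?n \<omega> + ?g * (\<epsilon> * ?n \<omega> + L * (?n \<omega>)\<^sup>2))"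
    have le: "\<bar>R p \<omega>\<bar> \<le> ?B \<omega>" for \<omega>
    proof -
      have "R p \<omega> = (w (Suc p) \<bullet> \<delta> p \<omega> - w p \<bullet> \<delta> p \<omega> - ?g * (w (Suc p) \<bullet> (A *v \<delta> p \<omega>)))
          - ?g * (w (Suc p) \<bullet> (h (\<theta> p \<omega>) - A *v \<delta> p \<omega>))"
        unfolding R_def inner_diff_right[of _ "h (\<theta> p \<omega>)"] right_diff_distrib by linarith
      then have "\<bar>R p \<omega>\<bar> \<le> \<bar>w (Suc p) \<bullet> \<delta> p \<omega> - w p \<bullet> \<delta> p \<omega> - ?g * (w (Suc p) \<bullet> (A *v \<delta> p \<omega>))\<bar>
          + ?g * \<bar>w (Suc p) \<bullet> (h (\<theta> p \<omega>) - A *v \<delta> p \<omega>)\<bar>"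
        using pos[of "Suc p"] abs_triangle_ineq4 by (metis abs_mult abs_of_nonneg)
      also have "\<dots> \<le> norm (w (Suc p)) * (a * ?g\<^sup>2 * ?n \<omega>) + ?g * (norm (w (Suc p)) * (\<epsilon> * ?n \<omega> + L * (?n \<omega>)\<^sup>2))"
        using pos[of "Suc p"] by (intro add_mono w[OF p] mult_left_mono order_trans[OF Cauchy_Schwarz_ineq2] drift) auto
      finally show ?thesis by (simp only: distrib_left mult_ac)
    qed
    have B: "integrable M ?B" using n1(1)[of p] \<delta>_L2[of p] by simp
    show i: "integrable M (R p)"
      by (rule Bochner_Integration.integrable_bound[OF B]) (use le in \<open>auto intro: order_trans[OF _ abs_ge_self]\<close>)
    have "expectation (\<lambda>\<omega>. \<bar>R p \<omega>\<bar>) \<le> expectation ?B"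
      using i B le by (intro integral_mono) auto
    also have "\<dots> = norm (w (Suc p)) * (a * ?g\<^sup>2 * expectation ?n + ?g * (\<epsilon> * expectation ?n + L * m p))"
      using n1(1)[of p] \<delta>_L2[of p] by (simp add: m_def)
    also have "\<dots> \<le> norm (w (Suc p)) * (a * ?g\<^sup>2 * sqrt (m p) + ?g * (\<epsilon> * sqrt (m p) + L * m p))"
      using pos[of "Suc p"] a \<epsilon> n1(2)[of p] by (intro mult_left_mono add_mono order.refl) auto
    finally show "expectation (\<lambda>\<omega>. \<bar>R p \<omega>\<bar>) \<le>
      norm (w (Suc p)) * (a * ?g\<^sup>2 * sqrt (m p) + ?g * (\<epsilon> * sqrt (m p) + L * m p))" .
  qed
  have S2: "integrable M (\<lambda>\<omega>. (S \<omega>)\<^sup>2)" "expectation (\<lambda>\<omega>. (S \<omega>)\<^sup>2) \<le>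
      (\<Sum>p<N. (norm (step (Suc p) *\<^sub>R w (Suc p)))\<^sup>2 * (Cb * expectation (\<lambda>\<omega>. norm (\<delta> p \<omega>) powr (2 * b))))"
    using martingale_L2[of "\<lambda>p. step (Suc p) *\<^sub>R w (Suc p)" N] unfolding S_def by auto
  have S1: "integrable M S" by (rule square_integrable_imp_integrable[OF S_meas S2(1)])
  show int: "integrable M (\<lambda>\<omega>. w N \<bullet> \<delta> N \<omega> + (\<Sum>p<N. (step (Suc p) *\<^sub>R w (Suc p)) \<bullet> H \<theta>s (V (Suc p) \<omega>)))"
    unfolding id using w0(1) R(1) S1 by (intro Bochner_Integration.integrable_diff Bochner_Integration.integrable_add Bochner_Integration.integrable_sum) auto
  have "expectation (\<lambda>\<omega>. \<bar>w 0 \<bullet> \<delta> 0 \<omega> + (\<Sum>p<N. R p \<omega>) - S \<omega>\<bar>) \<le>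
      expectation (\<lambda>\<omega>. \<bar>w 0 \<bullet> \<delta> 0 \<omega>\<bar> + (\<Sum>p<N. \<bar>R p \<omega>\<bar>) + \<bar>S \<omega>\<bar>)"
  proof (rule integral_mono)
    show "integrable M (\<lambda>\<omega>. \<bar>w 0 \<bullet> \<delta> 0 \<omega> + (\<Sum>p<N. R p \<omega>) - S \<omega>\<bar>)"
      using int unfolding id by simp
    show "integrable M (\<lambda>\<omega>. \<bar>w 0 \<bullet> \<delta> 0 \<omega>\<bar> + (\<Sum>p<N. \<bar>R p \<omega>\<bar>) + \<bar>S \<omega>\<bar>)"
      using w0(1) R(1) S1 by (intro Bochner_Integration.integrable_add Bochner_Integration.integrable_sum integrable_abs) auto
    fix \<omega>
    show "\<bar>w 0 \<bullet> \<delta> 0 \<omega> + (\<Sum>p<N. R p \<omega>) - S \<omega>\<bar> \<le> \<bar>w 0 \<bullet> \<delta> 0 \<omega>\<bar> + (\<Sum>p<N. \<bar>R p \<omega>\<bar>) + \<bar>S \<omega>\<bar>"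
      using sum_abs[of "\<lambda>p. R p \<omega>" "{..<N}"] by linarith
  qed
  also have "\<dots> = expectation (\<lambda>\<omega>. \<bar>w 0 \<bullet> \<delta> 0 \<omega>\<bar>) + (\<Sum>p<N. expectation (\<lambda>\<omega>. \<bar>R p \<omega>\<bar>)) + expectation (\<lambda>\<omega>. \<bar>S \<omega>\<bar>)"
  proof -
    have i1: "integrable M (\<lambda>\<omega>. \<bar>w 0 \<bullet> \<delta> 0 \<omega>\<bar>)" using w0(1) by (rule integrable_abs)
    have iR: "integrable M (\<lambda>\<omega>. \<bar>R p \<omega>\<bar>)" if "p \<in> {..<N}" for p using R(1) that by (intro integrable_abs) auto
    have i2: "integrable M (\<lambda>\<omega>. \<Sum>p<N. \<bar>R p \<omega>\<bar>)" using iR by (rule Bochner_Integration.integrable_sum)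
    have i3: "integrable M (\<lambda>\<omega>. \<bar>S \<omega>\<bar>)" using S1 by (rule integrable_abs)
    show ?thesis
      by (simp only: Bochner_Integration.integral_add[OF Bochner_Integration.integrable_add[OF i1 i2] i3]
        Bochner_Integration.integral_add[OF i1 i2] Bochner_Integration.integral_sum[OF iR])
  qed
  also have "expectation (\<lambda>\<omega>. \<bar>S \<omega>\<bar>) \<le>
      sqrt (\<Sum>p<N. (norm (step (Suc p) *\<^sub>R w (Suc p)))\<^sup>2 * (Cb * expectation (\<lambda>\<omega>. norm (\<delta> p \<omega>) powr (2 * b))))"
    by (rule order_trans[OF expectation_le_sqrt[OF S_meas S2(1)]]) (use S2(2) in simp)
  also have "expectation (\<lambda>\<omega>. \<bar>w 0 \<bullet> \<delta> 0 \<omega>\<bar>) \<le> norm (w 0) * sqrt (m 0)" by (rule w0(2))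
  also have "(\<Sum>p<N. expectation (\<lambda>\<omega>. \<bar>R p \<omega>\<bar>)) \<le> (\<Sum>p<N. norm (w (Suc p)) *
      (a * (step (Suc p))\<^sup>2 * sqrt (m p) + step (Suc p) * (\<epsilon> * sqrt (m p) + L * m p)))"
    by (rule sum_mono) (rule R(2), simp)
  finally show "expectation (\<lambda>\<omega>. \<bar>w N \<bullet> \<delta> N \<omega> + (\<Sum>p<N. (step (Suc p) *\<^sub>R w (Suc p)) \<bullet> H \<theta>s (V (Suc p) \<omega>))\<bar>) \<le>
      norm (w 0) * sqrt (m 0) +
      (\<Sum>p<N. norm (w (Suc p)) * (a * (step (Suc p))\<^sup>2 * sqrt (m p) + step (Suc p) * (\<epsilon> * sqrt (m p) + L * m p))) +
      sqrt (\<Sum>p<N. (norm (step (Suc p) *\<^sub>R w (Suc p)))\<^sup>2 * (Cb * expectation (\<lambda>\<omega>. norm (\<delta> p \<omega>) powr (2 * b))))"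
    unfolding id by simp
qed

end

section \<open>Uniform estimates along a step sequence\<close>

context step_sequence
begin

text \<open>Starting at \<open>k = 0\<close> costs one further step: the ratio
  \<open>g 0 / g 1\<close> and the elapsed time \<open>g 1\<close>. Index 0 occurs in the weight of
  the initial error.\<close>

lemma g_growth_from_0:
  obtains C where "C > 0" "\<And>N k. k \<le> N \<Longrightarrow> g k \<le> C * g N * exp (\<kappa> * age N k)"
proof -
  obtain C where C: "C > 0" "\<And>N k. 1 \<le> k \<Longrightarrow> k \<le> N \<Longrightarrow> g k \<le> C * g N * exp (\<kappa> * age N k)"
    by (erule g_growth_obtain)
  define C' where "C' = 1 + C + g 0 / g 1 * C * exp (\<bar>\<kappa>\<bar> * g 1)"
  have C': "C' \<ge> 1" "C' \<ge> C" "C' \<ge> g 0 / g 1 * C * exp (\<bar>\<kappa>\<bar> * g 1)"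
    using C(1) g_pos[of 0] g_pos[of 1] by (auto simp: C'_def)
  have "g k \<le> C' * g N * exp (\<kappa> * age N k)" if k: "k \<le> N" for k N
  proof (cases "k = 0")
    case False
    then have "g k \<le> C * g N * exp (\<kappa> * age N k)" using C(2) k by simp
    also have "\<dots> \<le> C' * g N * exp (\<kappa> * age N k)" using C' g_pos[of N] by (intro mult_right_mono) auto
    finally show ?thesis .
  next
    case k0: True
    show ?thesis
    proof (cases "N = 0")
      case True
      then show ?thesis using k0 C' g_pos[of 0] by simp
    next
      case False
      have "g 0 = g 0 / g 1 * g 1" using g_pos[of 1] by simp
      also have "\<dots> \<le> g 0 / g 1 * (C * g N * exp (\<kappa> * age N 1))"
        using False g_pos[of 0] g_pos[of 1] by (intro mult_left_mono C(2)) auto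
      also have "\<dots> \<le> g 0 / g 1 * (C * g N * (exp (\<bar>\<kappa>\<bar> * g 1) * exp (\<kappa> * age N 0)))"
      proof -
        have "- \<kappa> * g 1 \<le> \<bar>\<kappa>\<bar> * g 1" using g_pos[of 1] by (intro mult_right_mono) auto
        then have "\<kappa> * age N 1 \<le> \<bar>\<kappa>\<bar> * g 1 + \<kappa> * age N 0"
          using clock_Suc[of g 0] by (simp add: clock_def algebra_simps)
        then have "exp (\<kappa> * age N 1) \<le> exp (\<bar>\<kappa>\<bar> * g 1) * exp (\<kappa> * age N 0)"
          unfolding exp_add[symmetric] by (simp only: exp_le_cancel_iff)
        then show ?thesis using C(1) g_pos[of 0] g_pos[of 1] g_pos[of N] by (intro mult_left_mono) auto
      qed
      finally have "g 0 \<le> (g 0 / g 1 * C * exp (\<bar>\<kappa>\<bar> * g 1)) * (g N * exp (\<kappa> * age N 0))"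
        by (simp only: mult_ac)
      also have "\<dots> \<le> C' * (g N * exp (\<kappa> * age N 0))"
        using C' g_pos[of N] by (intro mult_right_mono) auto
      finally show ?thesis using k0 by (simp add: mult.assoc)
    qed
  qed
  moreover have "C' > 0" using C' by simp
  ultimately show thesis using that by blast
qed

text \<open>The factor of the recursion may be negative, so it is first replaced by the larger
  exponential of \<open>- 2 * lam * g + C * g\<^sup>2\<close>, which nonnegativity of
  \<open>m\<close> permits. Then the recursion unrolls.\<close>

lemma recursion_solution_le:
  fixes m :: "nat \<Rightarrow> real"
  assumes nonneg: "\<And>p. m p \<ge> 0" and C: "C \<ge> 0"
    and step: "\<And>p. m (Suc p) \<le> (1 - 2 * lam * g (Suc p) + C * (g (Suc p))\<^sup>2) * m p + C * (g (Suc p))\<^sup>2"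
  shows "m N \<le> exp (- 2 * lam * age N 0 + C * (\<Sum>j\<in>{0<..N}. (g j)\<^sup>2)) * m 0 +
    C * (\<Sum>k=1..N. (g k)\<^sup>2 * exp (- 2 * lam * age N k + C * (\<Sum>j\<in>{k<..N}. (g j)\<^sup>2)))"
proof (induction N)
  case (Suc N)
  define E where "E N k = exp (- 2 * lam * age N k + C * (\<Sum>j\<in>{k<..N}. (g j)\<^sup>2))" for N k
  define r where "r = exp (- 2 * lam * g (Suc N) + C * (g (Suc N))\<^sup>2)"
  have E_Suc: "E (Suc N) k = r * E N k" if "k \<le> N" for k
  proof -
    have "{k<..Suc N} = insert (Suc N) {k<..N}" using that by auto
    then have "(\<Sum>j\<in>{k<..Suc N}. (g j)\<^sup>2) = (g (Suc N))\<^sup>2 + (\<Sum>j\<in>{k<..N}. (g j)\<^sup>2)" by simp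
    then show ?thesis
      unfolding E_def r_def exp_add[symmetric] by (intro arg_cong[of _ _ exp]) (simp add: clock_Suc algebra_simps)
  qed
  have E_diag: "E (Suc N) (Suc N) = 1" by (simp add: E_def)
  have IH: "m N \<le> E N 0 * m 0 + C * (\<Sum>k=1..N. (g k)\<^sup>2 * E N k)"
    using Suc by (simp add: E_def)
  have "m (Suc N) \<le> (1 - 2 * lam * g (Suc N) + C * (g (Suc N))\<^sup>2) * m N + C * (g (Suc N))\<^sup>2" by (rule step)
  also have "\<dots> \<le> r * m N + C * (g (Suc N))\<^sup>2"
  proof -
    have "1 - 2 * lam * g (Suc N) + C * (g (Suc N))\<^sup>2 \<le> r"
      unfolding r_def using exp_ge_add_one_self[of "- 2 * lam * g (Suc N) + C * (g (Suc N))\<^sup>2"] by linarith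
    then show ?thesis using nonneg by (intro add_right_mono mult_right_mono)
  qed
  also have "\<dots> \<le> r * (E N 0 * m 0 + C * (\<Sum>k=1..N. (g k)\<^sup>2 * E N k)) + C * (g (Suc N))\<^sup>2"
    using IH by (intro add_right_mono mult_left_mono) (auto simp: r_def)
  also have "\<dots> = E (Suc N) 0 * m 0 + C * (\<Sum>k=1..Suc N. (g k)\<^sup>2 * E (Suc N) k)"
  proof -
    have "(\<Sum>k=1..N. (g k)\<^sup>2 * E (Suc N) k) = r * (\<Sum>k=1..N. (g k)\<^sup>2 * E N k)"
      unfolding sum_distrib_left by (intro sum.cong refl) (simp add: E_Suc)
    then show ?thesis by (simp add: E_diag E_Suc[of 0] algebra_simps)
  qed
  finally show ?case by (simp only: E_def)
qed (use C in simp)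

text \<open>\<open>K\<close> is chosen before \<open>m\<close>, hence common to all chains with the
  same parameters. The contraction must beat both the noise term \<open>C * g\<^sup>2\<close> and
  the backward growth \<kappa> of the steps; \<open>\<kappa> < 2 * lam\<close> leaves room for an
  intermediate rate \<open>c1\<close>.\<close>

lemma recursion_bound:
  assumes rates: "lam > 0" "\<kappa> < 2 * lam" and C: "C \<ge> 0" and u0: "u0 \<ge> 0"
  shows "\<exists>K>0. \<forall>m. (\<forall>p. m p \<ge> 0) \<longrightarrow> m 0 \<le> u0 \<longrightarrow>
    (\<forall>p. m (Suc p) \<le> (1 - 2 * lam * g (Suc p) + C * (g (Suc p))\<^sup>2) * m p + C * (g (Suc p))\<^sup>2) \<longrightarrow>
    (\<forall>p. m p \<le> K * g (Suc p))"
proof -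
  \<comment> \<open>Midway between \<kappa> and \<open>2 * lam\<close>, with the maximum keeping
    \<open>c1\<close> positive.\<close>
  define c1 where "c1 = (2 * lam + max \<kappa> 0) / 2"
  have c1: "c1 > 0" "c1 < 2 * lam" "\<kappa> < c1" using rates by (auto simp: c1_def)
  \<comment> \<open>So small that \<open>C\<close> times the squared steps uses up at most
    \<open>2 * lam - c1\<close> of the rate; \<open>C + 1\<close> avoids dividing by 0.\<close>
  define \<epsilon> where "\<epsilon> = (2 * lam - c1) / (C + 1)"
  have \<epsilon>: "\<epsilon> > 0" using c1 C by (simp add: \<epsilon>_def)
  have C\<epsilon>: "C * \<epsilon> \<le> 2 * lam - c1"
  proof -
    have "C * \<epsilon> = (C / (C + 1)) * (2 * lam - c1)" by (simp add: \<epsilon>_def)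
    also have "\<dots> \<le> 1 * (2 * lam - c1)" using C c1 by (intro mult_right_mono) auto
    finally show ?thesis by simp
  qed
  obtain D where D: "D \<ge> 0" "\<And>N k. k \<le> N \<Longrightarrow> (\<Sum>j\<in>{k<..N}. (g j)\<^sup>2) \<le> \<epsilon> * age N k + D"
    by (rule sum_squares_le[OF \<epsilon>]) blast
  obtain G where G: "G > 0" "\<And>N k. 1 \<le> k \<Longrightarrow> k \<le> N \<Longrightarrow> g k \<le> G * g N * exp (\<kappa> * age N k)"
    by (erule g_growth_obtain)
  obtain P where P: "P > 0" "\<And>k. g k \<le> P * g (Suc k)" by (erule g_pred_le)
  have E: "exp (- 2 * lam * age N k + C * (\<Sum>j\<in>{k<..N}. (g j)\<^sup>2)) \<le> exp (C * D) * exp (- c1 * age N k)" if "k \<le> N" for N k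
  proof -
    have "C * (\<Sum>j\<in>{k<..N}. (g j)\<^sup>2) \<le> C * (\<epsilon> * age N k + D)" using D(2)[OF that] C by (rule mult_left_mono)
    also have "\<dots> = (C * \<epsilon>) * age N k + C * D" by (simp add: distrib_left mult.assoc)
    also have "\<dots> \<le> (2 * lam - c1) * age N k + C * D"
      using C\<epsilon> age_nonneg[OF that] by (intro add_right_mono mult_right_mono) auto
    finally have "- 2 * lam * age N k + C * (\<Sum>j\<in>{k<..N}. (g j)\<^sup>2) \<le> C * D + - c1 * age N k"
      by (simp add: left_diff_distrib)
    then show ?thesis unfolding exp_add[symmetric] by (simp only: exp_le_cancel_iff)
  qed
  have decay: "exp (- c1 * age N k) * g k \<le> G * g N * exp (- (c1 - \<kappa>) * age N k)" if "1 \<le> k" "k \<le> N" for N k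
  proof -
    have "exp (- c1 * age N k) * g k \<le> exp (- c1 * age N k) * (G * g N * exp (\<kappa> * age N k))"
      using G(2)[OF that] by (intro mult_left_mono) auto
    also have "\<dots> = G * g N * exp (- (c1 - \<kappa>) * age N k)" by (simp add: mult_exp_exp algebra_simps)
    finally show ?thesis .
  qed
  \<comment> \<open>The first summand carries the initial value, compared through index 1, the
    second the accumulated noise.\<close>
  define K1 where "K1 = exp (C * D) * (G / g 1) * u0 + C * (exp (C * D) * (G * weight_bound (c1 - \<kappa>)))"
  have K1: "K1 \<ge> 0" using u0 C G(1) g_pos[of 1] weight_bound_pos[of "c1 - \<kappa>"] c1 by (simp add: K1_def)
  \<comment> \<open>\<open>P\<close> passes from \<open>g p\<close> to \<open>g (Suc p)\<close>;
    \<open>u0 / g 0\<close> serves \<open>p = 0\<close>.\<close>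
  define K where "K = (K1 + u0 / g 0 + 1) * P"
  have "m p \<le> K * g (Suc p)"
    if m: "\<And>p. m p \<ge> 0" "m 0 \<le> u0"
      "\<And>p. m (Suc p) \<le> (1 - 2 * lam * g (Suc p) + C * (g (Suc p))\<^sup>2) * m p + C * (g (Suc p))\<^sup>2" for m :: "nat \<Rightarrow> real" and p
  proof -
    have "m p \<le> (K1 + u0 / g 0) * g p"
    proof (cases "p = 0")
      case True
      have "m p \<le> u0 / g 0 * g p" using True m(2) g_pos[of 0] by simp
      then show ?thesis using K1 g_pos[of p] by (simp add: distrib_right add_increasing)
    next
      case False
      then have p: "1 \<le> p" by simp
      have first: "exp (- 2 * lam * age p 0 + C * (\<Sum>j\<in>{0<..p}. (g j)\<^sup>2)) * m 0 \<le> (exp (C * D) * (G / g 1) * u0) * g p"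
      proof -
        have "exp (- c1 * age p 0) * g 1 \<le> exp (- c1 * age p 1) * g 1"
          using clock_mono[of 0 1] c1 g_pos[of 1] by (intro mult_right_mono) auto
        also have "\<dots> \<le> G * g p * exp (- (c1 - \<kappa>) * age p 1)" by (rule decay) (use p in auto)
        also have "\<dots> \<le> G * g p * 1"
        proof -
          have "0 \<le> (c1 - \<kappa>) * age p 1" using c1 age_nonneg[OF p] by (intro mult_nonneg_nonneg) auto
          then have "exp (- (c1 - \<kappa>) * age p 1) \<le> 1" by (simp only: mult_minus_left exp_le_one_iff neg_le_0_iff_le)
          then show ?thesis using G(1) g_pos[of p] by (intro mult_left_mono) auto
        qed
        finally have "exp (- c1 * age p 0) \<le> (G / g 1) * g p" using g_pos[of 1] by (simp add: field_simps)
        then have "exp (C * D) * exp (- c1 * age p 0) \<le> exp (C * D) * ((G / g 1) * g p)" by (rule mult_left_mono) simp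
        then have "exp (- 2 * lam * age p 0 + C * (\<Sum>j\<in>{0<..p}. (g j)\<^sup>2)) \<le> exp (C * D) * ((G / g 1) * g p)"
          using E[of 0 p] by linarith
        then have "exp (- 2 * lam * age p 0 + C * (\<Sum>j\<in>{0<..p}. (g j)\<^sup>2)) * m 0 \<le> exp (C * D) * ((G / g 1) * g p) * u0"
          using m(1)[of 0] m(2) G(1) g_pos[of p] g_pos[of 1] by (intro mult_mono) auto
        then show ?thesis by (simp only: mult_ac)
      qed
      have second: "(\<Sum>k=1..p. (g k)\<^sup>2 * exp (- 2 * lam * age p k + C * (\<Sum>j\<in>{k<..p}. (g j)\<^sup>2))) \<le>
          (exp (C * D) * (G * weight_bound (c1 - \<kappa>))) * g p"
      proof -
        have "(\<Sum>k=1..p. (g k)\<^sup>2 * exp (- 2 * lam * age p k + C * (\<Sum>j\<in>{k<..p}. (g j)\<^sup>2))) \<le>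
          (\<Sum>k=1..p. exp (C * D) * (G * g p) * (g k * exp (- (c1 - \<kappa>) * age p k)))"
        proof (rule sum_mono)
          fix k assume k: "k \<in> {1..p}"
          have "(g k)\<^sup>2 * exp (- 2 * lam * age p k + C * (\<Sum>j\<in>{k<..p}. (g j)\<^sup>2)) \<le>
              (g k)\<^sup>2 * (exp (C * D) * exp (- c1 * age p k))"
            using k by (intro mult_left_mono E) auto
          also have "\<dots> = exp (C * D) * g k * (exp (- c1 * age p k) * g k)" by (simp add: power2_eq_square mult_ac)
          also have "\<dots> \<le> exp (C * D) * g k * (G * g p * exp (- (c1 - \<kappa>) * age p k))"
            using k g_pos[of k] by (intro mult_left_mono decay) auto
          finally show "(g k)\<^sup>2 * exp (- 2 * lam * age p k + C * (\<Sum>j\<in>{k<..p}. (g j)\<^sup>2)) \<le>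
             exp (C * D) * (G * g p) * (g k * exp (- (c1 - \<kappa>) * age p k))" by (simp only: mult_ac)
        qed
        also have "\<dots> = exp (C * D) * (G * g p) * (\<Sum>k=1..p. g k * exp (- (c1 - \<kappa>) * age p k))"
          by (simp only: sum_distrib_left)
        also have "\<dots> \<le> exp (C * D) * (G * g p) * weight_bound (c1 - \<kappa>)"
          using c1 G(1) g_pos[of p] by (intro mult_left_mono weights_le) auto
        finally show ?thesis by (simp only: mult_ac)
      qed
      have "m p \<le> (exp (C * D) * (G / g 1) * u0) * g p + C * ((exp (C * D) * (G * weight_bound (c1 - \<kappa>))) * g p)"
        by (rule order_trans[OF recursion_solution_le[OF m(1) C m(3)]]) (intro add_mono first mult_left_mono second C)
      also have "\<dots> = K1 * g p" by (simp add: K1_def algebra_simps)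
      also have "\<dots> \<le> (K1 + u0 / g 0) * g p"
        using u0 g_pos[of 0] g_pos[of p] by (intro mult_right_mono) auto
      finally show ?thesis .
    qed
    also have "\<dots> \<le> (K1 + u0 / g 0 + 1) * (P * g (Suc p))"
      using K1 u0 g_pos[of 0] g_pos[of p] P(2)[of p] by (intro mult_mono) auto
    finally show ?thesis by (simp add: K_def mult.assoc)
  qed
  moreover have "K > 0" using K1 u0 g_pos[of 0] P(1) by (simp add: K_def add_nonneg_pos)
  ultimately show ?thesis by blast
qed

end

lemma cmod_iexp_diff_le: "cmod (iexp x - iexp y) \<le> \<bar>x - y\<bar>"
proof -
  have "iexp x - iexp y = iexp y * (iexp (x - y) - 1)"
    by (simp add: algebra_simps exp_add[symmetric] flip: of_real_add)
  then have "cmod (iexp x - iexp y) = cmod (iexp (x - y) - 1)" by (simp add: norm_mult)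
  also have "\<dots> \<le> \<bar>x - y\<bar>" using iexp_approx1[of "x - y" 0] by simp
  finally show ?thesis .
qed

text \<open>Reduces exchanging two variables in a characteristic function to closeness in
  mean.\<close>

lemma (in prob_space) cmod_char_diff_le:
  fixes X Y :: "'a \<Rightarrow> real"
  assumes [measurable]: "X \<in> borel_measurable M" "Y \<in> borel_measurable M"
    and "integrable M (\<lambda>\<omega>. X \<omega> - Y \<omega>)"
  shows "cmod ((CLINT \<omega>|M. iexp (X \<omega>)) - (CLINT \<omega>|M. iexp (Y \<omega>))) \<le> expectation (\<lambda>\<omega>. \<bar>X \<omega> - Y \<omega>\<bar>)"
proof -
  have i: "integrable M (\<lambda>\<omega>. iexp (X \<omega>))" "integrable M (\<lambda>\<omega>. iexp (Y \<omega>))"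
    by (auto intro!: integrable_iexp)
  have "(CLINT \<omega>|M. iexp (X \<omega>)) - (CLINT \<omega>|M. iexp (Y \<omega>)) = (CLINT \<omega>|M. iexp (X \<omega>) - iexp (Y \<omega>))"
    using i by (rule Bochner_Integration.integral_diff[symmetric])
  also have "cmod \<dots> \<le> (\<integral>\<omega>. cmod (iexp (X \<omega>) - iexp (Y \<omega>)) \<partial>M)" by (rule integral_norm_bound)
  also have "\<dots> \<le> expectation (\<lambda>\<omega>. \<bar>X \<omega> - Y \<omega>\<bar>)"
    using i assms(3) by (intro integral_mono cmod_iexp_diff_le integrable_norm integrable_abs) auto
  finally show ?thesis .
qed

text \<open>Data common to all chains: \<open>\<kappa> < 2 * lam\<close> governs moments and
  weights, \<open>\<zeta> < lam\<close> the convergence of the covariance integral.\<close>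

locale sa_rates = step_sequence g \<kappa> \<zeta> for g :: "nat \<Rightarrow> real" and \<kappa> \<zeta> +
  fixes \<gamma> :: "real \<Rightarrow> real" and A \<Gamma> :: "real ^ 'd ^ 'd" and lam C0 Cb b u0 L \<eta> K :: real
  assumes \<gamma>: "\<And>k. \<gamma> (real k) = g k"
    and rates: "lam > 0" "\<kappa> < 2 * lam" "\<zeta> < lam"
    and A: "\<And>v. v \<bullet> (A *v v) \<ge> lam * (norm v)\<^sup>2"
    and \<Gamma>: "psd \<Gamma>"
    and params: "0 < b" "b \<le> 1" "C0 \<ge> 0" "Cb \<ge> 0" "u0 \<ge> 0" "L \<ge> 0" "0 < \<eta>" "\<eta> \<le> 1" "K \<ge> 0"
begin

text \<open>Taken from \<open>recursion_bound\<close> with \<open>C = 2 * C0 + 2 * Cb\<close>, the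
  constant \<open>C1\<close> of a contracting chain, before any chain is given; this makes the
  moment bound uniform in \<open>n\<close>.\<close>

definition moment_const :: real where
  "moment_const = (SOME K. K > 0 \<and> (\<forall>m. (\<forall>p. m p \<ge> 0) \<longrightarrow> m 0 \<le> u0 \<longrightarrow>
    (\<forall>p. m (Suc p) \<le> (1 - 2 * lam * g (Suc p) + (2 * C0 + 2 * Cb) * (g (Suc p))\<^sup>2) * m p + (2 * C0 + 2 * Cb) * (g (Suc p))\<^sup>2) \<longrightarrow>
    (\<forall>p. m p \<le> K * g (Suc p))))"

lemma moment_const:
  shows "moment_const > 0"
    and "\<And>m p. (\<And>p. m p \<ge> 0) \<Longrightarrow> m 0 \<le> u0 \<Longrightarrow>
    (\<And>p. m (Suc p) \<le> (1 - 2 * lam * g (Suc p) + (2 * C0 + 2 * Cb) * (g (Suc p))\<^sup>2) * m p + (2 * C0 + 2 * Cb) * (g (Suc p))\<^sup>2) \<Longrightarrow>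
    m p \<le> moment_const * g (Suc p)"
proof -
  have "\<exists>K. K > 0 \<and> (\<forall>m. (\<forall>p. m p \<ge> 0) \<longrightarrow> m 0 \<le> u0 \<longrightarrow>
    (\<forall>p. m (Suc p) \<le> (1 - 2 * lam * g (Suc p) + (2 * C0 + 2 * Cb) * (g (Suc p))\<^sup>2) * m p + (2 * C0 + 2 * Cb) * (g (Suc p))\<^sup>2) \<longrightarrow>
    (\<forall>p. m p \<le> K * g (Suc p)))"
    using params by (intro recursion_bound[OF rates(1,2)]) auto
  from someI_ex[OF this, folded moment_const_def]
  show "moment_const > 0"
    and "\<And>m p. (\<And>p. m p \<ge> 0) \<Longrightarrow> m 0 \<le> u0 \<Longrightarrow>
    (\<And>p. m (Suc p) \<le> (1 - 2 * lam * g (Suc p) + (2 * C0 + 2 * Cb) * (g (Suc p))\<^sup>2) * m p + (2 * C0 + 2 * Cb) * (g (Suc p))\<^sup>2) \<Longrightarrow>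
    m p \<le> moment_const * g (Suc p)"
    by blast+
qed

text \<open>The adjoint linear flow with end value \<open>v / sqrt (g N)\<close> at index
  \<open>N\<close>: pairing with an error at \<open>k\<close> transports it by the flow to time
  \<open>N\<close> and rescales it to order 1.\<close>

definition weight :: "real ^ 'd \<Rightarrow> nat \<Rightarrow> nat \<Rightarrow> real ^ 'd" where
  "weight v N k = (1 / sqrt (g N)) *\<^sub>R (transpose (mflow A \<zeta> (age N k)) *v v)"

text \<open>The flow decays at rate \<open>lam\<close>; measuring the error in units of
  \<open>sqrt (g k)\<close> instead of \<open>sqrt (g N)\<close> gives back
  \<open>\<kappa> / 2\<close>.\<close>

definition "rate = lam - \<kappa> / 2"

lemma rate: "rate > 0" using rates by (simp add: rate_def)

lemma inner_weight: "weight v N k \<bullet> x = (v \<bullet> (mflow A \<zeta> (age N k) *v x)) / sqrt (g N)"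
  by (simp add: weight_def dot_lmul_matrix)

lemma weight_end: "weight v N N \<bullet> x = (v \<bullet> x) / sqrt (g N)"
  by (simp add: inner_weight mflow_0)

text \<open>The semigroup law factors out one step of the flow, and \<open>mflow_Taylor\<close>
  compares it with the Euler step. This is the premise on weights in \<open>linearisation\<close>,
  with \<open>a = (norm A)\<^sup>2\<close>.\<close>

lemma weight_step:
  assumes "p < N"
  shows "\<bar>weight v N (Suc p) \<bullet> x - weight v N p \<bullet> x - g (Suc p) * (weight v N (Suc p) \<bullet> (A *v x))\<bar> \<le>
    norm (weight v N (Suc p)) * ((norm A)\<^sup>2 * (g (Suc p))\<^sup>2 * norm x)"
proof -
  let ?g = "g (Suc p)" and ?w = "weight v N (Suc p)"
  have "age N p = age N (Suc p) + ?g" by (simp add: clock_Suc)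
  moreover have "0 \<le> age N (Suc p)" using assms by (intro age_nonneg) simp
  ultimately have "mflow A \<zeta> (age N p) *v x = mflow A \<zeta> (age N (Suc p)) *v (mflow A \<zeta> ?g *v x)"
    using mflow_add[OF A, of "age N (Suc p)" \<zeta> ?g x] by (simp only:)
  then have "weight v N p \<bullet> x = ?w \<bullet> (mflow A \<zeta> ?g *v x)"
    by (simp only: inner_weight)
  then have "?w \<bullet> x - weight v N p \<bullet> x - ?g * (?w \<bullet> (A *v x)) = - (?w \<bullet> (mflow A \<zeta> ?g *v x - x + ?g *\<^sub>R (A *v x)))"
    by (simp add: inner_diff_right inner_add_right)
  also have "\<bar>\<dots>\<bar> \<le> norm ?w * norm (mflow A \<zeta> ?g *v x - x + ?g *\<^sub>R (A *v x))"
    by (simp only: abs_minus_cancel Cauchy_Schwarz_ineq2)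
  also have "\<dots> \<le> norm ?w * (?g\<^sup>2 * (norm A)\<^sup>2 * norm x)"
    using rates(1) g_pos[of "Suc p"] by (intro mult_left_mono mflow_Taylor[OF A]) auto
  finally show ?thesis by (simp only: mult_ac)
qed

lemma weight_bound_ex:
  "\<exists>C>0. \<forall>N. \<forall>k\<le>N. norm (weight v N k) * sqrt (g k) \<le> C * exp (- rate * age N k)"
proof -
  obtain G where G: "G > 0" "\<And>N k. k \<le> N \<Longrightarrow> g k \<le> G * g N * exp (\<kappa> * age N k)"
    by (erule g_growth_from_0)
  have "norm (weight v N k) * sqrt (g k) \<le> (sqrt G * norm v + 1) * exp (- rate * age N k)" if k: "k \<le> N" for N k
  proof -
    have w: "norm (weight v N k) \<le> exp (- lam * age N k) * norm v / sqrt (g N)"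
      unfolding weight_def using norm_transpose_mflow_le[OF A age_nonneg[OF k], of \<zeta> v] g_pos[of N]
      by (simp add: field_simps)
    have "sqrt (g k) \<le> sqrt (G * g N * exp (\<kappa> * age N k))" using G(2)[OF k] by simp
    also have "\<dots> = sqrt G * sqrt (g N) * exp (\<kappa> / 2 * age N k)"
    proof -
      have "sqrt (exp (\<kappa> * age N k)) = exp (\<kappa> / 2 * age N k)"
        by (rule real_sqrt_unique) (simp_all add: power2_eq_square mult_exp_exp)
      then show ?thesis by (simp add: real_sqrt_mult)
    qed
    finally have s: "sqrt (g k) \<le> sqrt G * sqrt (g N) * exp (\<kappa> / 2 * age N k)" .
    have "norm (weight v N k) * sqrt (g k) \<le>
        (exp (- lam * age N k) * norm v / sqrt (g N)) * (sqrt G * sqrt (g N) * exp (\<kappa> / 2 * age N k))"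
      using w s g_pos[of k] g_pos[of N] by (intro mult_mono) auto
    also have "\<dots> = sqrt G * norm v * (exp (- lam * age N k) * exp (\<kappa> / 2 * age N k))"
      using g_pos[of N] by simp
    also have "exp (- lam * age N k) * exp (\<kappa> / 2 * age N k) = exp (- rate * age N k)"
      by (simp add: rate_def mult_exp_exp algebra_simps)
    also have "sqrt G * norm v * exp (- rate * age N k) \<le> (sqrt G * norm v + 1) * exp (- rate * age N k)"
      by (intro mult_right_mono) auto
    finally show ?thesis .
  qed
  moreover have "sqrt G * norm v + 1 > 0" using G by (intro add_nonneg_pos) auto
  ultimately show ?thesis by (intro exI[of _ "sqrt G * norm v + 1"]) auto
qed

definition weight_const :: "real ^ 'd \<Rightarrow> real" where
  "weight_const v = (SOME C. C > 0 \<and> (\<forall>N. \<forall>k\<le>N. norm (weight v N k) * sqrt (g k) \<le> C * exp (- rate * age N k)))"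

lemma weight_const:
  shows "weight_const v > 0"
    and "k \<le> N \<Longrightarrow> norm (weight v N k) * sqrt (g k) \<le> weight_const v * exp (- rate * age N k)"
  using someI_ex[OF weight_bound_ex[of v]] unfolding weight_const_def by auto

lemma weight_sq_le:
  assumes k: "k \<le> N"
  shows "(norm (g k *\<^sub>R weight v N k))\<^sup>2 \<le> (weight_const v)\<^sup>2 * (g k * exp (- (2 * rate) * age N k))"
proof -
  have "(norm (weight v N k) * sqrt (g k))\<^sup>2 \<le> (weight_const v * exp (- rate * age N k))\<^sup>2"
    using g_pos[of k] by (intro power_mono weight_const(2)[OF k]) auto
  also have "\<dots> = (weight_const v)\<^sup>2 * exp (- (2 * rate) * age N k)"
    by (simp add: power_mult_distrib exp_double[symmetric] algebra_simps)
  finally have "g k * (norm (weight v N k) * sqrt (g k))\<^sup>2 \<le> g k * ((weight_const v)\<^sup>2 * exp (- (2 * rate) * age N k))"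
    using g_pos[of k] by (intro mult_left_mono) auto
  moreover have "g k * (norm (weight v N k) * sqrt (g k))\<^sup>2 = (norm (g k *\<^sub>R weight v N k))\<^sup>2"
    using g_pos[of k] by (simp add: power_mult_distrib power2_eq_square)
  ultimately show ?thesis by (simp only: mult_ac)
qed

text \<open>Of \<open>sqrt (g k) powr (2 + \<eta>)\<close> one factor \<open>g k\<close> is the
  summation weight, and \<open>g k powr (\<eta> / 2)\<close> tends to 0: the Lyapunov condition. The
  surplus decay in the age is dropped.\<close>

lemma weight_powr_le:
  assumes k: "k \<le> N"
  shows "norm (g k *\<^sub>R weight v N k) powr (2 + \<eta>) \<le>
    weight_const v powr (2 + \<eta>) * (g k * exp (- (2 * rate) * age N k) * g k powr (\<eta> / 2))"
proof -
  have gk: "g k > 0" by (rule g_pos)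
  have "norm (g k *\<^sub>R weight v N k) = sqrt (g k) * (norm (weight v N k) * sqrt (g k))"
    using gk by (simp add: mult.left_commute)
  also have "\<dots> \<le> sqrt (g k) * (weight_const v * exp (- rate * age N k))"
    using gk by (intro mult_left_mono weight_const(2)[OF k]) auto
  finally have "norm (g k *\<^sub>R weight v N k) powr (2 + \<eta>) \<le> (sqrt (g k) * (weight_const v * exp (- rate * age N k))) powr (2 + \<eta>)"
    using params by (intro powr_mono2) auto
  also have "\<dots> = weight_const v powr (2 + \<eta>) * (sqrt (g k) powr (2 + \<eta>) * exp (- rate * age N k) powr (2 + \<eta>))"
    using gk weight_const(1)[of v] by (simp add: powr_mult mult_ac)
  also have "sqrt (g k) powr (2 + \<eta>) = g k * g k powr (\<eta> / 2)"
    using gk by (simp add: powr_half_sqrt[symmetric] powr_powr powr_add add_divide_distrib)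
  also have "weight_const v powr (2 + \<eta>) * (g k * g k powr (\<eta> / 2) * exp (- rate * age N k) powr (2 + \<eta>)) \<le>
    weight_const v powr (2 + \<eta>) * (g k * g k powr (\<eta> / 2) * exp (- (2 * rate) * age N k))"
  proof (intro mult_left_mono)
    have "exp (- rate * age N k) powr (2 + \<eta>) = exp (- (2 * rate) * age N k) * exp (- (\<eta> * (rate * age N k)))"
      unfolding exp_powr_real mult_exp_exp by (intro arg_cong[of _ _ exp]) (simp add: algebra_simps)
    also have "\<dots> \<le> exp (- (2 * rate) * age N k) * 1"
      using rate params age_nonneg[OF k] by (intro mult_left_mono) auto
    finally show "exp (- rate * age N k) powr (2 + \<eta>) \<le> exp (- (2 * rate) * age N k)" by simp
  qed (use gk in auto)
  finally show ?thesis by (simp only: mult_ac)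
qed

lemma variance_tendsto:
  "(\<lambda>N. \<Sum>k=1..N. (g k *\<^sub>R weight v N k) \<bullet> (\<Gamma> *v (g k *\<^sub>R weight v N k)))
    \<longlonglongrightarrow> v \<bullet> (asymptotic_covariance A \<Gamma> \<zeta> *v v)"
proof -
  define q where "q s = (transpose (mflow A \<zeta> s) *v v) \<bullet> (\<Gamma> *v (transpose (mflow A \<zeta> s) *v v))" for s
  have eq: "(g k *\<^sub>R weight v N k) \<bullet> (\<Gamma> *v (g k *\<^sub>R weight v N k)) = (g k)\<^sup>2 / g N * q (age N k)" for N k
    using g_pos[of N] by (simp add: weight_def q_def matrix_vector_mult_scaleR power2_eq_square del: transpose_matrix_vector)
  have "continuous_on UNIV (\<lambda>s. transpose (mflow A \<zeta> s) *v v)"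
    unfolding transpose_def matrix_vector_mult_def using continuous_on_mflow[of UNIV A \<zeta>]
    by (intro continuous_on_vec_lambda continuous_intros) auto
  then have "continuous_on UNIV q"
    unfolding q_def by (intro continuous_on_inner
      continuous_on_compose2[OF linear_continuous_on[OF matrix_vector_mul_bounded_linear]]) auto
  then have q_cont: "continuous_on {0..} q" by (rule continuous_on_subset) auto
  have q_le: "\<bar>q s\<bar> \<le> (norm \<Gamma> * (norm v)\<^sup>2) * exp (- 2 * lam * s)" if "s \<ge> 0" for s
  proof -
    define w where "w = transpose (mflow A \<zeta> s) *v v"
    have w: "norm w \<le> exp (- lam * s) * norm v" unfolding w_def by (rule norm_transpose_mflow_le[OF A that])
    have "\<bar>q s\<bar> \<le> norm w * (norm \<Gamma> * norm w)"
      unfolding q_def w_def[symmetric]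
      by (intro order_trans[OF Cauchy_Schwarz_ineq2] mult_left_mono norm_matrix_vector_mult_le) auto
    also have "\<dots> \<le> (exp (- lam * s) * norm v) * (norm \<Gamma> * (exp (- lam * s) * norm v))"
      using w by (intro mult_mono) auto
    also have "\<dots> = (norm \<Gamma> * (norm v)\<^sup>2) * exp (- 2 * lam * s)"
      by (simp add: power2_eq_square mult_exp_exp algebra_simps)
    finally show ?thesis .
  qed
  have "(\<lambda>N. \<Sum>k=1..N. (g k)\<^sup>2 / g N * q (age N k)) \<longlonglongrightarrow> (LBINT x:{0..}. exp (2 * \<zeta> * x) * q x)"
    by (rule Riemann_sum_tendsto[OF q_cont q_le rates(2,3)])
  then show ?thesis
    unfolding eq inner_asymptotic_covariance[OF A rates(3)] q_def .
qed

text \<open>The errors of \<open>linearisation\<close> that depend on \<open>N\<close> alone. The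
  linear drift error, with its factor \<epsilon>, is kept out, since it vanishes with
  \<open>n\<close> and not with \<open>N\<close>.\<close>

definition bias :: "real ^ 'd \<Rightarrow> nat \<Rightarrow> real" where
  "bias v N = norm (weight v N 0) * sqrt u0 +
    (\<Sum>k=1..N. g k * exp (- rate * age N k) *
      (weight_const v * ((norm A)\<^sup>2 * sqrt moment_const * g k + L * moment_const * sqrt (g k)))) +
    sqrt (\<Sum>k=1..N. g k * exp (- (2 * rate) * age N k) * ((weight_const v)\<^sup>2 * Cb * (1 + moment_const) * g k powr b))"

text \<open>The errors of \<open>char_star_sum\<close> that depend on \<open>N\<close> alone: the
  moments of order 2 + \<eta>, and the squares of the \<open>q p\<close>, each \<open>q p\<close>
  being of order \<open>g\<close>.\<close>

definition lindeberg :: "real ^ 'd \<Rightarrow> nat \<Rightarrow> real" where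
  "lindeberg v N = (\<Sum>k=1..N. g k * exp (- (2 * rate) * age N k) *
      (weight_const v powr (2 + \<eta>) * K * g k powr (\<eta> / 2) + (norm \<Gamma>)\<^sup>2 * weight_const v ^ 4 * g k))"

lemma sqrt_g_tendsto: "(\<lambda>k. sqrt (g k)) \<longlonglongrightarrow> 0"
  using tendsto_real_sqrt[OF g_tendsto] by simp

lemma bias_tendsto: "bias v \<longlonglongrightarrow> 0"
proof -
  have "(\<lambda>N. norm (weight v N 0) * sqrt u0) \<longlonglongrightarrow> 0"
  proof (rule Lim_null_comparison)
    have "(\<lambda>N. exp (- rate * clock g N)) \<longlonglongrightarrow> 0"
      using rate by (intro filterlim_compose[OF exp_at_bot] filterlim_tendsto_neg_mult_at_bot[OF tendsto_const _ clock_at_top]) simp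
    then show "(\<lambda>N. weight_const v / sqrt (g 0) * exp (- rate * clock g N) * sqrt u0) \<longlonglongrightarrow> 0"
      by (intro tendsto_mult_left_zero tendsto_mult_right_zero)
    have "norm (weight v N 0) \<le> weight_const v / sqrt (g 0) * exp (- rate * clock g N)" for N
      using weight_const(2)[of 0 N v] g_pos[of 0] by (simp add: field_simps clock_def)
    from mult_right_mono[OF this, of "sqrt u0"]
    show "\<forall>\<^sub>F N in sequentially. norm (norm (weight v N 0) * sqrt u0) \<le>
        weight_const v / sqrt (g 0) * exp (- rate * clock g N) * sqrt u0"
      using params by (intro always_eventually allI) simp
  qed
  moreover have "(\<lambda>N. \<Sum>k=1..N. g k * exp (- rate * age N k) *
      (weight_const v * ((norm A)\<^sup>2 * sqrt moment_const * g k + L * moment_const * sqrt (g k)))) \<longlonglongrightarrow> 0"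
    using rate by (intro weighted_null_sequence tendsto_mult_right_zero tendsto_add_zero g_tendsto sqrt_g_tendsto)
  moreover have "(\<lambda>N. sqrt (\<Sum>k=1..N. g k * exp (- (2 * rate) * age N k) * ((weight_const v)\<^sup>2 * Cb * (1 + moment_const) * g k powr b))) \<longlonglongrightarrow> sqrt 0"
    using rate params by (intro tendsto_real_sqrt weighted_null_sequence tendsto_mult_right_zero g_powr_tendsto) auto
  ultimately show ?thesis
    unfolding bias_def[abs_def] by (auto intro!: tendsto_add_zero)
qed

lemma lindeberg_tendsto: "lindeberg v \<longlonglongrightarrow> 0"
  unfolding lindeberg_def[abs_def] using rate params
  by (intro weighted_null_sequence tendsto_add_zero tendsto_mult_right_zero g_powr_tendsto g_tendsto) auto

end

lemma half_le: "0 \<le> a \<Longrightarrow> a \<le> b \<Longrightarrow> a / 2 \<le> b" for a b :: real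
  by linarith

context sa_rates
begin

lemma moment_bound:
  fixes H :: "real ^ 'd \<Rightarrow> real ^ 'q \<Rightarrow> real ^ 'd"
  assumes chain: "sa_contraction M H X V \<theta>0 h \<theta>s lam C0 Cb b"
    and init: "(\<integral>\<omega>. (norm (\<theta>0 \<omega> - \<theta>s))\<^sup>2 \<partial>M) \<le> u0"
  shows "(\<integral>\<omega>. (norm (sa_scheme \<gamma> H \<theta>0 V p \<omega> - \<theta>s))\<^sup>2 \<partial>M) \<le> moment_const * g (Suc p)"
proof -
  interpret S: sa_contraction M H X V \<theta>0 \<gamma> h \<theta>s lam C0 Cb b by (rule chain)
  have "S.m p \<le> moment_const * g (Suc p)"
  proof (rule moment_const(2)[OF S.m_nonneg])
    show "S.m 0 \<le> u0" using init by (simp add: S.m_def)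
    fix p
    have "0 \<le> \<gamma> (real (Suc p))" unfolding \<gamma> using g_pos[of "Suc p"] by simp
    from S.m_Suc_le[OF this]
    show "S.m (Suc p) \<le> (1 - 2 * lam * g (Suc p) + (2 * C0 + 2 * Cb) * (g (Suc p))\<^sup>2) * S.m p + (2 * C0 + 2 * Cb) * (g (Suc p))\<^sup>2"
      unfolding \<gamma> S.C1_def .
  qed
  then show ?thesis by (simp only: S.m_def)
qed

text \<open>A bound for one chain and one \<open>N\<close>: two terms vanish with \<open>N\<close>,
  two as the chain approaches its limit. That separation is what allows \<open>N\<close> to depend
  on \<open>n\<close>.\<close>

theorem char_bound:
  fixes H :: "real ^ 'd \<Rightarrow> real ^ 'q \<Rightarrow> real ^ 'd"
  assumes chain: "sa_contraction M H X V \<theta>0 h \<theta>s lam C0 Cb b"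
    and init: "(\<integral>\<omega>. (norm (\<theta>0 \<omega> - \<theta>s))\<^sup>2 \<partial>M) \<le> u0"
    and drift: "\<And>x. norm (h x - A *v (x - \<theta>s)) \<le> \<epsilon> * norm (x - \<theta>s) + L * (norm (x - \<theta>s))\<^sup>2"
    and \<epsilon>: "\<epsilon> \<ge> 0"
    and moment: "integrable M (\<lambda>\<omega>. norm (H \<theta>s (X \<omega>)) powr (2 + \<eta>))"
      "(\<integral>\<omega>. norm (H \<theta>s (X \<omega>)) powr (2 + \<eta>) \<partial>M) \<le> K"
  shows "cmod ((CLINT \<omega>|M. iexp ((v \<bullet> (sa_scheme \<gamma> H \<theta>0 V N \<omega> - \<theta>s)) / sqrt (g N))) -
      complex_of_real (exp (- (\<Sum>k=1..N. (g k *\<^sub>R weight v N k) \<bullet> (\<Gamma> *v (g k *\<^sub>R weight v N k))) / 2)))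
    \<le> bias v N + \<epsilon> * (weight_const v * sqrt moment_const * weight_bound rate) + lindeberg v N +
      norm (second_moment M H X \<theta>s - \<Gamma>) * ((weight_const v)\<^sup>2 * weight_bound (2 * rate))"
proof -
  interpret S: sa_contraction M H X V \<theta>0 \<gamma> h \<theta>s lam C0 Cb b by (rule chain)
  let ?w = "weight v N" and ?Cw = "weight_const v" and ?Mc = moment_const
  let ?x = "\<lambda>p. g (Suc p) *\<^sub>R ?w (Suc p)"
  have m: "S.m p \<le> ?Mc * g (Suc p)" for p
    unfolding S.m_def by (rule moment_bound[OF chain init])
  have sqrt_m: "sqrt (S.m p) \<le> sqrt ?Mc * sqrt (g (Suc p))" for p
    using m[of p] by (simp add: real_sqrt_mult[symmetric])
  have gp: "g (Suc p) > 0" for p by (rule g_pos)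
  have Cw: "?Cw > 0" by (rule weight_const)
  have Mc: "?Mc > 0" by (rule moment_const)
  define Z where "Z \<omega> = ?w N \<bullet> (sa_scheme \<gamma> H \<theta>0 V N \<omega> - \<theta>s)" for \<omega>
  \<comment> \<open>The minus sign comes from the scheme, which subtracts the innovations; it
    disappears in the quadratic forms.\<close>
  define G where "G \<omega> = (\<Sum>p<N. (- ?x p) \<bullet> H \<theta>s (V (Suc p) \<omega>))" for \<omega>
  have diff: "Z \<omega> - G \<omega> = ?w N \<bullet> (sa_scheme \<gamma> H \<theta>0 V N \<omega> - \<theta>s) + (\<Sum>p<N. ?x p \<bullet> H \<theta>s (V (Suc p) \<omega>))" for \<omega>
    by (simp add: Z_def G_def sum_negf)
  have lin: "integrable M (\<lambda>\<omega>. Z \<omega> - G \<omega>)"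
    "S.expectation (\<lambda>\<omega>. \<bar>Z \<omega> - G \<omega>\<bar>) \<le> norm (?w 0) * sqrt (S.m 0) +
      (\<Sum>p<N. norm (?w (Suc p)) * ((norm A)\<^sup>2 * (g (Suc p))\<^sup>2 * sqrt (S.m p) + g (Suc p) * (\<epsilon> * sqrt (S.m p) + L * S.m p))) +
      sqrt (\<Sum>p<N. (norm (?x p))\<^sup>2 * (Cb * S.expectation (\<lambda>\<omega>. norm (sa_scheme \<gamma> H \<theta>0 V p \<omega> - \<theta>s) powr (2 * b))))"
  proof -
    have 1: "0 \<le> \<gamma> (real p)" for p unfolding \<gamma> using g_pos[of p] by simp
    have 2: "\<bar>?w (Suc p) \<bullet> x - ?w p \<bullet> x - \<gamma> (real (Suc p)) * (?w (Suc p) \<bullet> (A *v x))\<bar> \<le>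
        norm (?w (Suc p)) * ((norm A)\<^sup>2 * (\<gamma> (real (Suc p)))\<^sup>2 * norm x)" if "p < N" for p x
      unfolding \<gamma> using that by (rule weight_step)
    note L0 = params(6)
    show "integrable M (\<lambda>\<omega>. Z \<omega> - G \<omega>)"
      using S.linearisation(1)[OF 1 drift \<epsilon> L0 zero_le_power2 2] unfolding diff \<gamma> .
    show "S.expectation (\<lambda>\<omega>. \<bar>Z \<omega> - G \<omega>\<bar>) \<le> norm (?w 0) * sqrt (S.m 0) +
      (\<Sum>p<N. norm (?w (Suc p)) * ((norm A)\<^sup>2 * (g (Suc p))\<^sup>2 * sqrt (S.m p) + g (Suc p) * (\<epsilon> * sqrt (S.m p) + L * S.m p))) +
      sqrt (\<Sum>p<N. (norm (?x p))\<^sup>2 * (Cb * S.expectation (\<lambda>\<omega>. norm (sa_scheme \<gamma> H \<theta>0 V p \<omega> - \<theta>s) powr (2 * b))))"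
      using S.linearisation(2)[OF 1 drift \<epsilon> L0 zero_le_power2 2] unfolding diff \<gamma> .
  qed
  have meas: "Z \<in> borel_measurable M" "G \<in> borel_measurable M"
    unfolding Z_def G_def by measurable
  have t1: "norm (?w 0) * sqrt (S.m 0) \<le> norm (?w 0) * sqrt u0"
    using init by (intro mult_left_mono) (auto simp: S.m_def)
  have t2: "(\<Sum>p<N. norm (?w (Suc p)) * ((norm A)\<^sup>2 * (g (Suc p))\<^sup>2 * sqrt (S.m p) + g (Suc p) * (\<epsilon> * sqrt (S.m p) + L * S.m p))) \<le>
     (\<Sum>k=1..N. g k * exp (- rate * age N k) * (?Cw * ((norm A)\<^sup>2 * sqrt ?Mc * g k + L * ?Mc * sqrt (g k)))) +
     \<epsilon> * (?Cw * sqrt ?Mc * weight_bound rate)"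
  proof -
    have "norm (?w (Suc p)) * ((norm A)\<^sup>2 * (g (Suc p))\<^sup>2 * sqrt (S.m p) + g (Suc p) * (\<epsilon> * sqrt (S.m p) + L * S.m p)) \<le>
      g (Suc p) * exp (- rate * age N (Suc p)) * (?Cw * ((norm A)\<^sup>2 * sqrt ?Mc * g (Suc p) + L * ?Mc * sqrt (g (Suc p)))) +
      \<epsilon> * (?Cw * sqrt ?Mc) * (g (Suc p) * exp (- rate * age N (Suc p)))" if "p < N" for p
    proof -
      let ?g = "g (Suc p)" and ?e = "exp (- rate * age N (Suc p))"
      let ?B = "(norm A)\<^sup>2 * sqrt ?Mc * ?g + \<epsilon> * sqrt ?Mc + L * ?Mc * sqrt ?g"
      have "norm (?w (Suc p)) * ((norm A)\<^sup>2 * ?g\<^sup>2 * sqrt (S.m p) + ?g * (\<epsilon> * sqrt (S.m p) + L * S.m p)) \<le>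
        norm (?w (Suc p)) * ((norm A)\<^sup>2 * ?g\<^sup>2 * (sqrt ?Mc * sqrt ?g) + ?g * (\<epsilon> * (sqrt ?Mc * sqrt ?g) + L * (?Mc * ?g)))"
        using gp[of p] \<epsilon> params(6) by (intro mult_left_mono add_mono sqrt_m m) auto
      also have "\<dots> = (norm (?w (Suc p)) * sqrt ?g) * (?g * ?B)"
      proof -
        \<comment> \<open>One of the two roots combines with the weight in
          \<open>weight_const\<close>, the other remains as the vanishing factor.\<close>
        have "?Mc * ?g = ?Mc * sqrt ?g * sqrt ?g" using gp[of p] by simp
        then show ?thesis by (simp only:) (simp add: algebra_simps power2_eq_square)
      qed
      also have "\<dots> \<le> (?Cw * ?e) * (?g * ?B)"
        using that gp[of p] \<epsilon> params(6) Mc by (intro mult_right_mono weight_const(2)) auto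
      finally show ?thesis by (simp add: algebra_simps)
    qed
    then have "(\<Sum>p<N. norm (?w (Suc p)) * ((norm A)\<^sup>2 * (g (Suc p))\<^sup>2 * sqrt (S.m p) + g (Suc p) * (\<epsilon> * sqrt (S.m p) + L * S.m p))) \<le>
      (\<Sum>p<N. g (Suc p) * exp (- rate * age N (Suc p)) * (?Cw * ((norm A)\<^sup>2 * sqrt ?Mc * g (Suc p) + L * ?Mc * sqrt (g (Suc p)))) +
      \<epsilon> * (?Cw * sqrt ?Mc) * (g (Suc p) * exp (- rate * age N (Suc p))))"
      by (intro sum_mono) simp
    also have "\<dots> = (\<Sum>k=1..N. g k * exp (- rate * age N k) * (?Cw * ((norm A)\<^sup>2 * sqrt ?Mc * g k + L * ?Mc * sqrt (g k)))) +
      \<epsilon> * (?Cw * sqrt ?Mc) * (\<Sum>k=1..N. g k * exp (- rate * age N k))"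
      unfolding One_nat_def sum.atLeast1_atMost_eq sum.distrib sum_distrib_left ..
    also have "\<dots> \<le> (\<Sum>k=1..N. g k * exp (- rate * age N k) * (?Cw * ((norm A)\<^sup>2 * sqrt ?Mc * g k + L * ?Mc * sqrt (g k)))) +
      \<epsilon> * (?Cw * sqrt ?Mc) * weight_bound rate"
      using \<epsilon> Cw Mc by (intro add_left_mono mult_left_mono weights_le rate) auto
    finally show ?thesis by (simp only: mult.assoc)
  qed
  have sq: "(norm (?x p))\<^sup>2 \<le> ?Cw\<^sup>2 * (g (Suc p) * exp (- (2 * rate) * age N (Suc p)))" if "p < N" for p
    using that by (intro weight_sq_le) simp
  have t3: "sqrt (\<Sum>p<N. (norm (?x p))\<^sup>2 * (Cb * S.expectation (\<lambda>\<omega>. norm (sa_scheme \<gamma> H \<theta>0 V p \<omega> - \<theta>s) powr (2 * b)))) \<le>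
     sqrt (\<Sum>k=1..N. g k * exp (- (2 * rate) * age N k) * (?Cw\<^sup>2 * Cb * (1 + ?Mc) * g k powr b))"
  proof -
    have "(norm (?x p))\<^sup>2 * (Cb * S.expectation (\<lambda>\<omega>. norm (sa_scheme \<gamma> H \<theta>0 V p \<omega> - \<theta>s) powr (2 * b))) \<le>
      g (Suc p) * exp (- (2 * rate) * age N (Suc p)) * (?Cw\<^sup>2 * Cb * (1 + ?Mc) * g (Suc p) powr b)" if "p < N" for p
    proof -
      \<comment> \<open>Taking \<open>t = g (Suc p)\<close>, the order of \<open>S.m p\<close>,
        makes the bracket bounded.\<close>
      have "S.expectation (\<lambda>\<omega>. norm (sa_scheme \<gamma> H \<theta>0 V p \<omega> - \<theta>s) powr (2 * b)) \<le>
          g (Suc p) powr b * (1 + S.m p / g (Suc p))"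
        by (rule S.\<delta>_powr_le(2)[OF gp])
      also have "\<dots> \<le> g (Suc p) powr b * (1 + ?Mc)"
        using m[of p] gp[of p] by (intro mult_left_mono add_left_mono) (auto simp: field_simps)
      finally have e: "S.expectation (\<lambda>\<omega>. norm (sa_scheme \<gamma> H \<theta>0 V p \<omega> - \<theta>s) powr (2 * b)) \<le> g (Suc p) powr b * (1 + ?Mc)" .
      have "(norm (?x p))\<^sup>2 * (Cb * S.expectation (\<lambda>\<omega>. norm (sa_scheme \<gamma> H \<theta>0 V p \<omega> - \<theta>s) powr (2 * b))) \<le>
        (?Cw\<^sup>2 * (g (Suc p) * exp (- (2 * rate) * age N (Suc p)))) * (Cb * (g (Suc p) powr b * (1 + ?Mc)))"
        using params gp[of p] e by (intro mult_mono sq[OF that] mult_left_mono) (auto intro!: mult_nonneg_nonneg integral_nonneg_AE)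
      then show ?thesis by (simp only: mult_ac)
    qed
    then show ?thesis
      unfolding One_nat_def sum.atLeast1_atMost_eq by (intro real_sqrt_le_mono sum_mono) simp
  qed
  have bound1: "cmod ((CLINT \<omega>|M. iexp (Z \<omega>)) - (CLINT \<omega>|M. iexp (G \<omega>))) \<le>
      bias v N + \<epsilon> * (?Cw * sqrt ?Mc * weight_bound rate)"
    using S.cmod_char_diff_le[OF meas lin(1)] lin(2) t1 t2 t3 unfolding bias_def by linarith
  \<comment> \<open>Built from the limit \<Gamma>, so that the exponent is the sum in
    \<open>variance_tendsto\<close>; the covariance of the chain enters through its distance to
    \<Gamma>.\<close>
  define q where "q p = ?x p \<bullet> (\<Gamma> *v ?x p)" for p
  have q0: "q p \<ge> 0" for p using \<Gamma> unfolding q_def psd_def by blast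
  have q_neg: "(- y) \<bullet> (B *v (- y)) = y \<bullet> (B *v y)" for y and B :: "real ^ 'd ^ 'd"
    using matrix_vector_mult_diff_distrib[of B 0 y] by simp
  have "cmod ((CLINT \<omega>|M. iexp (G \<omega>)) - complex_of_real (exp (- (\<Sum>p<N. q p) / 2))) \<le>
      (\<Sum>p<N. norm (- ?x p) powr (2 + \<eta>) * K + \<bar>(- ?x p) \<bullet> (second_moment M H X \<theta>s *v (- ?x p)) - q p\<bar> / 2 + (q p)\<^sup>2 / 8)"
    unfolding G_def by (rule S.char_star_sum[OF params(7,8) moment]) (rule q0)
  also have "\<dots> \<le> (\<Sum>p<N. g (Suc p) * exp (- (2 * rate) * age N (Suc p)) *
        (?Cw powr (2 + \<eta>) * K * g (Suc p) powr (\<eta> / 2) + (norm \<Gamma>)\<^sup>2 * ?Cw ^ 4 * g (Suc p)) +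
      norm (second_moment M H X \<theta>s - \<Gamma>) * ?Cw\<^sup>2 * (g (Suc p) * exp (- (2 * rate) * age N (Suc p))))"
  proof (rule sum_mono)
    fix p assume "p \<in> {..<N}"
    then have p: "p < N" by simp
    let ?y = "?x p" and ?g = "g (Suc p)" and ?e = "exp (- (2 * rate) * age N (Suc p))"
    have a: "norm (- ?y) powr (2 + \<eta>) * K \<le> ?Cw powr (2 + \<eta>) * (?g * ?e * ?g powr (\<eta> / 2)) * K"
      unfolding norm_minus_cancel using p params by (intro mult_right_mono weight_powr_le) auto
    have form: "\<bar>y \<bullet> (B *v y)\<bar> \<le> norm B * (norm y)\<^sup>2" for y and B :: "real ^ 'd ^ 'd"
    proof -
      have "\<bar>y \<bullet> (B *v y)\<bar> \<le> norm y * (norm B * norm y)"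
        by (intro order_trans[OF Cauchy_Schwarz_ineq2] mult_left_mono norm_matrix_vector_mult_le) simp
      then show ?thesis by (simp only: power2_eq_square mult_ac)
    qed
    have "\<bar>(- ?y) \<bullet> (second_moment M H X \<theta>s *v (- ?y)) - q p\<bar> = \<bar>?y \<bullet> ((second_moment M H X \<theta>s - \<Gamma>) *v ?y)\<bar>"
      unfolding q_neg q_def by (simp only: matrix_vector_mult_diff_rdistrib inner_diff_right)
    also have "\<dots> \<le> norm (second_moment M H X \<theta>s - \<Gamma>) * (?Cw\<^sup>2 * (?g * ?e))"
      by (rule order_trans[OF form]) (intro mult_left_mono sq p norm_ge_zero)
    finally have b: "\<bar>(- ?y) \<bullet> (second_moment M H X \<theta>s *v (- ?y)) - q p\<bar> / 2 \<le>
      norm (second_moment M H X \<theta>s - \<Gamma>) * (?Cw\<^sup>2 * (?g * ?e))"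
      by (rule half_le[OF abs_ge_zero])
    have "q p \<le> norm \<Gamma> * (?Cw\<^sup>2 * (?g * ?e))"
      using form[of ?y \<Gamma>] mult_left_mono[OF sq[OF p] norm_ge_zero[of \<Gamma>]] unfolding q_def by linarith
    then have "(q p)\<^sup>2 \<le> (norm \<Gamma> * (?Cw\<^sup>2 * (?g * ?e)))\<^sup>2" using q0 by (rule power_mono)
    also have "\<dots> = (norm \<Gamma>)\<^sup>2 * ?Cw ^ 4 * ?g * (?g * ?e) * ?e"
      by (simp add: power2_eq_square power4_eq_xxxx)
    also have "\<dots> \<le> (norm \<Gamma>)\<^sup>2 * ?Cw ^ 4 * ?g * (?g * ?e) * 1"
      using gp[of p] rate age_nonneg[of "Suc p" N] p by (intro mult_left_mono) auto
    finally have c: "(q p)\<^sup>2 / 8 \<le> (norm \<Gamma>)\<^sup>2 * ?Cw ^ 4 * ?g * (?g * ?e)"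
      using zero_le_power2[of "q p"] by linarith
    show "norm (- ?y) powr (2 + \<eta>) * K + \<bar>(- ?y) \<bullet> (second_moment M H X \<theta>s *v (- ?y)) - q p\<bar> / 2 + (q p)\<^sup>2 / 8 \<le>
      ?g * ?e * (?Cw powr (2 + \<eta>) * K * ?g powr (\<eta> / 2) + (norm \<Gamma>)\<^sup>2 * ?Cw ^ 4 * ?g) +
      norm (second_moment M H X \<theta>s - \<Gamma>) * ?Cw\<^sup>2 * (?g * ?e)"
      by (rule order_trans[OF add_mono[OF add_mono[OF a b] c]]) (simp add: algebra_simps)
  qed
  also have "\<dots> = lindeberg v N + norm (second_moment M H X \<theta>s - \<Gamma>) * ?Cw\<^sup>2 * (\<Sum>k=1..N. g k * exp (- (2 * rate) * age N k))"
    unfolding lindeberg_def One_nat_def sum.atLeast1_atMost_eq sum.distrib sum_distrib_left ..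
  also have "\<dots> \<le> lindeberg v N + norm (second_moment M H X \<theta>s - \<Gamma>) * ?Cw\<^sup>2 * weight_bound (2 * rate)"
    using rate by (intro add_left_mono mult_left_mono weights_le) auto
  finally have bound2: "cmod ((CLINT \<omega>|M. iexp (G \<omega>)) - complex_of_real (exp (- (\<Sum>p<N. q p) / 2))) \<le>
     lindeberg v N + norm (second_moment M H X \<theta>s - \<Gamma>) * (?Cw\<^sup>2 * weight_bound (2 * rate))"
    by (simp only: mult.assoc)
  have sumq: "(\<Sum>k=1..N. (g k *\<^sub>R ?w k) \<bullet> (\<Gamma> *v (g k *\<^sub>R ?w k))) = (\<Sum>p<N. q p)"
    unfolding One_nat_def sum.atLeast1_atMost_eq q_def ..
  have Z: "(CLINT \<omega>|M. iexp ((v \<bullet> (sa_scheme \<gamma> H \<theta>0 V N \<omega> - \<theta>s)) / sqrt (g N))) = (CLINT \<omega>|M. iexp (Z \<omega>))"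
    unfolding Z_def weight_end ..
  show ?thesis
    unfolding Z sumq using bound1 bound2 norm_triangle_ineq[of
      "(CLINT \<omega>|M. iexp (Z \<omega>)) - (CLINT \<omega>|M. iexp (G \<omega>))"
      "(CLINT \<omega>|M. iexp (G \<omega>)) - complex_of_real (exp (- (\<Sum>p<N. q p) / 2))"]
    by simp
qed

end

section \<open>The central limit theorem\<close>

lemma prob_space_gaussian: "prob_space (gaussian c \<Sigma>)"
  unfolding gaussian_def gaussian_image_def
proof (rule prob_space.prob_space_distr[OF prob_space_PiM measurable_gaussian_image])
  show "prob_space std_normal_distribution" by (rule prob_space_normal_density) simp
qed

lemma sets_gaussian: "sets (gaussian c \<Sigma>) = sets borel"
  by (simp add: gaussian_def gaussian_image_def)

context sa_rates
begin

text \<open>The rescaled error splits into a deterministic bias \<open>c n\<close> and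
  \<open>\<rho> n *\<^sub>R Z n\<close>, with \<open>\<rho> n\<close> tending to 1 and the
  characteristic function of \<open>Z n\<close> given by \<open>char_bound\<close>. Second moments
  supply tightness.\<close>

theorem conv_in_law_gaussian:
  fixes M :: "'w measure" and H :: "real ^ 'd \<Rightarrow> real ^ 'q \<Rightarrow> real ^ 'd"
    and \<theta>s :: "nat \<Rightarrow> real ^ 'd" and \<tau> \<mu> :: "real ^ 'd" and r \<epsilon> :: "nat \<Rightarrow> real" and N :: "nat \<Rightarrow> nat"
  assumes chain: "\<And>n. sa_contraction M H (X n) (V n) (\<theta>0 n) (h n) (\<theta>s n) lam C0 Cb b"
    and init: "\<And>n. (\<integral>\<omega>. (norm (\<theta>0 n \<omega> - \<theta>s n))\<^sup>2 \<partial>M) \<le> u0"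
    and drift: "\<And>n x. norm (h n x - A *v (x - \<theta>s n)) \<le> \<epsilon> n * norm (x - \<theta>s n) + L * (norm (x - \<theta>s n))\<^sup>2"
    and \<epsilon>: "\<And>n. \<epsilon> n \<ge> 0" "\<epsilon> \<longlonglongrightarrow> 0"
    and moment: "\<And>n. integrable M (\<lambda>\<omega>. norm (H (\<theta>s n) (X n \<omega>)) powr (2 + \<eta>))"
      "\<And>n. (\<integral>\<omega>. norm (H (\<theta>s n) (X n \<omega>)) powr (2 + \<eta>) \<partial>M) \<le> K"
    and cov: "(\<lambda>n. second_moment M H (X n) (\<theta>s n)) \<longlonglongrightarrow> \<Gamma>"
    and N: "filterlim N at_top sequentially"
    and r: "\<And>n. r n \<ge> 0" "(\<lambda>n. (r n)\<^sup>2 * g (N n)) \<longlonglongrightarrow> 1"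
    and \<mu>: "(\<lambda>n. r n *\<^sub>R (\<theta>s n - \<tau>)) \<longlonglongrightarrow> \<mu>"
  shows "conv_in_law (\<lambda>n. distr M borel (\<lambda>\<omega>. r n *\<^sub>R (sa_scheme \<gamma> H (\<theta>0 n) (V n) (N n) \<omega> - \<tau>)))
    (gaussian \<mu> (asymptotic_covariance A \<Gamma> \<zeta>))"
proof -
  define \<Sigma> where "\<Sigma> = asymptotic_covariance A \<Gamma> \<zeta>"
  interpret M: prob_space M using chain[of 0] by (simp add: sa_contraction_def sa_chain_def)
  define T where "T n = sa_scheme \<gamma> H (\<theta>0 n) (V n) (N n)" for n
  define \<rho> where "\<rho> n = r n * sqrt (g (N n))" for n
  define Z where "Z n \<omega> = (1 / sqrt (g (N n))) *\<^sub>R (T n \<omega> - \<theta>s n)" for n \<omega>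
  define c where "c n = r n *\<^sub>R (\<theta>s n - \<tau>)" for n
  define Y where "Y n \<omega> = r n *\<^sub>R (T n \<omega> - \<tau>)" for n \<omega>
  have Y: "Y n \<omega> = c n + \<rho> n *\<^sub>R Z n \<omega>" for n \<omega>
    using g_pos[of "N n"] by (simp add: Y_def c_def \<rho>_def Z_def scaleR_right_diff_distrib)
  have T_meas [measurable]: "T n \<in> borel_measurable M" for n
  proof -
    interpret S: sa_contraction M H "X n" "V n" "\<theta>0 n" \<gamma> "h n" "\<theta>s n" lam C0 Cb b by (rule chain)
    show ?thesis unfolding T_def by (rule S.\<theta>_measurable)
  qed
  have Z_meas [measurable]: "Z n \<in> borel_measurable M" for n unfolding Z_def by measurable
  have Y_meas [measurable]: "Y n \<in> borel_measurable M" for n unfolding Y_def by measurable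
  have Z2: "integrable M (\<lambda>\<omega>. (norm (Z n \<omega>))\<^sup>2)" "M.expectation (\<lambda>\<omega>. (norm (Z n \<omega>))\<^sup>2) \<le> moment_const" for n
  proof -
    interpret S: sa_contraction M H "X n" "V n" "\<theta>0 n" \<gamma> "h n" "\<theta>s n" lam C0 Cb b by (rule chain)
    have eq: "(norm (Z n \<omega>))\<^sup>2 = (norm (T n \<omega> - \<theta>s n))\<^sup>2 / g (N n)" for \<omega>
      using g_pos[of "N n"] by (simp add: Z_def power_divide)
    show "integrable M (\<lambda>\<omega>. (norm (Z n \<omega>))\<^sup>2)"
      unfolding eq using S.\<delta>_L2[of "N n"] by (simp add: T_def)
    have "M.expectation (\<lambda>\<omega>. (norm (Z n \<omega>))\<^sup>2) = M.expectation (\<lambda>\<omega>. (norm (T n \<omega> - \<theta>s n))\<^sup>2) / g (N n)"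
      unfolding eq by simp
    also have "\<dots> \<le> (moment_const * g (Suc (N n))) / g (N n)"
      unfolding T_def using g_pos[of "N n"] by (intro divide_right_mono moment_bound[OF chain init]) auto
    also have "\<dots> \<le> (moment_const * g (N n)) / g (N n)"
      using g_pos[of "N n"] g_antimono[of "N n" "Suc (N n)"] moment_const(1) by (intro divide_right_mono mult_left_mono) auto
    finally show "M.expectation (\<lambda>\<omega>. (norm (Z n \<omega>))\<^sup>2) \<le> moment_const" using g_pos[of "N n"] by simp
  qed
  have \<rho>: "\<rho> \<longlonglongrightarrow> 1"
  proof -
    have "(\<lambda>n. sqrt ((r n)\<^sup>2 * g (N n))) \<longlonglongrightarrow> sqrt 1" using r(2) by (rule tendsto_real_sqrt)
    moreover have "sqrt ((r n)\<^sup>2 * g (N n)) = \<rho> n" for n using r(1)[of n] by (simp add: real_sqrt_mult \<rho>_def)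
    ultimately show ?thesis by simp
  qed
  have psd\<Sigma>: "psd \<Sigma>" unfolding \<Sigma>_def by (rule psd_asymptotic_covariance[OF A rates(3) \<Gamma>])
  have char_Z: "(\<lambda>n. CLINT \<omega>|M. iexp (v \<bullet> Z n \<omega>)) \<longlonglongrightarrow> complex_of_real (exp (- (v \<bullet> (\<Sigma> *v v)) / 2))" for v
  proof -
    define s where "s N = (\<Sum>k=1..N. (g k *\<^sub>R weight v N k) \<bullet> (\<Gamma> *v (g k *\<^sub>R weight v N k)))" for N
    define B where "B n = bias v (N n) + \<epsilon> n * (weight_const v * sqrt moment_const * weight_bound rate) + lindeberg v (N n) +
      norm (second_moment M H (X n) (\<theta>s n) - \<Gamma>) * ((weight_const v)\<^sup>2 * weight_bound (2 * rate))" for n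
    have "(\<lambda>n. norm (second_moment M H (X n) (\<theta>s n) - \<Gamma>)) \<longlonglongrightarrow> 0"
      using tendsto_norm[OF tendsto_diff[OF cov tendsto_const[of \<Gamma>]]] by simp
    then have "B \<longlonglongrightarrow> 0"
      unfolding B_def[abs_def]
      by (intro tendsto_add_zero tendsto_mult_left_zero \<epsilon>(2) filterlim_compose[OF bias_tendsto N]
        filterlim_compose[OF lindeberg_tendsto N])
    have "(\<lambda>n. (CLINT \<omega>|M. iexp (v \<bullet> Z n \<omega>)) - complex_of_real (exp (- s (N n) / 2))) \<longlonglongrightarrow> 0"
    proof (rule Lim_null_comparison[OF always_eventually \<open>B \<longlonglongrightarrow> 0\<close>], rule allI)
      fix n
      have "v \<bullet> Z n \<omega> = (v \<bullet> (sa_scheme \<gamma> H (\<theta>0 n) (V n) (N n) \<omega> - \<theta>s n)) / sqrt (g (N n))" for \<omega>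
        by (simp add: Z_def T_def)
      then show "cmod ((CLINT \<omega>|M. iexp (v \<bullet> Z n \<omega>)) - complex_of_real (exp (- s (N n) / 2))) \<le> B n"
        using char_bound[OF chain init drift \<epsilon>(1) moment, of v n "N n"] unfolding s_def B_def by (simp only:)
    qed
    moreover have "(\<lambda>n. s (N n)) \<longlonglongrightarrow> v \<bullet> (\<Sigma> *v v)"
      using filterlim_compose[OF variance_tendsto[of v] N] unfolding s_def \<Sigma>_def .
    then have "(\<lambda>n. complex_of_real (exp (- s (N n) / 2))) \<longlonglongrightarrow> complex_of_real (exp (- (v \<bullet> (\<Sigma> *v v)) / 2))"
      by (intro tendsto_intros) auto
    ultimately show ?thesis using tendsto_add by fastforce
  qed
  have char_Y: "(\<lambda>n. CLINT \<omega>|M. iexp (v \<bullet> Y n \<omega>)) \<longlonglongrightarrow> iexp (v \<bullet> \<mu>) * complex_of_real (exp (- (v \<bullet> (\<Sigma> *v v)) / 2))" for v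
  proof -
    \<comment> \<open>Slutsky's step: \<open>Z n\<close> is bounded in mean, so the factor
      \<open>\<rho> n\<close> may be dropped.\<close>
    have "(\<lambda>n. (CLINT \<omega>|M. iexp (v \<bullet> (\<rho> n *\<^sub>R Z n \<omega>))) - (CLINT \<omega>|M. iexp (v \<bullet> Z n \<omega>))) \<longlonglongrightarrow> 0"
    proof (rule Lim_null_comparison)
      show "(\<lambda>n. \<bar>\<rho> n - 1\<bar> * (norm v * sqrt moment_const)) \<longlonglongrightarrow> 0"
        using tendsto_rabs[OF tendsto_diff[OF \<rho> tendsto_const[of 1]]] by (intro tendsto_mult_left_zero) simp
      show "\<forall>\<^sub>F n in sequentially. cmod ((CLINT \<omega>|M. iexp (v \<bullet> (\<rho> n *\<^sub>R Z n \<omega>))) - (CLINT \<omega>|M. iexp (v \<bullet> Z n \<omega>)))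
         \<le> \<bar>\<rho> n - 1\<bar> * (norm v * sqrt moment_const)"
      proof (rule always_eventually, rule allI)
        fix n
        have Zn: "integrable M (\<lambda>\<omega>. norm (Z n \<omega>))" "integrable M (Z n)"
          using M.integrable_norm_of_square[OF Z_meas Z2(1)] by auto
        have "v \<bullet> (\<rho> n *\<^sub>R Z n \<omega>) - v \<bullet> Z n \<omega> = (\<rho> n - 1) * (v \<bullet> Z n \<omega>)" for \<omega>
          by (simp add: algebra_simps)
        then have "cmod ((CLINT \<omega>|M. iexp (v \<bullet> (\<rho> n *\<^sub>R Z n \<omega>))) - (CLINT \<omega>|M. iexp (v \<bullet> Z n \<omega>)))
           \<le> M.expectation (\<lambda>\<omega>. \<bar>(\<rho> n - 1) * (v \<bullet> Z n \<omega>)\<bar>)"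
          using M.cmod_char_diff_le[of "\<lambda>\<omega>. v \<bullet> (\<rho> n *\<^sub>R Z n \<omega>)" "\<lambda>\<omega>. v \<bullet> Z n \<omega>"] Zn(2) by simp
        also have "\<dots> \<le> M.expectation (\<lambda>\<omega>. \<bar>\<rho> n - 1\<bar> * (norm v * norm (Z n \<omega>)))"
          using Zn by (intro integral_mono) (auto simp: abs_mult intro!: mult_left_mono Cauchy_Schwarz_ineq2)
        also have "\<dots> = \<bar>\<rho> n - 1\<bar> * (norm v * M.expectation (\<lambda>\<omega>. norm (Z n \<omega>)))" by simp
        also have "\<dots> \<le> \<bar>\<rho> n - 1\<bar> * (norm v * sqrt moment_const)"
        proof (intro mult_left_mono)
          have "M.expectation (\<lambda>\<omega>. \<bar>norm (Z n \<omega>)\<bar>) \<le> sqrt (M.expectation (\<lambda>\<omega>. (norm (Z n \<omega>))\<^sup>2))"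
            by (rule M.expectation_le_sqrt) (use Z2(1) in auto)
          also have "\<dots> \<le> sqrt moment_const" using Z2(2) by simp
          finally show "M.expectation (\<lambda>\<omega>. norm (Z n \<omega>)) \<le> sqrt moment_const" by simp
        qed auto
        finally show "cmod ((CLINT \<omega>|M. iexp (v \<bullet> (\<rho> n *\<^sub>R Z n \<omega>))) - (CLINT \<omega>|M. iexp (v \<bullet> Z n \<omega>)))
         \<le> \<bar>\<rho> n - 1\<bar> * (norm v * sqrt moment_const)" .
      qed
    qed
    from tendsto_add[OF this char_Z[of v]]
    have "(\<lambda>n. CLINT \<omega>|M. iexp (v \<bullet> (\<rho> n *\<^sub>R Z n \<omega>))) \<longlonglongrightarrow> complex_of_real (exp (- (v \<bullet> (\<Sigma> *v v)) / 2))"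
      by simp
    moreover have "(\<lambda>n. iexp (v \<bullet> c n)) \<longlonglongrightarrow> iexp (v \<bullet> \<mu>)"
      using \<mu> unfolding c_def by (intro tendsto_intros)
    ultimately have "(\<lambda>n. iexp (v \<bullet> c n) * (CLINT \<omega>|M. iexp (v \<bullet> (\<rho> n *\<^sub>R Z n \<omega>)))) \<longlonglongrightarrow>
        iexp (v \<bullet> \<mu>) * complex_of_real (exp (- (v \<bullet> (\<Sigma> *v v)) / 2))"
      by (intro tendsto_mult)
    moreover have "(CLINT \<omega>|M. iexp (v \<bullet> Y n \<omega>)) = iexp (v \<bullet> c n) * (CLINT \<omega>|M. iexp (v \<bullet> (\<rho> n *\<^sub>R Z n \<omega>)))" for n
      unfolding integral_mult_right_zero[symmetric] Y
      by (intro Bochner_Integration.integral_cong refl) (simp add: inner_add_right distrib_left exp_add)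
    ultimately show ?thesis by simp
  qed
  have "conv_in_law (\<lambda>n. distr M borel (Y n)) (gaussian \<mu> \<Sigma>)"
  proof (rule conv_in_law_char)
    show "prob_space (distr M borel (Y n))" for n by (rule M.prob_space_distr) simp
    show "prob_space (gaussian \<mu> \<Sigma>)" by (rule prob_space_gaussian)
    show "sets (gaussian \<mu> \<Sigma>) = sets borel" by (rule sets_gaussian)
    fix v
    have "(CLINT x|distr M borel (Y n). iexp (v \<bullet> x)) = (CLINT \<omega>|M. iexp (v \<bullet> Y n \<omega>))" for n
      by (rule integral_distr) auto
    then show "(\<lambda>n. CLINT x|distr M borel (Y n). iexp (v \<bullet> x)) \<longlonglongrightarrow> (CLINT x|gaussian \<mu> \<Sigma>. iexp (v \<bullet> x))"
      using char_Y[of v] gaussian_char[OF psd_factorization[OF psd\<Sigma>], of \<mu> v] by (simp only:)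
  next
    fix e :: real assume "e > 0"
    \<comment> \<open>Bounds the second moment of \<open>Y n\<close> once
      \<open>norm (c n) < norm \<mu> + 1\<close> and \<open>\<bar>\<rho> n\<bar> < 2\<close>;
      Markov's inequality then yields tightness with radius \<open>R\<close>.\<close>
    define Q where "Q = 2 * (norm \<mu> + 1)\<^sup>2 + 2 * 4 * moment_const"
    define R where "R = sqrt (Q / e) + 1"
    have "Q > 0" using moment_const(1) by (simp add: Q_def add_nonneg_pos)
    then have R: "R > 0" "Q \<le> e * R\<^sup>2"
    proof -
      show "R > 0" using \<open>Q > 0\<close> \<open>e > 0\<close> by (simp add: R_def add_nonneg_pos)
      have "(sqrt (Q / e))\<^sup>2 \<le> R\<^sup>2" using \<open>Q > 0\<close> \<open>e > 0\<close> unfolding R_def by (intro power_mono) auto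
      then have "Q / e \<le> R\<^sup>2" using \<open>Q > 0\<close> \<open>e > 0\<close> by simp
      then show "Q \<le> e * R\<^sup>2" using \<open>e > 0\<close> by (simp add: field_simps)
    qed
    have "\<forall>\<^sub>F n in sequentially. norm (c n) < norm \<mu> + 1"
      using tendsto_norm[OF \<mu>] unfolding c_def by (intro order_tendstoD(2)) auto
    moreover have "\<forall>\<^sub>F n in sequentially. \<bar>\<rho> n\<bar> < 2"
      using tendsto_rabs[OF \<rho>] by (intro order_tendstoD(2)) auto
    ultimately have "\<forall>\<^sub>F n in sequentially. measure (distr M borel (Y n)) {x. norm x > R} \<le> e"
    proof eventually_elim
      case (elim n)
      have le: "(norm (Y n \<omega>))\<^sup>2 \<le> 2 * (norm \<mu> + 1)\<^sup>2 + 2 * 4 * (norm (Z n \<omega>))\<^sup>2" for \<omega>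
      proof -
        have "(norm (Y n \<omega>))\<^sup>2 \<le> 2 * (norm (c n))\<^sup>2 + 2 * (norm (\<rho> n *\<^sub>R Z n \<omega>))\<^sup>2"
          unfolding Y using norm_diff_square_le[of "c n" "- (\<rho> n *\<^sub>R Z n \<omega>)"] by simp
        also have "(norm (c n))\<^sup>2 \<le> (norm \<mu> + 1)\<^sup>2" using elim(1) by (intro power_mono) auto
        also have "(norm (\<rho> n *\<^sub>R Z n \<omega>))\<^sup>2 \<le> 4 * (norm (Z n \<omega>))\<^sup>2"
        proof -
          have "\<bar>\<rho> n\<bar>\<^sup>2 \<le> 2\<^sup>2" using elim(2) by (intro power_mono) auto
          then show ?thesis by (simp add: power_mult_distrib mult_right_mono)
        qed
        finally show ?thesis by simp
      qed
      have int: "integrable M (\<lambda>\<omega>. 2 * (norm \<mu> + 1)\<^sup>2 + 2 * 4 * (norm (Z n \<omega>))\<^sup>2)" using Z2(1)[of n] by simp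
      have Y2: "integrable M (\<lambda>\<omega>. (norm (Y n \<omega>))\<^sup>2)"
        by (rule Bochner_Integration.integrable_bound[OF int]) (use le in auto)
      have "M.expectation (\<lambda>\<omega>. (norm (Y n \<omega>))\<^sup>2) \<le> M.expectation (\<lambda>\<omega>. 2 * (norm \<mu> + 1)\<^sup>2 + 2 * 4 * (norm (Z n \<omega>))\<^sup>2)"
        by (intro integral_mono Y2 int le)
      also have "\<dots> \<le> Q" using Z2[of n] by (simp add: Q_def M.prob_space)
      finally have EY: "M.expectation (\<lambda>\<omega>. (norm (Y n \<omega>))\<^sup>2) \<le> Q" .
      have "measure (distr M borel (Y n)) {x. norm x > R} = M.prob {\<omega> \<in> space M. norm (Y n \<omega>) > R}"
        by (subst measure_distr) (auto intro!: arg_cong[of _ _ M.prob])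
      also have "\<dots> \<le> M.prob {\<omega> \<in> space M. R\<^sup>2 \<le> (norm (Y n \<omega>))\<^sup>2}"
        using R(1) by (intro M.finite_measure_mono) (auto intro!: power_mono)
      also have "\<dots> \<le> M.expectation (\<lambda>\<omega>. (norm (Y n \<omega>))\<^sup>2) / R\<^sup>2"
        using R(1) by (intro integral_Markov_inequality_measure[OF Y2]) auto
      also have "\<dots> \<le> e" using EY R by (simp add: field_simps)
      finally show ?case .
    qed
    then show "\<exists>R. \<forall>\<^sub>F n in sequentially. measure (distr M borel (Y n)) {x. norm x > R} \<le> e" by blast
  qed simp
  then show ?thesis unfolding Y_def T_def \<Sigma>_def .
qed

end

section \<open>Linearisation of the mean field\<close>

text \<open>The mean value inequality for \<open>f\<close> minus its linear part at
  \<open>y\<close>, on the ball around \<open>y\<close> with \<open>x\<close> on its boundary, where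
  the Jacobian varies by at most \<open>L * norm (x - y)\<close>.\<close>

lemma norm_jacobian_remainder_le:
  fixes f :: "real ^ 'd \<Rightarrow> real ^ 'd"
  assumes diff: "\<And>x. f differentiable (at x)"
    and Lip: "L-lipschitz_on UNIV (\<lambda>x. jacobian f (at x))"
  shows "norm (f x - f y - jacobian f (at y) *v (x - y)) \<le> L * (norm (x - y))\<^sup>2"
proof -
  define J where "J z = jacobian f (at z)" for z
  define F where "F z = f z - J y *v z" for z
  have "norm (F x - F y) \<le> (L * norm (x - y)) * norm (x - y)"
  proof (rule differentiable_bound[where S="cball y (norm (x - y))" and f'="\<lambda>z h. J z *v h - J y *v h"])
    fix z assume z: "z \<in> cball y (norm (x - y))"
    have "(f has_derivative (\<lambda>h. J z *v h)) (at z)"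
      using diff[of z] unfolding jacobian_works J_def .
    then have "(F has_derivative (\<lambda>h. J z *v h - J y *v h)) (at z)"
      unfolding F_def by (intro has_derivative_diff bounded_linear.has_derivative[OF matrix_vector_mul_bounded_linear] has_derivative_ident)
    then show "(F has_derivative (\<lambda>h. J z *v h - J y *v h)) (at z within cball y (norm (x - y)))"
      by (rule has_derivative_at_withinI)
    show "onorm (\<lambda>h. J z *v h - J y *v h) \<le> L * norm (x - y)"
    proof (rule onorm_le)
      fix h
      have "norm (J z *v h - J y *v h) \<le> norm (J z - J y) * norm h"
        unfolding matrix_vector_mult_diff_rdistrib[symmetric] by (rule norm_matrix_vector_mult_le)
      also have "norm (J z - J y) \<le> L * norm (z - y)"
        using lipschitz_onD[OF Lip, of z y] by (simp add: J_def dist_norm)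
      also have "L * norm (z - y) \<le> L * norm (x - y)"
        using z lipschitz_on_nonneg[OF Lip] by (intro mult_left_mono) (auto simp: dist_norm norm_minus_commute)
      finally show "norm (J z *v h - J y *v h) \<le> L * norm (x - y) * norm h" by (simp add: mult_right_mono)
    qed
  qed (auto simp: dist_norm norm_minus_commute)
  moreover have "F x - F y = f x - f y - J y *v (x - y)"
    by (simp add: F_def matrix_vector_mult_diff_distrib)
  ultimately show ?thesis by (simp add: J_def power2_eq_square mult.assoc)
qed

text \<open>Coercivity of \<open>f\<close> at \<open>y + t *\<^sub>R v\<close> is an inequality of
  order t^2 with an error of order t^3; dividing by t^2 and taking \<open>t\<close> small transfers
  it to \<open>J\<close>.\<close>

lemma coercive_linearisation:
  fixes f :: "real ^ 'd \<Rightarrow> real ^ 'd"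
  assumes rem: "\<And>x. norm (f x - J *v (x - y)) \<le> L * (norm (x - y))\<^sup>2"
    and mono: "\<And>x. (x - y) \<bullet> f x \<ge> lam * (norm (x - y))\<^sup>2" and L: "L \<ge> 0"
  shows "v \<bullet> (J *v v) \<ge> lam * (norm v)\<^sup>2"
proof (rule field_le_epsilon)
  fix e :: real assume e: "e > 0"
  \<comment> \<open>Small enough for the cubic error to be at most \<open>e\<close> after division;
    the 1 keeps the denominator positive.\<close>
  define t where "t = e / (L * norm v ^ 3 + 1)"
  have t: "t > 0" "t * (L * norm v ^ 3) \<le> e"
  proof -
    have "0 \<le> L * norm v ^ 3" using L by simp
    then show "t > 0" using e by (simp add: t_def add_nonneg_pos)
    show "t * (L * norm v ^ 3) \<le> e"
      using e \<open>0 \<le> L * norm v ^ 3\<close> unfolding t_def by (simp add: field_simps)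
  qed
  define x where "x = y + t *\<^sub>R v"
  define \<rho> where "\<rho> = f x - J *v (x - y)"
  have xy: "x - y = t *\<^sub>R v" by (simp add: x_def)
  have \<rho>: "norm \<rho> \<le> L * (t\<^sup>2 * (norm v)\<^sup>2)" using rem[of x] t by (simp add: \<rho>_def xy power_mult_distrib)
  have "lam * (t\<^sup>2 * (norm v)\<^sup>2) \<le> t * (v \<bullet> f x)" using mono[of x] t by (simp add: xy power_mult_distrib)
  also have "f x = t *\<^sub>R (J *v v) + \<rho>" by (simp add: \<rho>_def xy matrix_vector_mult_scaleR)
  also have "t * (v \<bullet> (t *\<^sub>R (J *v v) + \<rho>)) = t\<^sup>2 * (v \<bullet> (J *v v)) + t * (v \<bullet> \<rho>)"
    by (simp add: inner_add_right algebra_simps power2_eq_square)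
  also have "v \<bullet> \<rho> \<le> norm v * (L * (t\<^sup>2 * (norm v)\<^sup>2))"
    by (rule order_trans[OF norm_cauchy_schwarz]) (intro mult_left_mono \<rho> norm_ge_zero)
  finally have "lam * (t\<^sup>2 * (norm v)\<^sup>2) \<le> t\<^sup>2 * (v \<bullet> (J *v v)) + t * (norm v * (L * (t\<^sup>2 * (norm v)\<^sup>2)))"
    using t by simp
  then have "t\<^sup>2 * (lam * (norm v)\<^sup>2) \<le> t\<^sup>2 * (v \<bullet> (J *v v) + t * (L * norm v ^ 3))"
    by (simp add: algebra_simps power2_eq_square power3_eq_cube)
  then have "lam * (norm v)\<^sup>2 \<le> v \<bullet> (J *v v) + t * (L * norm v ^ 3)"
    using t(1) by simp
  then show "lam * (norm v)\<^sup>2 \<le> v \<bullet> (J *v v) + e" using t by linarith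
qed

lemma locally_uniform_limit_tendsto:
  assumes "locally_uniform_limit f l F"
  shows "((\<lambda>n. f n x) \<longlongrightarrow> l x) F"
proof -
  obtain r where "r > 0" "uniform_limit (ball x r) f l F"
    using assms unfolding locally_uniform_limit_def by blast
  then show ?thesis by (auto intro: tendsto_uniform_limitI)
qed

text \<open>Young's inequality with a free weight \<open>t\<close> separates the difference from the
  sizes. Choosing \<open>t\<close> small, yet large against the mean squared difference, makes both
  terms vanish.\<close>

lemma norm_expectation_outer_diff_le:
  fixes Y Z :: "'a \<Rightarrow> real ^ 'd"
  assumes [measurable]: "Y \<in> borel_measurable M" "Z \<in> borel_measurable M"
    and int: "integrable M (\<lambda>\<omega>. (norm (Y \<omega>))\<^sup>2)" "integrable M (\<lambda>\<omega>. (norm (Z \<omega>))\<^sup>2)"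
      "integrable M (\<lambda>\<omega>. (norm (Y \<omega> - Z \<omega>))\<^sup>2)"
    and t: "t > 0"
  shows "norm ((\<integral>\<omega>. outer (Y \<omega>) \<partial>M) - (\<integral>\<omega>. outer (Z \<omega>) \<partial>M)) \<le> (real CARD('d))\<^sup>2 *
    ((\<integral>\<omega>. (norm (Y \<omega> - Z \<omega>))\<^sup>2 \<partial>M) / t + 2 * t * ((\<integral>\<omega>. (norm (Y \<omega>))\<^sup>2 \<partial>M) + (\<integral>\<omega>. (norm (Z \<omega>))\<^sup>2 \<partial>M)))"
proof -
  let ?B = "\<lambda>\<omega>. (real CARD('d))\<^sup>2 * ((norm (Y \<omega> - Z \<omega>))\<^sup>2 / t + 2 * t * ((norm (Y \<omega>))\<^sup>2 + (norm (Z \<omega>))\<^sup>2))"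
  have le: "norm (outer y - outer z) \<le> (real CARD('d))\<^sup>2 * ((norm (y - z))\<^sup>2 / t + 2 * t * ((norm y)\<^sup>2 + (norm z)\<^sup>2))"
    for y z :: "real ^ 'd"
  proof (rule order_trans[OF norm_outer_diff_le], rule mult_left_mono)
    define a s where "a = norm (y - z)" and "s = norm y + norm z"
    have "0 \<le> (a / sqrt t - sqrt t * s)\<^sup>2 + (a / sqrt t)\<^sup>2 + (sqrt t * s)\<^sup>2" by simp
    then have "2 * (a * s) \<le> 2 * (a\<^sup>2 / t + t * s\<^sup>2)"
      using t by (simp add: power2_diff power_divide power_mult_distrib)
    moreover have "t * s\<^sup>2 \<le> t * (2 * ((norm y)\<^sup>2 + (norm z)\<^sup>2))"
      using t sum_squares_bound[of "norm y" "norm z"] by (intro mult_left_mono) (auto simp: s_def power2_sum)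
    ultimately show "norm (y - z) * (norm y + norm z) \<le> (norm (y - z))\<^sup>2 / t + 2 * t * ((norm y)\<^sup>2 + (norm z)\<^sup>2)"
      unfolding a_def[symmetric] s_def[symmetric] by (simp add: mult_ac)
  qed simp
  have B: "integrable M ?B" using int by simp
  have oi: "integrable M (\<lambda>\<omega>. outer (Y \<omega>))" "integrable M (\<lambda>\<omega>. outer (Z \<omega>))"
    using int by (auto intro: integrable_outer)
  have "norm ((\<integral>\<omega>. outer (Y \<omega>) \<partial>M) - (\<integral>\<omega>. outer (Z \<omega>) \<partial>M)) = norm (\<integral>\<omega>. outer (Y \<omega>) - outer (Z \<omega>) \<partial>M)"
    using oi by simp
  also have "\<dots> \<le> (\<integral>\<omega>. norm (outer (Y \<omega>) - outer (Z \<omega>)) \<partial>M)" by (rule integral_norm_bound)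
  also have "\<dots> \<le> (\<integral>\<omega>. ?B \<omega> \<partial>M)" using oi B le by (intro integral_mono) auto
  finally show ?thesis using int by simp
qed

lemma nn_integral_le_one_plus:
  fixes f f' :: "'a \<Rightarrow> real"
  assumes "prob_space M" and [measurable]: "f \<in> borel_measurable M" and f: "\<And>x. f x \<ge> 0"
    and f': "\<And>x. f' x \<le> 1 + f x"
    and le: "(\<integral>\<^sup>+x. ennreal (f x) \<partial>M) \<le> ennreal K" and K: "K \<ge> 0"
  shows "(\<integral>\<^sup>+x. ennreal (f' x) \<partial>M) \<le> ennreal (1 + K)"
proof -
  interpret prob_space M by fact
  have "(\<integral>\<^sup>+x. ennreal (f' x) \<partial>M) \<le> (\<integral>\<^sup>+x. 1 + ennreal (f x) \<partial>M)"
  proof (rule nn_integral_mono)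
    fix x
    have "ennreal (f' x) \<le> ennreal (1 + f x)" by (rule ennreal_leI[OF f'])
    then show "ennreal (f' x) \<le> 1 + ennreal (f x)" using f[of x] by (simp add: ennreal_plus)
  qed
  also have "\<dots> = 1 + (\<integral>\<^sup>+x. ennreal (f x) \<partial>M)"
    by (subst nn_integral_add) (auto simp: emeasure_space_1)
  also have "\<dots> \<le> 1 + ennreal K" using le by (rule add_left_mono)
  also have "\<dots> = ennreal (1 + K)" using K by (simp add: ennreal_plus)
  finally show ?thesis .
qed

lemma powr_le_one_plus_powr: "x powr a \<le> 1 + x powr b" if "x \<ge> 0" "0 \<le> a" "a \<le> b" for x a b :: real
proof (cases "x \<le> 1")
  case True
  then have "x powr a \<le> 1" using that by (intro powr_le1) auto
  then show ?thesis using powr_ge_zero[of x b] by linarith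
next
  case False
  then have "x powr a \<le> x powr b" using that by (intro powr_mono) auto
  then show ?thesis by simp
qed

lemma conv_in_law_SucD:
  assumes "conv_in_law (\<lambda>n. \<mu> (Suc n)) \<nu>"
  shows "conv_in_law \<mu> \<nu>"
  unfolding conv_in_law_def
proof (intro allI impI)
  fix f :: "'a \<Rightarrow> real" assume "continuous_on UNIV f" "bounded (range f)"
  then have "(\<lambda>n. \<integral>x. f x \<partial>\<mu> (Suc n)) \<longlonglongrightarrow> (\<integral>x. f x \<partial>\<nu>)"
    using assms unfolding conv_in_law_def by blast
  then show "(\<lambda>n. \<integral>x. f x \<partial>\<mu> n) \<longlonglongrightarrow> (\<integral>x. f x \<partial>\<nu>)" by (rule LIMSEQ_imp_Suc)
qed

theorem theorem2p7:
  fixes M :: "'w measure"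
    and H :: "real ^ 'd \<Rightarrow> real ^ 'q \<Rightarrow> real ^ 'd"
    and U :: "'w \<Rightarrow> real ^ 'q" and Useq :: "nat \<Rightarrow> 'w \<Rightarrow> real ^ 'q"
    and V :: "nat \<Rightarrow> nat \<Rightarrow> 'w \<Rightarrow> real ^ 'q"
    and \<theta>0 :: "nat \<Rightarrow> 'w \<Rightarrow> real ^ 'd"
    and h :: "real ^ 'd \<Rightarrow> real ^ 'd" and hn :: "nat \<Rightarrow> real ^ 'd \<Rightarrow> real ^ 'd"
    and \<theta>s :: "real ^ 'd" and \<theta>sn :: "nat \<Rightarrow> real ^ 'd"
    and \<gamma> :: "real \<Rightarrow> real" and \<alpha> lam \<zeta> :: real
  assumes M: "prob_space M"
    and H_borel: "(\<lambda>(\<theta>, u). H \<theta> u) \<in> borel_measurable borel"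
    and U: "U \<in> borel_measurable M"
    and Useq: "\<And>n. n \<ge> 1 \<Longrightarrow> Useq n \<in> borel_measurable M"
    and h: "h = mean_field M H U"
    and hn: "\<And>n. n \<ge> 1 \<Longrightarrow> hn n = mean_field M H (Useq n)"
    and zero_h: "h \<theta>s = 0" "\<And>\<theta>. h \<theta> = 0 \<Longrightarrow> \<theta> = \<theta>s"
    and zero_hn: "\<And>n. n \<ge> 1 \<Longrightarrow> hn n (\<theta>sn n) = 0"
      "\<And>n \<theta>. n \<ge> 1 \<Longrightarrow> hn n \<theta> = 0 \<Longrightarrow> \<theta> = \<theta>sn n"
    \<comment> \<open>innovations \<open>V n p\<close>, \<open>p \<ge> 1\<close>, and starting points\<close>
    and V_indep: "\<And>n. n \<ge> 1 \<Longrightarrow> prob_space.indep_vars M (\<lambda>_. borel) (V n) {1..}"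
    and V_law: "\<And>n p. n \<ge> 1 \<Longrightarrow> p \<ge> 1 \<Longrightarrow> distr M borel (V n p) = distr M borel (Useq n)"
    and \<theta>0: "\<And>n. n \<ge> 1 \<Longrightarrow> \<theta>0 n \<in> borel_measurable M"
    and \<theta>0_indep: "\<And>n. n \<ge> 1 \<Longrightarrow>
      indep_rvs M borel (\<theta>0 n) (\<Pi>\<^sub>M p\<in>{1..}. borel) (\<lambda>\<omega>. \<lambda>p\<in>{1..}. V n p \<omega>)"
    and \<theta>0_L2: "(SUP n\<in>{1..}. \<integral>\<^sup>+\<omega>. ennreal ((norm (\<theta>0 n \<omega>))\<^sup>2) \<partial>M) < \<infinity>"
    and \<alpha>: "\<alpha> > 0"
    \<comment> \<open>(i)\<close>
    and i_C1: "C1_on UNIV h" "\<And>n. n \<ge> 1 \<Longrightarrow> C1_on UNIV (hn n)"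
    and i_mean_rev: "\<And>\<theta>. \<theta> \<noteq> \<theta>s \<Longrightarrow> (\<theta> - \<theta>s) \<bullet> h \<theta> > 0"
      "\<And>n \<theta>. n \<ge> 1 \<Longrightarrow> \<theta> \<noteq> \<theta>sn n \<Longrightarrow> (\<theta> - \<theta>sn n) \<bullet> hn n \<theta> > 0"
    and i_conv: "locally_uniform_limit hn h sequentially"
      "locally_uniform_limit (\<lambda>n \<theta>. jacobian (hn n) (at \<theta>)) (\<lambda>\<theta>. jacobian h (at \<theta>)) sequentially"
    and i_nonsing: "invertible (jacobian h (at \<theta>s))"
    and i_error: "\<And>\<theta>. convergent (\<lambda>n. (real n powr \<alpha>) *\<^sub>R (hn n \<theta> - h \<theta>))"
    \<comment> \<open>(ii)\<close>
    and ii_C2: "\<exists>S. open S \<and> \<theta>s \<in> S \<and> C2_on S h"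
    and ii_eigen: "\<And>z. complex_eigenvalue (jacobian h (at \<theta>s)) z \<Longrightarrow> Re z > 0"
    and ii_cont: "continuous_on UNIV (second_moment M H U)"
    and ii_moment: "\<exists>\<epsilon>>0. locally_bounded
      (\<lambda>\<theta>. \<integral>\<^sup>+\<omega>. ennreal (norm (H \<theta> (U \<omega>)) powr (2 + \<epsilon>)) \<partial>M)"
    and ii_posdef: "positive_definite (second_moment M H U \<theta>s)"
    \<comment> \<open>(iii)\<close>
    and iii: "\<exists>b. 0 < b \<and> b \<le> 1 \<and>
      (SUP n\<in>{1..}. SUP (\<theta>, \<theta>')\<in>{(\<theta>, \<theta>'). \<theta> \<noteq> \<theta>'}.
         (\<integral>\<^sup>+\<omega>. ennreal ((norm (H \<theta> (Useq n \<omega>) - H \<theta>' (Useq n \<omega>)))\<^sup>2) \<partial>M)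
           / ennreal (norm (\<theta> - \<theta>') powr (2 * b))) < \<infinity>"
    \<comment> \<open>(iv)\<close>
    and iv_moment: "\<exists>\<eta>>0. \<forall>R>0. (SUP n\<in>{1..}. SUP \<theta>\<in>cball 0 R.
         \<integral>\<^sup>+\<omega>. ennreal (norm (H \<theta> (Useq n \<omega>)) powr (2 + \<eta>)) \<partial>M) < \<infinity>"
    and iv_conv: "locally_uniform_limit
      (\<lambda>n. second_moment M H (Useq n)) (second_moment M H U) sequentially"
    \<comment> \<open>(v)\<close>
    and v: "lam > 0" "\<And>n \<theta>. n \<ge> 1 \<Longrightarrow> (\<theta> - \<theta>sn n) \<bullet> hn n \<theta> \<ge> lam * (norm (\<theta> - \<theta>sn n))\<^sup>2"
    \<comment> \<open>(vi)\<close>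
    and vi_C2: "\<And>n. n \<ge> 1 \<Longrightarrow> C2_on UNIV (hn n)"
    and vi_Lip: "\<exists>L. \<forall>n\<ge>1. L-lipschitz_on UNIV (\<lambda>\<theta>. jacobian (hn n) (at \<theta>))"
    \<comment> \<open>(vii)\<close>
    and vii_pos: "\<And>t. t \<ge> 0 \<Longrightarrow> \<gamma> t > 0"
    and vii_decr: "antimono_on {0..} \<gamma>" "(\<gamma> \<longlongrightarrow> 0) at_top"
    and vii_HS: "(\<exists>a. 0 \<le> a \<and> a < 1 \<and> regularly_varying \<gamma> (- a) \<and> \<zeta> = 0) \<or>
      (\<exists>\<gamma>0. (\<forall>t\<ge>1. \<gamma> t = \<gamma>0 / t) \<and> 2 * lam * \<gamma>0 > 1 \<and> \<zeta> = 1 / (2 * \<gamma>0))"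
  shows "conv_in_law
    (\<lambda>n. distr M borel (\<lambda>\<omega>. (real n powr \<alpha>) *\<^sub>R
       (sa_scheme \<gamma> H (\<theta>0 n) (V n) (nat \<lfloor>decreasing_inverse \<gamma> (1 / real n powr (2 * \<alpha>))\<rfloor>) \<omega> - \<theta>s)))
    (gaussian
       (- (matrix_inv (jacobian h (at \<theta>s)) *v discretization_error hn h \<alpha> \<theta>s))
       (asymptotic_covariance (jacobian h (at \<theta>s)) (second_moment M H U \<theta>s) \<zeta>))"
proof -
  interpret M: prob_space M by (rule M)
  define A where "A = jacobian h (at \<theta>s)"
  define \<Gamma> where "\<Gamma> = second_moment M H U \<theta>s"
  define J where "J n = jacobian (hn n) (at (\<theta>sn n))" for n

  \<comment> \<open>Second-order remainders of the mean fields\<close>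
  obtain L where L: "\<And>n. n \<ge> 1 \<Longrightarrow> L-lipschitz_on UNIV (\<lambda>\<theta>. jacobian (hn n) (at \<theta>))"
    using vi_Lip by blast
  have L0: "L \<ge> 0" using lipschitz_on_nonneg[OF L[of 1]] by simp
  have diff: "hn n differentiable (at x)" if "n \<ge> 1" for n x
    using i_C1(2)[OF that] unfolding C1_on_def differentiable_def by blast
  have remainder: "norm (hn n x - J n *v (x - \<theta>sn n)) \<le> L * (norm (x - \<theta>sn n))\<^sup>2" if "n \<ge> 1" for n x
    using norm_jacobian_remainder_le[OF diff[OF that] L[OF that], of x "\<theta>sn n"] zero_hn(1)[OF that]
    by (simp add: J_def)

  \<comment> \<open>Convergence of zeros and Jacobians, coercivity in the limit\<close>
  have dist_le: "norm (\<theta>s - \<theta>sn n) \<le> norm (hn n \<theta>s) / lam" if n: "n \<ge> 1" for n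
  proof -
    \<comment> \<open>Assumption (v), evaluated at \<open>\<theta>s\<close>, bounds the distance of
      the zeros by the size of \<open>hn n\<close> there.\<close>
    have "lam * (norm (\<theta>s - \<theta>sn n))\<^sup>2 \<le> norm (\<theta>s - \<theta>sn n) * norm (hn n \<theta>s)"
      using v(2)[OF n, of \<theta>s] norm_cauchy_schwarz order_trans by blast
    then have "norm (\<theta>s - \<theta>sn n) * (lam * norm (\<theta>s - \<theta>sn n)) \<le> norm (\<theta>s - \<theta>sn n) * norm (hn n \<theta>s)"
      by (simp add: power2_eq_square mult_ac)
    then have "lam * norm (\<theta>s - \<theta>sn n) \<le> norm (hn n \<theta>s)"
      by (cases "\<theta>s = \<theta>sn n") simp_all
    then show ?thesis using v(1) by (simp add: field_simps)
  qed
  have hn_lim: "(\<lambda>n. hn n \<theta>s) \<longlonglongrightarrow> 0"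
    using locally_uniform_limit_tendsto[OF i_conv(1), of \<theta>s] by (simp add: zero_h(1))
  have zeros_lim: "\<theta>sn \<longlonglongrightarrow> \<theta>s"
  proof -
    have "(\<lambda>n. norm (hn n \<theta>s) / lam) \<longlonglongrightarrow> norm (0 :: real ^ 'd) / lam"
      using v(1) by (intro tendsto_intros hn_lim) simp
    then have "(\<lambda>n. norm (hn n \<theta>s) / lam) \<longlonglongrightarrow> 0" by simp
    moreover have "\<forall>\<^sub>F n in sequentially. norm (\<theta>s - \<theta>sn n) \<le> norm (hn n \<theta>s) / lam"
      by (rule eventually_sequentiallyI[of 1]) (rule dist_le)
    ultimately have "(\<lambda>n. \<theta>s - \<theta>sn n) \<longlonglongrightarrow> 0"
      by (rule Lim_null_comparison[rotated])
    from tendsto_diff[OF tendsto_const[of \<theta>s] this] show ?thesis by simp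
  qed
  have J_lim: "J \<longlonglongrightarrow> A"
  proof -
    have "(\<lambda>n. J n - jacobian (hn n) (at \<theta>s)) \<longlonglongrightarrow> 0"
    proof (rule Lim_null_comparison)
      show "\<forall>\<^sub>F n in sequentially. norm (J n - jacobian (hn n) (at \<theta>s)) \<le> L * norm (\<theta>sn n - \<theta>s)"
      proof (rule eventually_sequentiallyI[of 1])
        fix n :: nat assume "1 \<le> n"
        from lipschitz_onD[OF L[OF this], of "\<theta>sn n" \<theta>s]
        show "norm (J n - jacobian (hn n) (at \<theta>s)) \<le> L * norm (\<theta>sn n - \<theta>s)" by (simp add: J_def dist_norm)
      qed
      show "(\<lambda>n. L * norm (\<theta>sn n - \<theta>s)) \<longlonglongrightarrow> 0"
        using tendsto_mult_right_zero[OF tendsto_norm_zero[OF LIM_zero[OF zeros_lim]]] .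
    qed
    from tendsto_add[OF this locally_uniform_limit_tendsto[OF i_conv(2), of \<theta>s]]
    show ?thesis by (simp add: A_def)
  qed
  have A_coercive: "x \<bullet> (A *v x) \<ge> lam * (norm x)\<^sup>2" for x
  proof (rule LIMSEQ_le_const)
    show "(\<lambda>n. x \<bullet> (J n *v x)) \<longlonglongrightarrow> x \<bullet> (A *v x)"
      by (rule bounded_linear.tendsto[OF bounded_linear_bilinear_form J_lim])
    show "\<exists>N. \<forall>n\<ge>N. lam * (norm x)\<^sup>2 \<le> x \<bullet> (J n *v x)"
      using coercive_linearisation[OF remainder v(2) L0] by blast
  qed

  \<comment> \<open>Uniform Hoelder and moment constants\<close>
  obtain b where b: "0 < b" "b \<le> 1" and hoelder_fin: "(SUP n\<in>{1..}. SUP (\<theta>, \<theta>')\<in>{(\<theta>, \<theta>'). \<theta> \<noteq> \<theta>'}.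
         (\<integral>\<^sup>+\<omega>. ennreal ((norm (H \<theta> (Useq n \<omega>) - H \<theta>' (Useq n \<omega>)))\<^sup>2) \<partial>M)
           / ennreal (norm (\<theta> - \<theta>') powr (2 * b))) < \<infinity>" (is "?S < \<infinity>")
    using iii by blast
  define Cb where "Cb = enn2real ?S"
  have Cb: "Cb \<ge> 0" "ennreal Cb = ?S" using hoelder_fin by (simp_all add: Cb_def less_top)
  have hoelder: "(\<integral>\<^sup>+\<omega>. ennreal ((norm (H x (Useq n \<omega>) - H y (Useq n \<omega>)))\<^sup>2) \<partial>M) \<le>
      ennreal (Cb * norm (x - y) powr (2 * b))" if n: "n \<ge> 1" for n x y
  \<comment> \<open>The supremum ranges over distinct arguments only; for equal ones the integral is
    0.\<close>
  proof (cases "x = y")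
    case False
    let ?I = "\<integral>\<^sup>+\<omega>. ennreal ((norm (H x (Useq n \<omega>) - H y (Useq n \<omega>)))\<^sup>2) \<partial>M" and ?d = "norm (x - y) powr (2 * b)"
    have d: "?d > 0" using False by simp
    have "?I / ennreal ?d \<le> ?S"
      using n False by (intro SUP_upper2[of n] SUP_upper2[of "(x, y)"]) auto
    then have "?I / ennreal ?d \<le> ennreal Cb" by (simp only: Cb)
    then have "?I / ennreal ?d * ennreal ?d \<le> ennreal Cb * ennreal ?d" by (rule mult_right_mono) simp
    moreover have "?I / ennreal ?d * ennreal ?d = ?I"
      using d by (simp add: ennreal_divide_times ennreal_divide_self)
    ultimately show ?thesis using Cb(1) by (simp add: ennreal_mult)
  qed simp

  obtain R where R: "R > 0" "\<And>n. norm (\<theta>sn n) \<le> R" "norm \<theta>s \<le> R"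
  proof -
    \<comment> \<open>Boundedness of a convergent sequence also covers \<open>\<theta>sn 0\<close>,
      whose value is arbitrary.\<close>
    obtain R' where "\<And>n. norm (\<theta>sn n) \<le> R'"
      using convergent_imp_Bseq[OF convergentI[OF zeros_lim]] by (auto simp: Bseq_def)
    then show thesis by (intro that[of "max 1 (max R' (norm \<theta>s))"]) (auto simp: le_max_iff_disj)
  qed
  obtain \<eta>' where \<eta>': "\<eta>' > 0" and moment_fin: "(SUP n\<in>{1..}. SUP \<theta>\<in>cball 0 R.
         \<integral>\<^sup>+\<omega>. ennreal (norm (H \<theta> (Useq n \<omega>)) powr (2 + \<eta>')) \<partial>M) < \<infinity>" (is "?T < \<infinity>")
    using iv_moment R(1) by blast
  \<comment> \<open>The second-order expansion of characteristic functions is made for exponents up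
    to 1.\<close>
  define \<eta> where "\<eta> = min \<eta>' 1"
  have \<eta>: "0 < \<eta>" "\<eta> \<le> 1" "\<eta> \<le> \<eta>'" using \<eta>' by (auto simp: \<eta>_def)
  define K0 where "K0 = enn2real ?T"
  have K0: "K0 \<ge> 0" "ennreal K0 = ?T" using moment_fin by (simp_all add: K0_def less_top)
  have moment0: "(\<integral>\<^sup>+\<omega>. ennreal (norm (H x (Useq n \<omega>)) powr (2 + \<eta>')) \<partial>M) \<le> ennreal K0"
    if "n \<ge> 1" "norm x \<le> R" for n x
    unfolding K0 using that by (intro SUP_upper2[of n] SUP_upper2[of x]) auto
  have H_meas: "(\<lambda>\<omega>. H x (Useq n \<omega>)) \<in> borel_measurable M" if "n \<ge> 1" for n x
    using measurable_compose[OF borel_measurable_Pair[OF borel_measurable_const Useq[OF that]] H_borel] by simp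
  \<comment> \<open>The 1 arises from \<open>x\<^sup>2 \<le> 1 + x powr (2 + \<eta>')\<close>, and
    likewise for \<open>x powr (2 + \<eta>)\<close>; so \<open>C0\<close> bounds both
    moments.\<close>
  define C0 where "C0 = 1 + K0"
  have C0: "C0 \<ge> 0" using K0 by (simp add: C0_def)
  have second: "(\<integral>\<^sup>+\<omega>. ennreal ((norm (H x (Useq n \<omega>)))\<^sup>2) \<partial>M) \<le> ennreal C0"
    if "n \<ge> 1" "norm x \<le> R" for n x
    unfolding C0_def
  proof (rule nn_integral_le_one_plus[OF M _ _ _ moment0[OF that] K0(1)])
    show "(\<lambda>\<omega>. norm (H x (Useq n \<omega>)) powr (2 + \<eta>')) \<in> borel_measurable M"
      using H_meas[OF that(1)] by measurable
    show "(norm (H x (Useq n \<omega>)))\<^sup>2 \<le> 1 + norm (H x (Useq n \<omega>)) powr (2 + \<eta>')" for \<omega>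
      using square_le_one_plus_powr[of \<eta>' "norm (H x (Useq n \<omega>))"] \<eta>' by simp
  qed simp
  have moment: "(\<integral>\<^sup>+\<omega>. ennreal (norm (H x (Useq n \<omega>)) powr (2 + \<eta>)) \<partial>M) \<le> ennreal C0"
    if "n \<ge> 1" "norm x \<le> R" for n x
    unfolding C0_def
  proof (rule nn_integral_le_one_plus[OF M _ _ _ moment0[OF that] K0(1)])
    show "(\<lambda>\<omega>. norm (H x (Useq n \<omega>)) powr (2 + \<eta>')) \<in> borel_measurable M"
      using H_meas[OF that(1)] by measurable
    show "norm (H x (Useq n \<omega>)) powr (2 + \<eta>) \<le> 1 + norm (H x (Useq n \<omega>)) powr (2 + \<eta>')" for \<omega>
      using \<eta> by (intro powr_le_one_plus_powr) auto
  qed simp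

  \<comment> \<open>Uniform bound on the initial errors\<close>
  define U0 where "U0 = enn2real (SUP n\<in>{1..}. \<integral>\<^sup>+\<omega>. ennreal ((norm (\<theta>0 n \<omega>))\<^sup>2) \<partial>M)"
  have U0: "U0 \<ge> 0" "ennreal U0 = (SUP n\<in>{1..}. \<integral>\<^sup>+\<omega>. ennreal ((norm (\<theta>0 n \<omega>))\<^sup>2) \<partial>M)"
    using \<theta>0_L2 by (simp_all add: U0_def less_top)
  have \<theta>0_le: "(\<integral>\<^sup>+\<omega>. ennreal ((norm (\<theta>0 n \<omega>))\<^sup>2) \<partial>M) \<le> ennreal U0" if "n \<ge> 1" for n
    unfolding U0 using that by (intro SUP_upper) simp
  have \<theta>0_int: "integrable M (\<lambda>\<omega>. (norm (\<theta>0 n \<omega>))\<^sup>2)" "(\<integral>\<omega>. (norm (\<theta>0 n \<omega>))\<^sup>2 \<partial>M) \<le> U0" if "n \<ge> 1" for n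
  proof -
    have "(\<lambda>\<omega>. (norm (\<theta>0 n \<omega>))\<^sup>2) \<in> borel_measurable M" using \<theta>0[OF that] by measurable
    from integrable_nn_bound[OF this _ \<theta>0_le[OF that] U0(1)]
    show "integrable M (\<lambda>\<omega>. (norm (\<theta>0 n \<omega>))\<^sup>2)" "(\<integral>\<omega>. (norm (\<theta>0 n \<omega>))\<^sup>2 \<partial>M) \<le> U0" by simp_all
  qed
  define u0 where "u0 = 2 * U0 + 2 * R\<^sup>2"
  have init: "(\<integral>\<omega>. (norm (\<theta>0 n \<omega> - \<theta>sn n))\<^sup>2 \<partial>M) \<le> u0" if n: "n \<ge> 1" for n
  proof -
    have bound: "(norm (\<theta>0 n \<omega> - \<theta>sn n))\<^sup>2 \<le> 2 * (norm (\<theta>0 n \<omega>))\<^sup>2 + 2 * R\<^sup>2" for \<omega>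
      using norm_diff_square_le[of "\<theta>0 n \<omega>" "\<theta>sn n"] power_mono[OF R(2)[of n] norm_ge_zero, of 2] by linarith
    have int: "integrable M (\<lambda>\<omega>. 2 * (norm (\<theta>0 n \<omega>))\<^sup>2 + 2 * R\<^sup>2)" using \<theta>0_int(1)[OF n] by simp
    have "(\<integral>\<omega>. (norm (\<theta>0 n \<omega> - \<theta>sn n))\<^sup>2 \<partial>M) \<le> (\<integral>\<omega>. 2 * (norm (\<theta>0 n \<omega>))\<^sup>2 + 2 * R\<^sup>2 \<partial>M)"
    proof (rule integral_mono[OF _ int bound])
      have [measurable]: "\<theta>0 n \<in> borel_measurable M" by (rule \<theta>0[OF n])
      show "integrable M (\<lambda>\<omega>. (norm (\<theta>0 n \<omega> - \<theta>sn n))\<^sup>2)"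
        by (rule Bochner_Integration.integrable_bound[OF int]) (use bound in auto)
    qed
    also have "\<dots> \<le> u0" using \<theta>0_int[OF n] by (simp add: u0_def M.prob_space)
    finally show ?thesis .
  qed

  have chain: "sa_contraction M H (Useq n) (V n) (\<theta>0 n) (hn n) (\<theta>sn n) lam C0 Cb b" if n: "n \<ge> 1" for n
    using M H_borel Useq[OF n] V_indep[OF n] V_law[OF n] \<theta>0[OF n] \<theta>0_indep[OF n] hn[OF n] zero_hn(1)[OF n]
      v(1) v(2)[OF n] b C0 Cb(1) second[OF n R(2)] hoelder[OF n] \<theta>0_int(1)[OF n]
    by (intro sa_contraction.intro sa_chain.intro sa_chain_axioms.intro sa_contraction_axioms.intro)

  \<comment> \<open>Convergence of the innovation covariance\<close>
  have \<Gamma>: "psd \<Gamma>"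
    using ii_posdef unfolding positive_definite_def psd_def \<Gamma>_def
    by (metis inner_zero_left less_imp_le order.refl)
  \<comment> \<open>The argument is first moved from \<open>\<theta>sn n\<close> to
    \<open>\<theta>s\<close> by the Hoelder bound, uniformly in \<open>n\<close>; then (iv) applies
    at a fixed point.\<close>
  have cov: "(\<lambda>n. second_moment M H (Useq n) (\<theta>sn n)) \<longlonglongrightarrow> \<Gamma>"
  proof -
    define c where "c = (real CARD('d))\<^sup>2"
    \<comment> \<open>Balances Young's inequality: the mean squared difference has order
      \<open>norm (\<theta>sn n - \<theta>s) powr (2 * b)\<close>, so dividing by \<open>t n\<close>
      leaves the exponent \<open>b\<close>. The second summand keeps \<open>t n\<close> positive
      when the zeros coincide.\<close>
    define t where "t n = norm (\<theta>sn n - \<theta>s) powr b + 1 / real (Suc n)" for n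
    have "(\<lambda>n. second_moment M H (Useq n) (\<theta>sn n) - second_moment M H (Useq n) \<theta>s) \<longlonglongrightarrow> 0"
    proof (rule Lim_null_comparison)
      have z: "(\<lambda>n. norm (\<theta>sn n - \<theta>s) powr b) \<longlonglongrightarrow> 0"
        using tendsto_powr'[OF tendsto_norm_zero[OF LIM_zero[OF zeros_lim]] tendsto_const, of b] b by simp
      have "t \<longlonglongrightarrow> 0 + 0"
        unfolding t_def[abs_def] by (intro tendsto_add z LIMSEQ_inverse_real_of_nat[unfolded inverse_eq_divide])
      then have "(\<lambda>n. c * (Cb * norm (\<theta>sn n - \<theta>s) powr b + 2 * t n * (C0 + C0))) \<longlonglongrightarrow> c * (Cb * 0 + 2 * 0 * (C0 + C0))"
        using z by (intro tendsto_intros) simp_all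
      then show "(\<lambda>n. c * (Cb * norm (\<theta>sn n - \<theta>s) powr b + 2 * t n * (C0 + C0))) \<longlonglongrightarrow> 0" by simp
      show "\<forall>\<^sub>F n in sequentially. norm (second_moment M H (Useq n) (\<theta>sn n) - second_moment M H (Useq n) \<theta>s) \<le>
          c * (Cb * norm (\<theta>sn n - \<theta>s) powr b + 2 * t n * (C0 + C0))"
      proof (rule eventually_sequentiallyI[of 1])
        fix n :: nat assume n: "1 \<le> n"
        let ?Y = "\<lambda>\<omega>. H (\<theta>sn n) (Useq n \<omega>)" and ?Z = "\<lambda>\<omega>. H \<theta>s (Useq n \<omega>)"
        note [measurable] = H_meas[OF n]
        have t: "t n > 0" by (simp add: t_def add_nonneg_pos)
        have Y: "integrable M (\<lambda>\<omega>. (norm (?Y \<omega>))\<^sup>2)" "(\<integral>\<omega>. (norm (?Y \<omega>))\<^sup>2 \<partial>M) \<le> C0"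
          using integrable_nn_bound[OF _ _ second[OF n R(2)] C0] by simp_all
        have Z: "integrable M (\<lambda>\<omega>. (norm (?Z \<omega>))\<^sup>2)" "(\<integral>\<omega>. (norm (?Z \<omega>))\<^sup>2 \<partial>M) \<le> C0"
          using integrable_nn_bound[OF _ _ second[OF n R(3)] C0] by simp_all
        have D: "integrable M (\<lambda>\<omega>. (norm (?Y \<omega> - ?Z \<omega>))\<^sup>2)"
          "(\<integral>\<omega>. (norm (?Y \<omega> - ?Z \<omega>))\<^sup>2 \<partial>M) \<le> Cb * norm (\<theta>sn n - \<theta>s) powr (2 * b)"
          using integrable_nn_bound[OF _ _ hoelder[OF n, of "\<theta>sn n" \<theta>s]] Cb(1) by simp_all
        let ?r = "norm (\<theta>sn n - \<theta>s) powr b"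
        have "(\<integral>\<omega>. (norm (?Y \<omega> - ?Z \<omega>))\<^sup>2 \<partial>M) / t n \<le> Cb * (?r * ?r) / t n"
          using D(2) t by (intro divide_right_mono) (simp_all add: powr_add[symmetric])
        also have "\<dots> \<le> Cb * ?r"
        proof -
          have "?r * ?r \<le> ?r * t n" by (intro mult_left_mono) (simp_all add: t_def)
          then have "Cb * (?r * ?r) \<le> Cb * (?r * t n)" using Cb(1) by (rule mult_left_mono)
          then show ?thesis using t by (simp add: field_simps)
        qed
        finally have D': "(\<integral>\<omega>. (norm (?Y \<omega> - ?Z \<omega>))\<^sup>2 \<partial>M) / t n \<le> Cb * ?r" .
        have "norm ((\<integral>\<omega>. outer (?Y \<omega>) \<partial>M) - (\<integral>\<omega>. outer (?Z \<omega>) \<partial>M)) \<le> c *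
           ((\<integral>\<omega>. (norm (?Y \<omega> - ?Z \<omega>))\<^sup>2 \<partial>M) / t n + 2 * t n * ((\<integral>\<omega>. (norm (?Y \<omega>))\<^sup>2 \<partial>M) + (\<integral>\<omega>. (norm (?Z \<omega>))\<^sup>2 \<partial>M)))"
          unfolding c_def by (rule norm_expectation_outer_diff_le[OF _ _ Y(1) Z(1) D(1) t]) measurable
        also have "\<dots> \<le> c * (Cb * ?r + 2 * t n * (C0 + C0))"
          using t Y(2) Z(2) D' by (intro mult_left_mono add_mono) (simp_all add: c_def)
        finally show "norm (second_moment M H (Useq n) (\<theta>sn n) - second_moment M H (Useq n) \<theta>s) \<le>
          c * (Cb * ?r + 2 * t n * (C0 + C0))" by (simp only: second_moment_def)
      qed
    qed
    from tendsto_add[OF this locally_uniform_limit_tendsto[OF iv_conv, of \<theta>s]]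
    show ?thesis by (simp add: \<Gamma>_def)
  qed

  \<comment> \<open>Uniform drift expansion and limit of the bias\<close>
  define \<epsilon> where "\<epsilon> n = norm (J n - A)" for n
  have \<epsilon>: "\<epsilon> n \<ge> 0" "\<epsilon> \<longlonglongrightarrow> 0" for n
    using tendsto_norm_zero[OF LIM_zero[OF J_lim]] by (simp_all add: \<epsilon>_def[abs_def])
  have drift: "norm (hn n x - A *v (x - \<theta>sn n)) \<le> \<epsilon> n * norm (x - \<theta>sn n) + L * (norm (x - \<theta>sn n))\<^sup>2"
    if "n \<ge> 1" for n x
  proof -
    have "hn n x - A *v (x - \<theta>sn n) = (J n - A) *v (x - \<theta>sn n) + (hn n x - J n *v (x - \<theta>sn n))"
      by (simp add: matrix_vector_mult_diff_rdistrib)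
    also have "norm \<dots> \<le> \<epsilon> n * norm (x - \<theta>sn n) + L * (norm (x - \<theta>sn n))\<^sup>2"
      unfolding \<epsilon>_def by (intro norm_triangle_le add_mono norm_matrix_vector_mult_le remainder that)
    finally show ?thesis .
  qed

  define e where "e = discretization_error hn h \<alpha> \<theta>s"
  have e: "(\<lambda>n. (real n powr \<alpha>) *\<^sub>R hn n \<theta>s) \<longlonglongrightarrow> e"
    using i_error[of \<theta>s] unfolding convergent_LIMSEQ_iff e_def discretization_error_def by (simp add: zero_h(1))
  have bias: "(\<lambda>n. (real n powr \<alpha>) *\<^sub>R (\<theta>sn n - \<theta>s)) \<longlonglongrightarrow> - (matrix_inv A *v e)"
  proof -
    define y where "y n = (real n powr \<alpha>) *\<^sub>R (\<theta>sn n - \<theta>s)" for n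
    have scaled: "norm (y n) \<le> norm ((real n powr \<alpha>) *\<^sub>R hn n \<theta>s) / lam" if "n \<ge> 1" for n
      using mult_left_mono[OF dist_le[OF that], of "real n powr \<alpha>"] by (simp add: y_def norm_minus_commute)
    have rhs0: "(\<lambda>n. (norm ((real n powr \<alpha>) *\<^sub>R hn n \<theta>s) / lam) * (\<epsilon> n + L * norm (\<theta>s - \<theta>sn n))) \<longlonglongrightarrow> (norm e / lam) * (0 + L * norm (\<theta>s - \<theta>s))"
      using v(1) by (intro tendsto_intros e \<epsilon>(2) zeros_lim) simp
    \<comment> \<open>Expands \<open>hn n\<close> about its own zero and evaluates at
      \<open>\<theta>s\<close>. The error is a bounded factor, as the scaled
      \<open>hn n \<theta>s\<close> converges, times a null sequence.\<close>
    have "(\<lambda>n. (real n powr \<alpha>) *\<^sub>R hn n \<theta>s + A *v y n) \<longlonglongrightarrow> 0"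
    proof (rule Lim_null_comparison)
      show "(\<lambda>n. (norm ((real n powr \<alpha>) *\<^sub>R hn n \<theta>s) / lam) * (\<epsilon> n + L * norm (\<theta>s - \<theta>sn n))) \<longlonglongrightarrow> 0"
        using rhs0 by simp
      show "\<forall>\<^sub>F n in sequentially. norm ((real n powr \<alpha>) *\<^sub>R hn n \<theta>s + A *v y n) \<le>
          (norm ((real n powr \<alpha>) *\<^sub>R hn n \<theta>s) / lam) * (\<epsilon> n + L * norm (\<theta>s - \<theta>sn n))"
      proof (rule eventually_sequentiallyI[of 1])
        fix n :: nat assume n: "1 \<le> n"
        let ?r = "real n powr \<alpha>"
        have "A *v y n = - (?r *\<^sub>R (A *v (\<theta>s - \<theta>sn n)))"
          by (simp add: y_def matrix_vector_mult_scaleR matrix_vector_mult_diff_distrib scaleR_right_diff_distrib)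
        then have "norm (?r *\<^sub>R hn n \<theta>s + A *v y n) = ?r * norm (hn n \<theta>s - A *v (\<theta>s - \<theta>sn n))"
          by (simp add: scaleR_right_diff_distrib[symmetric])
        also have "\<dots> \<le> ?r * (\<epsilon> n * norm (\<theta>s - \<theta>sn n) + L * (norm (\<theta>s - \<theta>sn n))\<^sup>2)"
          by (intro mult_left_mono drift n) simp
        also have "\<dots> = norm (y n) * (\<epsilon> n + L * norm (\<theta>s - \<theta>sn n))"
        proof -
          have "norm (y n) = ?r * norm (\<theta>s - \<theta>sn n)" by (simp add: y_def norm_minus_commute)
          then show ?thesis by (simp only: power2_eq_square) (simp add: distrib_left mult_ac)
        qed
        also have "\<dots> \<le> (norm (?r *\<^sub>R hn n \<theta>s) / lam) * (\<epsilon> n + L * norm (\<theta>s - \<theta>sn n))"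
          using \<epsilon>(1)[of n] L0 by (intro mult_right_mono scaled n) simp
        finally show "norm (?r *\<^sub>R hn n \<theta>s + A *v y n) \<le> (norm (?r *\<^sub>R hn n \<theta>s) / lam) * (\<epsilon> n + L * norm (\<theta>s - \<theta>sn n))" .
      qed
    qed
    from tendsto_diff[OF this e] have "(\<lambda>n. A *v y n) \<longlonglongrightarrow> - e" by simp
    then have "(\<lambda>n. matrix_inv A *v (A *v y n)) \<longlonglongrightarrow> matrix_inv A *v (- e)"
      by (rule bounded_linear.tendsto[OF matrix_vector_mul_bounded_linear])
    moreover have "matrix_inv A *v (A *v y n) = y n" for n
    proof -
      have "\<exists>B. A ** B = mat 1 \<and> B ** A = mat 1" using i_nonsing by (simp add: A_def invertible_def)
      then have "matrix_inv A ** A = mat 1" unfolding matrix_inv_def by (rule someI2_ex) simp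
      then show ?thesis by (simp add: matrix_vector_mul_assoc)
    qed
    moreover have "matrix_inv A *v (- e) = - (matrix_inv A *v e)"
      using matrix_vector_mult_diff_distrib[of "matrix_inv A" 0 e] by simp
    ultimately show ?thesis by (simp add: y_def)
  qed

  \<comment> \<open>Step regimes and the number of steps\<close>
  obtain \<kappa> \<rho> where steps: "step_sequence (\<lambda>k. \<gamma> (real k)) \<kappa> \<zeta>" and rates: "\<kappa> < 2 * lam" "\<zeta> < lam"
    and rv: "regularly_varying \<gamma> \<rho>"
    using vii_HS
  \<comment> \<open>Under (HS1) any \<kappa> strictly between 0 and \<open>2 * lam\<close> would do,
    and \<open>lam\<close> is taken. Under (HS2) both \<open>1 / \<gamma>0 < 2 * lam\<close> and
    \<open>\<zeta> < lam\<close> restate \<open>1 < 2 * lam * \<gamma>0\<close>.\<close>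
  proof (elim disjE exE conjE)
    fix a assume a: "0 \<le> a" "a < 1" "regularly_varying \<gamma> (- a)" "\<zeta> = 0"
    have "step_sequence (\<lambda>k. \<gamma> (real k)) lam 0"
      by (rule step_sequence_subharmonic[OF vii_pos vii_decr a(3,2) v(1)])
    then show thesis using a v(1) by (intro that[of lam "- a"]) simp_all
  next
    fix \<gamma>0 assume \<gamma>0: "\<forall>t\<ge>1. \<gamma> t = \<gamma>0 / t" "1 < 2 * lam * \<gamma>0" "\<zeta> = 1 / (2 * \<gamma>0)"
    have pos: "\<gamma>0 > 0" using \<gamma>0(1)[rule_format, of 1] vii_pos[of 1] by simp
    have steps: "step_sequence (\<lambda>k. \<gamma> (real k)) (1 / \<gamma>0) (1 / (2 * \<gamma>0))"
      by (rule step_sequence_harmonic[OF vii_pos vii_decr]) (use \<gamma>0 in auto)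
    have "1 / \<gamma>0 < 2 * lam" "\<zeta> < lam" "regularly_varying \<gamma> (- 1)"
      using pos \<gamma>0(2) regularly_varying_harmonic[of \<gamma> \<gamma>0] \<gamma>0(1) unfolding \<gamma>0(3) by (simp_all add: field_simps)
    with steps show thesis unfolding \<gamma>0(3)[symmetric] by (rule that)
  qed

  define N where "N n = nat \<lfloor>decreasing_inverse \<gamma> (1 / real n powr (2 * \<alpha>))\<rfloor>" for n
  have level: "\<forall>\<^sub>F n in sequentially. 1 / real n powr (2 * \<alpha>) > 0" "(\<lambda>n. 1 / real n powr (2 * \<alpha>)) \<longlonglongrightarrow> 0"
  proof -
    show "\<forall>\<^sub>F n in sequentially. 1 / real n powr (2 * \<alpha>) > 0"
      by (rule eventually_sequentiallyI[of 1]) simp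
    have "(\<lambda>n. real n powr (- (2 * \<alpha>))) \<longlonglongrightarrow> 0"
      using \<alpha> by (intro tendsto_neg_powr filterlim_real_sequentially) simp
    then show "(\<lambda>n. 1 / real n powr (2 * \<alpha>)) \<longlonglongrightarrow> 0" by (simp add: powr_minus_divide)
  qed
  have N: "filterlim N at_top sequentially"
    unfolding N_def by (rule decreasing_inverse_asymptotics(1)[OF vii_pos vii_decr rv level])
  have "(\<lambda>n. \<gamma> (real (N n)) / (1 / real n powr (2 * \<alpha>))) \<longlonglongrightarrow> 1"
    unfolding N_def by (rule decreasing_inverse_asymptotics(2)[OF vii_pos vii_decr rv level])
  then have scale: "(\<lambda>n. (real n powr \<alpha>)\<^sup>2 * \<gamma> (real (N n))) \<longlonglongrightarrow> 1"
    by (simp add: power2_eq_square powr_add[symmetric] mult.commute)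

  \<comment> \<open>Application of the limit theorem\<close>
  have "u0 \<ge> 0" using U0(1) by (simp add: u0_def)
  then have "sa_rates (\<lambda>k. \<gamma> (real k)) \<kappa> \<zeta> \<gamma> A \<Gamma> lam C0 Cb b u0 L \<eta> C0"
    by (intro sa_rates.intro sa_rates_axioms.intro steps rates v(1) A_coercive \<Gamma> b C0 Cb(1) L0 \<eta>(1,2) refl)
  then interpret sa_rates "\<lambda>k. \<gamma> (real k)" \<kappa> \<zeta> \<gamma> A \<Gamma> lam C0 Cb b u0 L \<eta> C0 .

  have moment_int: "integrable M (\<lambda>\<omega>. norm (H (\<theta>sn n) (Useq n \<omega>)) powr (2 + \<eta>))"
    "(\<integral>\<omega>. norm (H (\<theta>sn n) (Useq n \<omega>)) powr (2 + \<eta>) \<partial>M) \<le> C0" if n: "n \<ge> 1" for n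
  proof -
    have "(\<lambda>\<omega>. norm (H (\<theta>sn n) (Useq n \<omega>)) powr (2 + \<eta>)) \<in> borel_measurable M"
      using H_meas[OF n] by measurable
    from integrable_nn_bound[OF this _ moment[OF n R(2)] C0]
    show "integrable M (\<lambda>\<omega>. norm (H (\<theta>sn n) (Useq n \<omega>)) powr (2 + \<eta>))"
      "(\<integral>\<omega>. norm (H (\<theta>sn n) (Useq n \<omega>)) powr (2 + \<eta>) \<partial>M) \<le> C0" by simp_all
  qed

  text \<open>Nothing is assumed about the index \<open>0\<close>, hence the shift.\<close>
  define law where "law n = distr M borel (\<lambda>\<omega>. (real n powr \<alpha>) *\<^sub>R
       (sa_scheme \<gamma> H (\<theta>0 n) (V n) (N n) \<omega> - \<theta>s))" for n
  have "conv_in_law (\<lambda>n. law (Suc n)) (gaussian (- (matrix_inv A *v e)) (asymptotic_covariance A \<Gamma> \<zeta>))"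
    unfolding law_def
  proof (rule conv_in_law_gaussian)
    show "sa_contraction M H (Useq (Suc n)) (V (Suc n)) (\<theta>0 (Suc n)) (hn (Suc n)) (\<theta>sn (Suc n)) lam C0 Cb b" for n
      by (rule chain) simp
    show "(\<integral>\<omega>. (norm (\<theta>0 (Suc n) \<omega> - \<theta>sn (Suc n)))\<^sup>2 \<partial>M) \<le> u0" for n by (rule init) simp
    show "norm (hn (Suc n) x - A *v (x - \<theta>sn (Suc n))) \<le> \<epsilon> (Suc n) * norm (x - \<theta>sn (Suc n)) + L * (norm (x - \<theta>sn (Suc n)))\<^sup>2" for n x
      by (rule drift) simp
    show "(\<lambda>n. \<epsilon> (Suc n)) \<longlonglongrightarrow> 0" by (rule LIMSEQ_Suc[OF \<epsilon>(2)])
    show "integrable M (\<lambda>\<omega>. norm (H (\<theta>sn (Suc n)) (Useq (Suc n) \<omega>)) powr (2 + \<eta>))"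
      "(\<integral>\<omega>. norm (H (\<theta>sn (Suc n)) (Useq (Suc n) \<omega>)) powr (2 + \<eta>) \<partial>M) \<le> C0" for n
      by (rule moment_int, simp)+
    show "(\<lambda>n. second_moment M H (Useq (Suc n)) (\<theta>sn (Suc n))) \<longlonglongrightarrow> \<Gamma>" by (rule LIMSEQ_Suc[OF cov])
    show "filterlim (\<lambda>n. N (Suc n)) at_top sequentially"
      using N by (simp add: filterlim_sequentially_Suc)
    show "(\<lambda>n. (real (Suc n) powr \<alpha>)\<^sup>2 * \<gamma> (real (N (Suc n)))) \<longlonglongrightarrow> 1" by (rule LIMSEQ_Suc[OF scale])
    show "(\<lambda>n. (real (Suc n) powr \<alpha>) *\<^sub>R (\<theta>sn (Suc n) - \<theta>s)) \<longlonglongrightarrow> - (matrix_inv A *v e)"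
      by (rule LIMSEQ_Suc[OF bias])
  qed (use \<epsilon>(1) in auto)
  from conv_in_law_SucD[OF this] show ?thesis
    unfolding law_def[abs_def] A_def \<Gamma>_def e_def N_def .
qed

end
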